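(* Let $K$ be an algebraically closed field of characteristic zero, complete with respect to a nontrivial non-Archimedean absolute value $|\cdot|_K$. Let $\{f_t(z)\}\subset K(z)$ be an analytic family of degree $d\ge 2$ rational maps. Then there are at most $2d-2$ pairwise dynamically independent rescalings for $\{f_t\}$ such that the corresponding rescaling limits are not postcritically finite.
   Context: **Analytic families.** $\mathrm{Rat}_d(K)$ is the set of degree $d$ rational maps over $K$, viewed as a subset of $\mathbb{P}^{2d+1}(K)$ via coefficients. Let $U\subset K$ be a disk containing $0$; since only the germ at $t=0$ matters, $U$ may be shrunk and taken to be a closed disk $\overline{D}(0,r)$ with $r\in|K^\times|_K$. As $\mathrm{char}\,K=0$, every nonconstant rational map is separable. An analytic family of degree $d\ge1$ rational maps is a collection $\{f_t\}_{t\in U}\subset\mathbb{P}^{2d+1}(K)$ such that $t\mapsto f_t$ is analytic (its homogeneous coordinates are given by power series in $t$ with coefficients in $K$ converging on $U$) and $f_t\in\mathrm{Rat}_d(K)$ for all $t\neq0$. A moving frame $\{M_t\}$ is an analytic family of degree $1$ rational maps. **Rescalings.** Let $\{f_t\}$ be an analytic family of degree at least $2$. A moving frame $\{M_t\}$ is a rescaling for $\{f_t\}$ if there exist an integer $q\ge1$, a rational map $g:\mathbb{P}^1(K)\to\mathbb{P}^1(K)$ of degree at least $2$ and a finite set $S\subset\mathbb{P}^1(K)$ such that, as $t\to0$, $M_t^{-1}\circ f_t^q\circ M_t(z)\to g(z)$ pointwise for $z\in\mathbb{P}^1(K)\setminus S$ (here $f_t^q$ is the $q$-th iterate, and convergence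 is in $\mathbb{P}^1(K)$ with the topology induced by $|\cdot|_K$). Then $g$ is the corresponding rescaling limit, and the minimal such $q$ is the period of the rescaling. Two rescalings $\{M_t\}$, $\{L_t\}$ for $\{f_t\}$ are dynamically dependent if there exist an integer $l\ge0$ and a nonconstant rational map $g$ over $K$ such that $L_t^{-1}\circ f_t^l\circ M_t\to g$ as $t\to0$ pointwise outside some finite set; otherwise they are dynamically independent. A rational map $g$ is postcritically finite if every critical point of $g$ has a finite forward orbit under $g$. *)

theory Defs
  imports "HOL-Analysis.Analysis"
begin

text \<open>
  A field with a nontrivial non-Archimedean absolute value. The library classes of normed fields
  extend \<^class>\<open>real_vector\<close> and hence only cover Archimedean fields. Completeness is
  expressed by the library class \<^class>\<open>complete_space\<close>.
\<close>

class nonarch_field = field + metric_space +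
  fixes absval :: "'a \<Rightarrow> real"
  assumes dist_absval: "dist x y = absval (x - y)"
    and absval_eq_0_iff: "absval x = 0 \<longleftrightarrow> x = 0"
    and absval_mult: "absval (x * y) = absval x * absval y"
    and absval_ultrametric: "absval (x + y) \<le> max (absval x) (absval y)"
    and absval_nontrivial: "\<exists>x. x \<noteq> 0 \<and> absval x \<noteq> 1"
begin

lemma absval_nonneg: "absval x \<ge> 0"
  using zero_le_dist[of x 0] by (simp add: dist_absval)

end


section \<open>The projective line\<close>

datatype 'a pline = Fin 'a | Infty

text \<open>
  \<open>of_hom (x, y)\<close> is the point $[x:y]$ for $(x,y) \neq (0,0)$; the value at \<open>(0, 0)\<close>
  is irrelevant. \<open>hom_coords\<close> chooses homogeneous coordinates of a point.
\<close>

fun of_hom :: "'a::field \<times> 'a \<Rightarrow> 'a pline" where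
  "of_hom (x, y) = (if y = 0 then Infty else Fin (x / y))"

fun hom_coords :: "'a::field pline \<Rightarrow> 'a \<times> 'a" where
  "hom_coords (Fin z) = (z, 1)"
| "hom_coords Infty = (1, 0)"

definition hom_norm :: "'a::nonarch_field \<times> 'a \<Rightarrow> real" where
  "hom_norm v = max (absval (fst v)) (absval (snd v))"

definition hom_wedge :: "'a::field \<times> 'a \<Rightarrow> 'a \<times> 'a \<Rightarrow> 'a" where
  "hom_wedge v w = fst v * snd w - snd v * fst w"

lemma hom_norm_coords_pos: "hom_norm (hom_coords x) > 0"
proof -
  have "absval (1::'a) > 0"
    using absval_nonneg[of "1::'a"] absval_eq_0_iff[of "1::'a"] by simp
  then show ?thesis by (cases x) (auto simp: hom_norm_def less_max_iff_disj)
qed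

lemma hom_wedge_triangle:
  fixes u v w :: "'a::nonarch_field \<times> 'a"
  shows "absval (hom_wedge u w) * hom_norm v
    \<le> max (absval (hom_wedge u v) * hom_norm w) (absval (hom_wedge v w) * hom_norm u)" (is "_ \<le> ?B")
proof -
  have *: "absval (hom_wedge u w) * absval (\<pi> v) \<le> ?B"
    if \<pi>: "\<pi> = fst \<or> \<pi> = snd" for \<pi> :: "'a \<times> 'a \<Rightarrow> 'a"
  proof -
    have "hom_wedge u w * \<pi> v = hom_wedge u v * \<pi> w + hom_wedge v w * \<pi> u"
      using \<pi> by (auto simp: hom_wedge_def algebra_simps)
    then have "absval (hom_wedge u w) * absval (\<pi> v)
        \<le> max (absval (hom_wedge u v) * absval (\<pi> w)) (absval (hom_wedge v w) * absval (\<pi> u))"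
      by (metis absval_mult absval_ultrametric)
    also have "absval (\<pi> w) \<le> hom_norm w" "absval (\<pi> u) \<le> hom_norm u"
      using \<pi> by (auto simp: hom_norm_def)
    then have "max (absval (hom_wedge u v) * absval (\<pi> w)) (absval (hom_wedge v w) * absval (\<pi> u)) \<le> ?B"
      by (intro max.mono mult_left_mono absval_nonneg)
    finally show ?thesis .
  qed
  show ?thesis
    using *[of fst] *[of snd] by (simp add: hom_norm_def[of v] max_def split: if_splits)
qed

text \<open>
  The topology of $\mathbb{P}^1(K)$ is that of the chordal metric
  $|x_0 y_1 - x_1 y_0| / (\max(|x_0|,|x_1|) \max(|y_0|,|y_1|))$.
\<close>

instantiation pline :: (nonarch_field) metric_space
begin

definition dist_pline :: "'a pline \<Rightarrow> 'a pline \<Rightarrow> real" where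
  "dist_pline x y = absval (hom_wedge (hom_coords x) (hom_coords y))
     / (hom_norm (hom_coords x) * hom_norm (hom_coords y))"

definition uniformity_pline :: "('a pline \<times> 'a pline) filter" where
  "uniformity_pline = (INF e\<in>{0<..}. principal {(x, y). dist x y < e})"

definition open_pline :: "'a pline set \<Rightarrow> bool" where
  "open_pline U \<longleftrightarrow> (\<forall>x\<in>U. eventually (\<lambda>(x', y). x' = x \<longrightarrow> y \<in> U) uniformity)"

instance
proof
  show "uniformity = (INF e\<in>{0<..}. principal {(x, y). dist (x::'a pline) y < e})"
    by (rule uniformity_pline_def)
  show "open U \<longleftrightarrow> (\<forall>x\<in>U. eventually (\<lambda>(x', y). x' = x \<longrightarrow> y \<in> U) uniformity)"
    for U :: "'a pline set" by (rule open_pline_def)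
  show "dist x y = 0 \<longleftrightarrow> x = y" for x y :: "'a pline"
    using hom_norm_coords_pos[of x] hom_norm_coords_pos[of y]
    by (cases x; cases y) (auto simp: dist_pline_def hom_wedge_def absval_eq_0_iff)
  show "dist x y \<le> dist x z + dist y z" for x y z :: "'a pline"
  proof -
    let ?c = hom_coords and ?n = "\<lambda>x. hom_norm (hom_coords x)"
    have pos: "?n x > 0" "?n y > 0" "?n z > 0" by (simp_all add: hom_norm_coords_pos)
    have "absval (1::'a) * absval (1::'a) = absval (1::'a)" using absval_mult[of "1::'a" 1] by simp
    then have one: "absval (1::'a) = 1" using absval_eq_0_iff[of "1::'a"] by auto
    have "absval (-1::'a) * absval (-1::'a) = 1" using absval_mult[of "-1::'a" "-1"] one by simp
    then have minus_one: "absval (-1::'a) = 1"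
      using absval_nonneg[of "-1::'a"] by (metis abs_of_nonneg real_sqrt_abs2 real_sqrt_one)
    have "hom_wedge (?c z) (?c y) = -1 * hom_wedge (?c y) (?c z)"
      by (simp add: hom_wedge_def algebra_simps)
    then have sym: "absval (hom_wedge (?c z) (?c y)) = absval (hom_wedge (?c y) (?c z))"
      using absval_mult minus_one by (metis mult_1)
    have "absval (hom_wedge (?c x) (?c y)) * ?n z
        \<le> max (absval (hom_wedge (?c x) (?c z)) * ?n y) (absval (hom_wedge (?c y) (?c z)) * ?n x)"
      using hom_wedge_triangle[of "?c x" "?c y" "?c z"] sym by simp
    also have "\<dots> \<le> absval (hom_wedge (?c x) (?c z)) * ?n y + absval (hom_wedge (?c y) (?c z)) * ?n x"
      using pos by (simp add: absval_nonneg less_imp_le)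
    finally show ?thesis using pos by (simp add: dist_pline_def field_simps)
  qed
qed

end


section \<open>Rational maps\<close>

text \<open>
  A pair \<open>(p, q)\<close> stands for the map $[p:q]$. A point of $\mathbb{P}^{2d+1}(K)$ is given by
  homogeneous coordinates, that is, by a pair \<open>(p, q) \<noteq> (0, 0)\<close> of polynomials of degree at
  most $d$, up to a common scalar. It lies in $\mathrm{Rat}_d(K)$ iff \<open>p\<close>, \<open>q\<close> are coprime
  and one of them has degree exactly $d$.
\<close>

type_synonym 'a rat_coords = "'a poly \<times> 'a poly"

definition rat_degree :: "'a::field rat_coords \<Rightarrow> nat" where
  "rat_degree f = max (degree (fst f)) (degree (snd f))"

definition rational_map :: "'a::field rat_coords \<Rightarrow> bool" where
  "rational_map f \<longleftrightarrow> coprime (fst f) (snd f)"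

definition Rat :: "nat \<Rightarrow> 'a::field rat_coords set" where
  "Rat d = {f. rational_map f \<and> rat_degree f = d}"

fun rat_eval :: "'a::field rat_coords \<Rightarrow> 'a pline \<Rightarrow> 'a pline" where
  "rat_eval f (Fin z) = of_hom (poly (fst f) z, poly (snd f) z)"
| "rat_eval f Infty = of_hom (coeff (fst f) (rat_degree f), coeff (snd f) (rat_degree f))"

text \<open>
  The local degree of $f = [p:q]$ at $c$, where $f(c) = [w_0:w_1]$, is the order of vanishing at $c$
  of the form of degree $\deg f$ obtained by homogenizing $w_1 p - w_0 q$. It is only meaningful for
  nonconstant \<open>f\<close>.
\<close>

definition local_degree :: "'a::field rat_coords \<Rightarrow> 'a pline \<Rightarrow> nat" where
  "local_degree f c =
     (let (w0, w1) = hom_coords (rat_eval f c);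
          h = smult w1 (fst f) - smult w0 (snd f)
      in case c of Fin z \<Rightarrow> order z h | Infty \<Rightarrow> rat_degree f - degree h)"

definition critical_point :: "'a::field rat_coords \<Rightarrow> 'a pline \<Rightarrow> bool" where
  "critical_point f c \<longleftrightarrow> local_degree f c \<ge> 2"

definition postcritically_finite :: "'a::field rat_coords \<Rightarrow> bool" where
  "postcritically_finite f \<longleftrightarrow>
     (\<forall>c. critical_point f c \<longrightarrow> finite (range (\<lambda>n. (rat_eval f ^^ n) c)))"


section \<open>Analytic families and rescalings\<close>

text \<open>
  A family is given by homogeneous coordinates of its members. Only its values on some closed disk
  around 0 matter, and each family comes with its own disk.
\<close>

definition analytic_family :: "nat \<Rightarrow> ('a::nonarch_field \<Rightarrow> 'a rat_coords) \<Rightarrow> bool" where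
  "analytic_family d f \<longleftrightarrow>
     (\<exists>r \<in> absval ` (- {0::'a}). \<exists>a b :: nat \<Rightarrow> nat \<Rightarrow> 'a. \<forall>t. absval t \<le> r \<longrightarrow>
        (\<forall>i\<le>d. (\<lambda>n. a i n * t ^ n) sums coeff (fst (f t)) i) \<and>
        (\<forall>i\<le>d. (\<lambda>n. b i n * t ^ n) sums coeff (snd (f t)) i) \<and>
        rat_degree (f t) \<le> d \<and> f t \<noteq> (0, 0) \<and> (t \<noteq> 0 \<longrightarrow> f t \<in> Rat d))"

definition moving_frame :: "('a::nonarch_field \<Rightarrow> 'a rat_coords) \<Rightarrow> bool" where
  "moving_frame M \<longleftrightarrow> analytic_family 1 M"

text \<open>$L_t^{-1} \circ f_t^n \circ M_t \to g$ pointwise outside a finite set\<close>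

definition frame_limit ::
  "('a::nonarch_field \<Rightarrow> 'a rat_coords) \<Rightarrow> ('a \<Rightarrow> 'a rat_coords) \<Rightarrow> ('a \<Rightarrow> 'a rat_coords)
     \<Rightarrow> nat \<Rightarrow> 'a rat_coords \<Rightarrow> bool" where
  "frame_limit f M L n g \<longleftrightarrow>
     (\<exists>S. finite S \<and> (\<forall>z. z \<notin> S \<longrightarrow>
        ((\<lambda>t. inv (rat_eval (L t)) ((rat_eval (f t) ^^ n) (rat_eval (M t) z)))
           \<longlongrightarrow> rat_eval g z) (at 0)))"

definition rescaling_limit ::
  "('a::nonarch_field \<Rightarrow> 'a rat_coords) \<Rightarrow> ('a \<Rightarrow> 'a rat_coords) \<Rightarrow> nat
     \<Rightarrow> 'a rat_coords \<Rightarrow> bool" where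
  "rescaling_limit f M q g \<longleftrightarrow>
     q \<ge> 1 \<and> rational_map g \<and> rat_degree g \<ge> 2 \<and> frame_limit f M M q g"

definition rescaling ::
  "('a::nonarch_field \<Rightarrow> 'a rat_coords) \<Rightarrow> ('a \<Rightarrow> 'a rat_coords) \<Rightarrow> bool" where
  "rescaling f M \<longleftrightarrow> moving_frame M \<and> (\<exists>q g. rescaling_limit f M q g)"

definition dynamically_dependent ::
  "('a::nonarch_field \<Rightarrow> 'a rat_coords) \<Rightarrow> ('a \<Rightarrow> 'a rat_coords) \<Rightarrow> ('a \<Rightarrow> 'a rat_coords)
     \<Rightarrow> bool" where
  "dynamically_dependent f M L \<longleftrightarrow>
     (\<exists>l g. rational_map g \<and> rat_degree g \<ge> 1 \<and> frame_limit f M L l g)"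

end

theory Submission
  imports Defs "HOL-Computational_Algebra.Polynomial_FPS"
begin

text \<open>
  A family of rational maps over \<open>K\<close> that depends analytically on a small parameter \<open>t\<close> behaves like
  one rational map over the field of Laurent series in \<open>t\<close>, whose residue field is \<open>K\<close> again. A moving
  frame \<open>M\<close> is a vertex of the tree of that field, and the points of $\mathbb{P}^1(K)$ are the directions at the
  vertex: a point \<open>z(t)\<close> lies in direction \<open>v\<close> if $M_t^{-1}(z(t)) \to v$. A rescaling is a periodic vertex, and two
  rescalings are dependent as soon as the forward orbit of one of them meets the other.

  To each rescaling \<open>M\<close> of period \<open>q\<close> with a limit \<open>g\<close> that is not postcritically finite, a critical point
  $\omega_t$ of $f_t$ is attached whose orbit returns to \<open>M\<close> at all large times of one residue class modulo \<open>q\<close>, in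
  pairwise distinct directions (\<open>critical_orbit_of_rescaling\<close>). As $f_t$ has at most $2d-2$ critical
  points, among $2d-1$ rescalings two, say \<open>M\<close> and \<open>L\<close>, share their critical point for parameters \<open>t\<close> accumulating
  at 0. Compare the times of the returns to \<open>M\<close> and to \<open>L\<close>: some map $L_t^{-1} \circ f_t^E \circ M_t$ takes infinitely
  many directions at \<open>M\<close> to pairwise distinct directions at \<open>L\<close>. Its limit exists outside a finite set. A constant limit
  would send almost all directions to a single one, so the limit is not constant, and \<open>M\<close> and \<open>L\<close> are dependent
  (\<open>dynamically_dependent_if_shared_critical_point\<close>).

  The existence of $\omega_t$ is the heart of the matter. After division by a power of \<open>t\<close>, the homogeneous coordinates of
  $M_t^{-1} \circ f_t^q \circ M_t$ tend to $h g_0$, $h g_1$, where $g = [g_0 : g_1]$ and \<open>h\<close> is a form. The zeros of \<open>h\<close> are the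
  bad directions, in which the family has both zeros and poles; all other directions are mapped as \<open>g\<close> says. The
  Wronskian of the limit is $h^2 (g_0' g_1 - g_0 g_1')$, so that its zeros are precisely the directions that are bad or
  critical. Follow a critical point of \<open>g\<close> with an infinite orbit up to the last point \<open>v\<close> of that orbit that is bad or
  critical. If the direction \<open>v\<close> contains a critical point of the family whose image lies in the direction \<open>g(v)\<close>,
  then all further images follow the orbit of \<open>g(v)\<close>.

  Such a critical point exists in every direction that is bad or critical (\<open>critical_family\<close>). In a good direction this is
  the continuity of the roots of the Wronskian. In a bad direction one zooms in, with a scale read off from the Newton
  polygons, until the zeros and poles of the family separate. Counting orders shows that some zero of the Wronskian at the
  new scale is not a pole (\<open>exists_branch_direction\<close>); there the new direction is again bad or critical, and the image stays
  where it should. The orders drop with every zoom, except for zooms by an integral power of \<open>t\<close>, which split a power of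
  \<open>t\<close> off the constant in a Bezout identity. Hence the process stops. All counts use that the residue characteristic is
  zero, so that orders and degrees of Wronskians are what they seem to be.

  Limits in the parameter are handled by asymptotic expansions of the coefficients. Convergence of the series matters only
  once: coprimality of the maps $f_t$ has to be passed on to their formal coefficients (\<open>bezout_of_coprime_family\<close>).
\<close>

section \<open>Limits over a non-Archimedean field\<close>

lemma absval_one [simp]: "absval (1::'a::nonarch_field) = 1"
proof -
  have "absval (1::'a) * absval (1::'a) = absval (1::'a)" using absval_mult[of "1::'a" 1] by simp
  then show ?thesis using absval_eq_0_iff[of "1::'a"] by auto
qed

lemma absval_zero [simp]: "absval (0::'a::nonarch_field) = 0"
  by (simp add: absval_eq_0_iff)

lemma absval_minus [simp]: "absval (- x) = absval (x::'a::nonarch_field)"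
proof -
  have "dist 0 x = dist x 0" by (rule dist_commute)
  then show ?thesis by (simp add: dist_absval)
qed

lemma absval_power: "absval (x ^ n) = absval (x::'a::nonarch_field) ^ n"
  by (induction n) (auto simp: absval_mult)

lemma absval_inverse: "absval (inverse x) = inverse (absval (x::'a::nonarch_field))"
proof (cases "x = 0")
  case False
  then have "absval x * absval (inverse x) = 1" by (simp flip: absval_mult)
  then show ?thesis by (metis inverse_unique)
qed auto

lemma absval_divide: "absval (x / y) = absval x / absval (y::'a::nonarch_field)"
  by (simp add: divide_inverse absval_mult absval_inverse)

lemma absval_pos_iff: "absval x > 0 \<longleftrightarrow> x \<noteq> (0::'a::nonarch_field)"
  using absval_nonneg[of x] absval_eq_0_iff[of x] by linarith

lemma absval_add_le: "absval (x + y) \<le> absval x + absval (y::'a::nonarch_field)"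
  using absval_ultrametric[of x y] absval_nonneg[of x] absval_nonneg[of y] by linarith

lemma absval_diff_le_max: "absval (x - y) \<le> max (absval x) (absval (y::'a::nonarch_field))"
  using absval_ultrametric[of x "-y"] by simp

lemma absval_sum_le:
  assumes "\<And>i. i \<in> A \<Longrightarrow> absval (f i :: 'a::nonarch_field) \<le> B" "B \<ge> 0"
  shows "absval (sum f A) \<le> B"
  using assms
proof (induction A rule: infinite_finite_induct)
  case (insert x F)
  then show ?case using absval_ultrametric[of "f x" "sum f F"] by simp (metis insert.prems max.boundedI order_trans insertCI)
qed auto

lemma tendsto_iff_absval:
  "(f \<longlongrightarrow> (l::'a::nonarch_field)) F \<longleftrightarrow> ((\<lambda>x. absval (f x - l)) \<longlongrightarrow> 0) F"
  by (subst tendsto_dist_iff) (simp add: dist_absval)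

lemma tendsto_zero_iff_absval:
  "(f \<longlongrightarrow> (0::'a::nonarch_field)) F \<longleftrightarrow> ((\<lambda>x. absval (f x)) \<longlongrightarrow> 0) F"
  by (subst tendsto_iff_absval) simp

text \<open>
  With the next two instances the generic limit rules for sums, differences and products apply to \<open>K\<close>.
\<close>

instance nonarch_field \<subseteq> topological_ab_group_add
proof
  fix a b :: 'a
  let ?F = "nhds a \<times>\<^sub>F nhds b"
  have 1: "((\<lambda>x. absval (fst x - a)) \<longlongrightarrow> 0) ?F" "((\<lambda>x. absval (snd x - b)) \<longlongrightarrow> 0) ?F"
    using filterlim_fst[of "nhds a" "nhds b"] filterlim_snd[of "nhds b" "nhds a"]
    by (simp_all flip: tendsto_iff_absval)
  have "((\<lambda>x. absval (fst x - a) + absval (snd x - b)) \<longlongrightarrow> 0) ?F"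
    using tendsto_add[OF 1] by simp
  then show "((\<lambda>x. fst x + snd x) \<longlongrightarrow> a + b) ?F"
    unfolding tendsto_iff_absval[where l="a+b"]
  proof (rule Lim_null_comparison[rotated])
    show "\<forall>\<^sub>F x in ?F. norm (absval (fst x + snd x - (a + b))) \<le> absval (fst x - a) + absval (snd x - b)"
    proof (rule always_eventually, rule allI)
      fix x
      have eq: "fst x + snd x - (a + b) = (fst x - a) + (snd x - b)" by simp
      show "norm (absval (fst x + snd x - (a + b))) \<le> absval (fst x - a) + absval (snd x - b)"
        unfolding eq real_norm_def abs_of_nonneg[OF absval_nonneg] by (rule absval_add_le)
    qed
  qed
next
  fix a :: 'a
  show "(uminus \<longlongrightarrow> - a) (nhds a)"
    unfolding tendsto_iff_absval
  proof -
    have "((\<lambda>x. absval (x - a)) \<longlongrightarrow> 0) (nhds a)"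
      by (simp add: tendsto_ident_at filterlim_ident flip: tendsto_iff_absval)
    moreover have "absval (- x - - a) = absval (x - a)" for x
      using absval_minus[of "x - a"] by simp
    ultimately show "((\<lambda>x. absval (- x - - a)) \<longlongrightarrow> 0) (nhds a)" by simp
  qed
qed

instance nonarch_field \<subseteq> topological_comm_monoid_mult
proof
  fix a b :: 'a
  let ?F = "nhds a \<times>\<^sub>F nhds b"
  have 1: "((\<lambda>x. absval (fst x - a)) \<longlongrightarrow> 0) ?F" "((\<lambda>x. absval (snd x - b)) \<longlongrightarrow> 0) ?F"
    using filterlim_fst[of "nhds a" "nhds b"] filterlim_snd[of "nhds b" "nhds a"]
    by (simp_all flip: tendsto_iff_absval)
  have "((\<lambda>x. absval (fst x - a) * absval (snd x - b) + (absval a * absval (snd x - b)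
       + absval b * absval (fst x - a))) \<longlongrightarrow> 0 * 0 + (absval a * 0 + absval b * 0)) ?F"
    by (intro tendsto_intros 1)
  then have "((\<lambda>x. absval (fst x - a) * absval (snd x - b) + (absval a * absval (snd x - b)
       + absval b * absval (fst x - a))) \<longlongrightarrow> 0) ?F" by simp
  then show "((\<lambda>x. fst x * snd x) \<longlongrightarrow> a * b) ?F"
    unfolding tendsto_iff_absval[where l="a*b"]
  proof (rule Lim_null_comparison[rotated])
    show "\<forall>\<^sub>F x in ?F. norm (absval (fst x * snd x - (a * b))) \<le> absval (fst x - a) * absval (snd x - b)
      + (absval a * absval (snd x - b) + absval b * absval (fst x - a))"
    proof (rule always_eventually, rule allI)
      fix x
      have "fst x * snd x - (a * b) = (fst x - a) * (snd x - b) + (a * (snd x - b) + b * (fst x - a))"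
        by (simp add: algebra_simps)
      then show "norm (absval (fst x * snd x - (a * b))) \<le> absval (fst x - a) * absval (snd x - b)
          + (absval a * absval (snd x - b) + absval b * absval (fst x - a))"
        using absval_add_le[of "(fst x - a) * (snd x - b)" "a * (snd x - b) + b * (fst x - a)"]
          absval_add_le[of "a * (snd x - b)" "b * (fst x - a)"]
          absval_nonneg[of "fst x * snd x - (a * b)"] by (simp add: absval_mult)
    qed
  qed
qed

lemma tendsto_absval:
  assumes "(f \<longlongrightarrow> (l::'a::nonarch_field)) F"
  shows "((\<lambda>x. absval (f x)) \<longlongrightarrow> absval l) F"
proof -
  have "((\<lambda>x. dist (f x) 0) \<longlongrightarrow> dist l 0) F" by (intro tendsto_intros assms)
  then show ?thesis by (simp add: dist_absval)
qed

lemma tendsto_inverse_nonarch: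
  assumes "(f \<longlongrightarrow> (l::'a::nonarch_field)) F" "l \<noteq> 0"
  shows "((\<lambda>x. inverse (f x)) \<longlongrightarrow> inverse l) F"
proof -
  have l: "absval l > 0" using assms by (simp add: absval_pos_iff)
  have A: "((\<lambda>x. absval (f x)) \<longlongrightarrow> absval l) F" by (rule tendsto_absval[OF assms(1)])
  have nz: "\<forall>\<^sub>F x in F. f x \<noteq> 0"
    using order_tendstoD(1)[OF A l] by eventually_elim (auto simp: absval_pos_iff)
  have "((\<lambda>x. absval (f x - l) * inverse (absval (f x)) * inverse (absval l))
      \<longlongrightarrow> 0 * inverse (absval l) * inverse (absval l)) F"
    by (intro tendsto_intros A) (use assms l in \<open>auto simp flip: tendsto_iff_absval\<close>)
  then have B: "((\<lambda>x. absval (f x - l) * inverse (absval (f x)) * inverse (absval l)) \<longlongrightarrow> 0) F" by simp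
  show ?thesis unfolding tendsto_iff_absval
  proof (rule tendsto_cong[THEN iffD1, OF _ B])
    show "\<forall>\<^sub>F x in F. absval (f x - l) * inverse (absval (f x)) * inverse (absval l)
        = absval (inverse (f x) - inverse l)"
      using nz
    proof eventually_elim
      case (elim x)
      then have "inverse (f x) - inverse l = - ((f x - l) * inverse (f x) * inverse l)"
        using assms(2) by (simp add: field_simps)
      then show ?case by (metis absval_minus absval_mult absval_inverse)
    qed
  qed
qed

lemma tendsto_divide_nonarch:
  assumes "(f \<longlongrightarrow> (l::'a::nonarch_field)) F" "(g \<longlongrightarrow> m) F" "m \<noteq> 0"
  shows "((\<lambda>x. f x / g x) \<longlongrightarrow> l / m) F"
  unfolding divide_inverse by (intro tendsto_mult assms tendsto_inverse_nonarch)

lemma eventually_at_0_absval: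
  "(\<forall>\<^sub>F t in at (0::'a::nonarch_field). P t) \<longleftrightarrow> (\<exists>e>0. \<forall>t. t \<noteq> 0 \<and> absval t < e \<longrightarrow> P t)"
  by (auto simp: eventually_at dist_absval)

lemma exists_small_absval:
  assumes "e > 0"
  shows "\<exists>x::'a::nonarch_field. x \<noteq> 0 \<and> absval x < e"
proof -
  obtain y :: 'a where y: "y \<noteq> 0" "absval y \<noteq> 1" using absval_nontrivial by blast
  define z where "z = (if absval y < 1 then y else inverse y)"
  have z: "z \<noteq> 0" "absval z < 1"
    using y by (auto simp: z_def absval_inverse inverse_less_1_iff)
  obtain n where "absval z ^ n < e"
    using real_arch_pow_inv[OF assms z(2)] by blast
  then show ?thesis using z by (intro exI[of _ "z^n"]) (auto simp: absval_power)
qed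

lemma at_0_neq_bot [simp]: "at (0::'a::nonarch_field) \<noteq> bot"
proof -
  have "\<not> (\<forall>\<^sub>F t in at (0::'a). False)"
    unfolding eventually_at_0_absval using exists_small_absval by blast
  then show ?thesis by (simp add: trivial_limit_def)
qed

section \<open>Asymptotic expansions at the origin\<close>

definition big_O_power :: "nat \<Rightarrow> ('a::nonarch_field \<Rightarrow> 'a) \<Rightarrow> bool" where
  "big_O_power N \<phi> \<longleftrightarrow> (\<exists>C. \<forall>\<^sub>F t in at 0. absval (\<phi> t) \<le> C * absval t ^ N)"

text \<open>
  Unlike convergent power series, functions with an asymptotic expansion are stable under the operations below without any
  bookkeeping of radii. The expansion up to order \<open>N\<close> is witnessed by a polynomial, which reduces products and
  substitutions to polynomial arithmetic.
\<close>

definition expands :: "('a::nonarch_field \<Rightarrow> 'a) \<Rightarrow> 'a fps \<Rightarrow> bool" where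
  "expands \<phi> \<Phi> \<longleftrightarrow> (\<forall>N. \<exists>p. (\<forall>n<N. coeff p n = fps_nth \<Phi> n) \<and> big_O_power N (\<lambda>t. \<phi> t - poly p t))"

lemma big_O_powerE:
  assumes "big_O_power N \<phi>"
  obtains C where "C \<ge> 0" "\<forall>\<^sub>F t in at 0. absval (\<phi> t) \<le> C * absval t ^ N"
proof -
  obtain C where C: "\<forall>\<^sub>F t in at 0. absval (\<phi> t) \<le> C * absval t ^ N"
    using assms by (auto simp: big_O_power_def)
  have "\<forall>\<^sub>F t in at 0. absval (\<phi> t) \<le> max C 0 * absval t ^ N"
    using C
  proof eventually_elim
    case (elim t)
    have "C * absval t ^ N \<le> max C 0 * absval t ^ N"
      by (intro mult_right_mono) (auto simp: absval_nonneg)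
    then show ?case using elim by linarith
  qed
  then show ?thesis using that[of "max C 0"] by simp
qed

lemma big_O_power_add:
  assumes "big_O_power N \<phi>" "big_O_power N \<psi>"
  shows "big_O_power N (\<lambda>t. \<phi> t + \<psi> t)"
proof -
  obtain C where C: "\<forall>\<^sub>F t in at 0. absval (\<phi> t) \<le> C * absval t ^ N"
    using assms by (auto simp: big_O_power_def)
  obtain D where D: "\<forall>\<^sub>F t in at 0. absval (\<psi> t) \<le> D * absval t ^ N"
    using assms by (auto simp: big_O_power_def)
  have "\<forall>\<^sub>F t in at 0. absval (\<phi> t + \<psi> t) \<le> (C + D) * absval t ^ N"
    using C D
  proof eventually_elim
    case (elim t)
    then show ?case using absval_add_le[of "\<phi> t" "\<psi> t"] by (simp add: algebra_simps)
  qed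
  then show ?thesis by (auto simp: big_O_power_def)
qed

lemma big_O_power_mult:
  assumes "big_O_power N \<phi>" "big_O_power M \<psi>"
  shows "big_O_power (N + M) (\<lambda>t. \<phi> t * \<psi> t)"
proof -
  obtain C where C: "C \<ge> 0" "\<forall>\<^sub>F t in at 0. absval (\<phi> t) \<le> C * absval t ^ N"
    using assms big_O_powerE by blast
  obtain D where D: "D \<ge> 0" "\<forall>\<^sub>F t in at 0. absval (\<psi> t) \<le> D * absval t ^ M"
    using assms big_O_powerE by blast
  have "\<forall>\<^sub>F t in at 0. absval (\<phi> t * \<psi> t) \<le> (C * D) * absval t ^ (N + M)"
    using C(2) D(2)
  proof eventually_elim
    case (elim t)
    have "absval (\<phi> t) * absval (\<psi> t) \<le> (C * absval t ^ N) * (D * absval t ^ M)"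
      by (intro mult_mono elim) (auto simp: absval_nonneg C D)
    then show ?case by (simp add: absval_mult algebra_simps power_add)
  qed
  then show ?thesis by (auto simp: big_O_power_def)
qed

lemma tendsto_id_at_0: "((\<lambda>t. t) \<longlongrightarrow> (0::'a::nonarch_field)) (at 0)"
  by (rule tendsto_ident_at)

lemma big_O_power_tendsto:
  assumes "(\<phi> \<longlongrightarrow> (l::'a::nonarch_field)) (at 0)"
  shows "big_O_power 0 \<phi>"
proof -
  have "\<forall>\<^sub>F t in at 0. absval (\<phi> t) < absval l + 1"
    by (rule order_tendstoD(2)[OF tendsto_absval[OF assms]]) simp
  then have "\<forall>\<^sub>F t in at 0. absval (\<phi> t) \<le> (absval l + 1) * absval t ^ 0"
    by eventually_elim simp
  then show ?thesis unfolding big_O_power_def by blast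
qed

lemma tendsto_poly_fixed:
  assumes "(f \<longlongrightarrow> (l::'a::nonarch_field)) F"
  shows "((\<lambda>t. poly p (f t)) \<longlongrightarrow> poly p l) F"
proof (induction p)
  case (pCons a p)
  have "((\<lambda>t. a + f t * poly p (f t)) \<longlongrightarrow> a + l * poly p l) F"
    by (intro tendsto_intros assms pCons)
  then show ?case by simp
qed auto

lemma big_O_power_poly: "big_O_power 0 (poly p)"
  using big_O_power_tendsto[OF tendsto_poly_fixed[OF tendsto_id_at_0, of p]] by simp


lemma poly_eq_monom_mult_shift:
  assumes "\<forall>n<N. coeff p n = 0"
  shows "p = monom 1 N * poly_shift N (p::'a::comm_ring_1 poly)"
  by (rule poly_eqI) (use assms in \<open>auto simp: coeff_monom_mult coeff_poly_shift\<close>)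

lemma expandsE:
  assumes "expands \<phi> \<Phi>"
  obtains p where "\<And>n. n < N \<Longrightarrow> coeff p n = fps_nth \<Phi> n" "big_O_power N (\<lambda>t. \<phi> t - poly p t)"
  using assms unfolding expands_def by blast

lemma expands_poly: "expands (poly p) (fps_of_poly p)"
  unfolding expands_def
  by (intro allI exI[of _ p]) (auto simp: big_O_power_def intro: exI[of _ 0])

lemma expands_const: "expands (\<lambda>_. c) (fps_const c)"
proof -
  have "poly [:c:] = (\<lambda>_. c)" by (simp add: fun_eq_iff)
  then show ?thesis using expands_poly[of "[:c:]"] by (simp add: fps_of_poly_const)
qed

lemma expands_zero: "expands (\<lambda>_. 0) 0"
  using expands_const[of 0] by simp

lemma expands_cong:
  assumes "expands \<phi> \<Phi>" "\<forall>\<^sub>F t in at 0. \<phi> t = \<psi> t"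
  shows "expands \<psi> \<Phi>"
  unfolding expands_def
proof
  fix N
  obtain p where p: "\<And>n. n < N \<Longrightarrow> coeff p n = fps_nth \<Phi> n" "big_O_power N (\<lambda>t. \<phi> t - poly p t)"
    using expandsE[OF assms(1)] by blast
  obtain C where C: "\<forall>\<^sub>F t in at 0. absval (\<phi> t - poly p t) \<le> C * absval t ^ N"
    using p by (auto simp: big_O_power_def)
  have "\<forall>\<^sub>F t in at 0. absval (\<psi> t - poly p t) \<le> C * absval t ^ N"
    using C assms(2) by eventually_elim simp
  then show "\<exists>p. (\<forall>n<N. coeff p n = fps_nth \<Phi> n) \<and> big_O_power N (\<lambda>t. \<psi> t - poly p t)"
    using p by (auto simp: big_O_power_def)
qed

lemma expands_add:
  assumes "expands \<phi> \<Phi>" "expands \<psi> \<Psi>"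
  shows "expands (\<lambda>t. \<phi> t + \<psi> t) (\<Phi> + \<Psi>)"
  unfolding expands_def
proof
  fix N
  obtain p where p: "\<And>n. n < N \<Longrightarrow> coeff p n = fps_nth \<Phi> n" "big_O_power N (\<lambda>t. \<phi> t - poly p t)"
    using expandsE[OF assms(1)] by blast
  obtain q where q: "\<And>n. n < N \<Longrightarrow> coeff q n = fps_nth \<Psi> n" "big_O_power N (\<lambda>t. \<psi> t - poly q t)"
    using expandsE[OF assms(2)] by blast
  have "big_O_power N (\<lambda>t. \<phi> t + \<psi> t - poly (p + q) t)"
    using big_O_power_add[OF p(2) q(2)] by (simp add: algebra_simps)
  then show "\<exists>p. (\<forall>n<N. coeff p n = fps_nth (\<Phi> + \<Psi>) n) \<and> big_O_power N (\<lambda>t. \<phi> t + \<psi> t - poly p t)"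
    using p q by (intro exI[of _ "p+q"]) auto
qed

lemma expands_big_O: "expands \<phi> \<Phi> \<Longrightarrow> big_O_power 0 \<phi>"
proof -
  assume "expands \<phi> \<Phi>"
  then obtain p where p: "big_O_power 0 (\<lambda>t. \<phi> t - poly p t)" using expandsE[of _ _ 0] by blast
  show ?thesis using big_O_power_add[OF p big_O_power_poly[of p]] by simp
qed

lemma expands_mult:
  assumes "expands \<phi> \<Phi>" "expands \<psi> \<Psi>"
  shows "expands (\<lambda>t. \<phi> t * \<psi> t) (\<Phi> * \<Psi>)"
  unfolding expands_def
proof
  fix N
  obtain p where p: "\<And>n. n < N \<Longrightarrow> coeff p n = fps_nth \<Phi> n" "big_O_power N (\<lambda>t. \<phi> t - poly p t)"
    using expandsE[OF assms(1)] by blast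
  obtain q where q: "\<And>n. n < N \<Longrightarrow> coeff q n = fps_nth \<Psi> n" "big_O_power N (\<lambda>t. \<psi> t - poly q t)"
    using expandsE[OF assms(2)] by blast
  have "big_O_power N (\<lambda>t. (\<phi> t - poly p t) * \<psi> t)"
    using big_O_power_mult[OF p(2) expands_big_O[OF assms(2)]] by simp
  moreover have "big_O_power N (\<lambda>t. poly p t * (\<psi> t - poly q t))"
    using big_O_power_mult[OF big_O_power_poly[of p] q(2)] by simp
  ultimately have "big_O_power N (\<lambda>t. \<phi> t * \<psi> t - poly (p * q) t)"
    using big_O_power_add by (fastforce simp: algebra_simps)
  moreover have "coeff (p * q) n = fps_nth (\<Phi> * \<Psi>) n" if "n < N" for n
    using that p(1) q(1) by (auto simp: coeff_mult fps_mult_nth atMost_atLeast0 intro!: sum.cong)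
  ultimately show "\<exists>p. (\<forall>n<N. coeff p n = fps_nth (\<Phi> * \<Psi>) n) \<and> big_O_power N (\<lambda>t. \<phi> t * \<psi> t - poly p t)"
    by blast
qed

lemma expands_uminus: "expands \<phi> \<Phi> \<Longrightarrow> expands (\<lambda>t. - \<phi> t) (- \<Phi>)"
  using expands_mult[OF expands_const[of "-1"]] by (fastforce simp flip: fps_const_neg)

lemma expands_diff: "expands \<phi> \<Phi> \<Longrightarrow> expands \<psi> \<Psi> \<Longrightarrow> expands (\<lambda>t. \<phi> t - \<psi> t) (\<Phi> - \<Psi>)"
  using expands_add[OF _ expands_uminus, of \<phi> \<Phi> \<psi> \<Psi>] by simp

lemma expands_sum:
  assumes "\<And>i. i \<in> A \<Longrightarrow> expands (\<phi> i) (\<Phi> i)"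
  shows "expands (\<lambda>t. \<Sum>i\<in>A. \<phi> i t) (\<Sum>i\<in>A. \<Phi> i)"
  using assms by (induction A rule: infinite_finite_induct) (auto intro: expands_add expands_zero)

lemma expands_tendsto:
  assumes "expands \<phi> \<Phi>"
  shows "(\<phi> \<longlongrightarrow> fps_nth \<Phi> 0) (at 0)"
proof -
  obtain p where p: "\<And>n. n < Suc 0 \<Longrightarrow> coeff p n = fps_nth \<Phi> n" "big_O_power (Suc 0) (\<lambda>t. \<phi> t - poly p t)"
    using expandsE[OF assms] by blast
  obtain C where C: "\<forall>\<^sub>F t in at 0. absval (\<phi> t - poly p t) \<le> C * absval t"
    using p(2) by (auto simp: big_O_power_def)
  have "((\<lambda>t::'a. C * absval t) \<longlongrightarrow> C * absval (0::'a)) (at 0)"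
    by (rule tendsto_mult_left[OF tendsto_absval[OF tendsto_id_at_0]])
  then have "((\<lambda>t::'a. C * absval t) \<longlongrightarrow> 0) (at 0)" by simp
  then have "((\<lambda>t. absval (\<phi> t - poly p t)) \<longlongrightarrow> 0) (at 0)"
    by (rule Lim_null_comparison[rotated]) (use C in \<open>eventually_elim, simp add: absval_nonneg\<close>)
  then have "((\<lambda>t. \<phi> t - poly p t) \<longlongrightarrow> 0) (at 0)" by (simp add: tendsto_zero_iff_absval)
  from tendsto_add[OF this tendsto_poly_fixed[OF tendsto_id_at_0, of p]]
  have "(\<phi> \<longlongrightarrow> poly p 0) (at 0)" by simp
  then show ?thesis using p(1)[of 0] by (simp add: poly_0_coeff_0)
qed

lemma expands_divide_power:
  assumes "expands \<phi> (fps_X ^ k * \<Phi>)"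
  shows "expands (\<lambda>t. \<phi> t / t ^ k) \<Phi>"
  unfolding expands_def
proof
  fix N
  obtain p where p: "\<And>n. n < N + k \<Longrightarrow> coeff p n = fps_nth (fps_X ^ k * \<Phi>) n"
      "big_O_power (N + k) (\<lambda>t. \<phi> t - poly p t)"
    using expandsE[OF assms(1)] by blast
  define q where "q = poly_shift k p"
  have "\<forall>n<k. coeff p n = 0" using p(1) by (simp add: fps_X_power_mult_nth)
  from poly_eq_monom_mult_shift[OF this] have pq: "poly p t = t ^ k * poly q t" for t
    by (metis q_def poly_mult poly_monom mult_1)
  obtain C where C: "\<forall>\<^sub>F t in at 0. absval (\<phi> t - poly p t) \<le> C * absval t ^ (N + k)"
    using p(2) by (auto simp: big_O_power_def)
  have nz: "\<forall>\<^sub>F t in at (0::'a). t \<noteq> 0" by (simp add: eventually_at_filter)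
  have "\<forall>\<^sub>F t in at 0. absval (\<phi> t / t ^ k - poly q t) \<le> C * absval t ^ N"
    using C nz
  proof eventually_elim
    case (elim t)
    have "\<phi> t / t ^ k - poly q t = (\<phi> t - poly p t) / t ^ k"
      using elim by (simp add: pq field_simps)
    then show ?case using elim
      by (simp add: absval_divide absval_power field_simps power_add absval_pos_iff)
  qed
  moreover have "coeff q n = fps_nth \<Phi> n" if "n < N" for n
    using p(1)[of "n + k"] that by (simp add: q_def coeff_poly_shift fps_X_power_mult_nth add.commute)
  ultimately show "\<exists>p. (\<forall>n<N. coeff p n = fps_nth \<Phi> n) \<and> big_O_power N (\<lambda>t. \<phi> t / t ^ k - poly p t)"
    by (auto simp: big_O_power_def)
qed

lemma filterlim_power_at_0:
  assumes "b > 0"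
  shows "filterlim (\<lambda>t::'a::nonarch_field. t ^ b) (at 0) (at 0)"
  unfolding filterlim_at
proof
  show "((\<lambda>t::'a. t ^ b) \<longlongrightarrow> 0) (at 0)"
    using tendsto_poly_fixed[OF tendsto_id_at_0, of "monom (1::'a) b"] assms
    by (simp add: poly_monom zero_power)
  have "\<forall>\<^sub>F t in at (0::'a). t \<noteq> 0" by (simp add: eventually_at_filter)
  then show "\<forall>\<^sub>F t in at (0::'a). t ^ b \<in> UNIV \<and> t ^ b \<noteq> 0" by eventually_elim simp
qed

lemma expands_subst_power:
  assumes "expands \<phi> \<Phi>" "b > 0"
  shows "expands (\<lambda>t. \<phi> (t ^ b)) (fps_compose \<Phi> (fps_X ^ b))"
  unfolding expands_def
proof
  fix N
  obtain p where p: "\<And>n. n < N \<Longrightarrow> coeff p n = fps_nth \<Phi> n" "big_O_power N (\<lambda>t. \<phi> t - poly p t)"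
    using expandsE[OF assms(1)] by blast
  define q where "q = pcompose p (monom 1 b)"
  obtain C where C: "C \<ge> 0" "\<forall>\<^sub>F t in at 0. absval (\<phi> t - poly p t) \<le> C * absval t ^ N"
    using p(2) big_O_powerE by blast
  have small: "\<forall>\<^sub>F t in at (0::'a). absval t < 1"
    unfolding eventually_at_0_absval by (rule exI[of _ 1]) auto
  have "\<forall>\<^sub>F t in at 0. absval (\<phi> (t ^ b) - poly p (t ^ b)) \<le> C * absval (t ^ b) ^ N"
    by (rule eventually_compose_filterlim[OF C(2) filterlim_power_at_0[OF assms(2)]])
  then have "\<forall>\<^sub>F t in at 0. absval (\<phi> (t ^ b) - poly q t) \<le> C * absval t ^ N"
    using small
  proof eventually_elim
    case (elim t)
    have "absval t ^ (b * N) \<le> absval t ^ N"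
      using assms(2) elim by (intro power_decreasing) (auto simp: absval_nonneg)
    then have "C * absval t ^ (b * N) \<le> C * absval t ^ N" using C by (intro mult_left_mono)
    then show ?case using elim by (simp add: q_def poly_pcompose poly_monom absval_power power_mult)
  qed
  moreover have "coeff q n = fps_nth (fps_compose \<Phi> (fps_X ^ b)) n" if "n < N" for n
  proof -
    have "fps_of_poly q = fps_compose (fps_of_poly p) (fps_X ^ b)"
      using assms(2) unfolding q_def by (subst fps_of_poly_pcompose) (auto simp: fps_of_poly_monom)
    then have "coeff q n = fps_nth (fps_compose (fps_of_poly p) (fps_X ^ b)) n"
      by (metis fps_of_poly_nth)
    also have "\<dots> = fps_nth (fps_compose \<Phi> (fps_X ^ b)) n"
      unfolding fps_compose_nth using p(1) that by (intro sum.cong) auto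
    finally show ?thesis .
  qed
  ultimately show "\<exists>p. (\<forall>n<N. coeff p n = fps_nth (fps_compose \<Phi> (fps_X ^ b)) n)
      \<and> big_O_power N (\<lambda>t. \<phi> (t ^ b) - poly p t)"
    by (auto simp: big_O_power_def)
qed

lemma fps_X_power_compose_nth:
  assumes "b > 0"
  shows "fps_nth (fps_compose \<Phi> (fps_X ^ b)) n = (if b dvd n then fps_nth \<Phi> (n div b) else 0)"
proof -
  have "fps_nth (fps_compose \<Phi> (fps_X ^ b)) n = (\<Sum>i=0..n. fps_nth \<Phi> i * (if n = b * i then 1 else 0))"
    by (simp add: fps_compose_nth fps_X_power_nth flip: power_mult)
  also have "\<dots> = (\<Sum>i\<in>{0..n}. if n = b * i then fps_nth \<Phi> i else 0)"
    by (intro sum.cong) auto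
  also have "\<dots> = (if b dvd n then fps_nth \<Phi> (n div b) else 0)"
  proof (cases "b dvd n")
    case True
    then obtain k where k: "n = b * k" by blast
    have "(\<Sum>i\<in>{0..n}. if n = b * i then fps_nth \<Phi> i else 0) = (\<Sum>i\<in>{k}. if n = b * i then fps_nth \<Phi> i else 0)"
      by (rule sum.mono_neutral_right) (use assms k in auto)
    then show ?thesis using k assms by simp
  qed (auto intro!: sum.neutral)
  finally show ?thesis .
qed

section \<open>Convergent power series\<close>

lemma sums_terms_tendsto_0:
  fixes a :: "nat \<Rightarrow> 'a::nonarch_field"
  assumes "a sums x"
  shows "a \<longlonglongrightarrow> 0"
proof -
  have 1: "(\<lambda>n. \<Sum>i<n. a i) \<longlonglongrightarrow> x" using assms by (simp add: sums_def)
  have 2: "(\<lambda>n. \<Sum>i<Suc n. a i) \<longlonglongrightarrow> x" using 1 by (rule LIMSEQ_Suc)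
  show ?thesis using tendsto_diff[OF 2 1] by simp
qed

lemma sums_terms_bounded:
  fixes a :: "nat \<Rightarrow> 'a::nonarch_field"
  assumes "a sums x"
  obtains B where "B > 0" "\<And>n. absval (a n) \<le> B"
proof -
  have "(\<lambda>n. absval (a n)) \<longlonglongrightarrow> absval (0::'a)"
    by (rule tendsto_absval[OF sums_terms_tendsto_0[OF assms]])
  then have "Bseq (\<lambda>n. absval (a n))" by (intro convergent_imp_Bseq convergentI)
  then obtain B where "B > 0" "\<And>n. norm (absval (a n)) \<le> B" by (auto elim: BseqE)
  then show ?thesis using that[of B] by (auto simp: absval_nonneg)
qed

lemma sums_absval_le:
  fixes a :: "nat \<Rightarrow> 'a::nonarch_field"
  assumes "a sums x" "\<And>n. absval (a n) \<le> B"
  shows "absval x \<le> B"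
proof -
  have B: "B \<ge> 0" using assms(2)[of 0] absval_nonneg[of "a 0"] by linarith
  have "(\<lambda>n. absval (\<Sum>i<n. a i)) \<longlonglongrightarrow> absval x"
    using assms(1) by (intro tendsto_absval) (simp add: sums_def)
  then show ?thesis
    by (rule tendsto_upperbound) (auto intro!: always_eventually absval_sum_le assms B)
qed

lemma sums_expands:
  fixes \<Phi> :: "'a::nonarch_field fps" and \<tau> :: 'a
  assumes "\<tau> \<noteq> 0" "\<And>t. absval t \<le> absval \<tau> \<Longrightarrow> (\<lambda>n. fps_nth \<Phi> n * t ^ n) sums \<phi> t"
  shows "expands \<phi> \<Phi>"
  unfolding expands_def
proof
  fix N
  obtain B where B: "B > 0" "\<And>n. absval (fps_nth \<Phi> n * \<tau> ^ n) \<le> B"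
    using sums_terms_bounded[OF assms(2)[of \<tau>]] by auto
  define p where "p = (\<Sum>n<N. monom (fps_nth \<Phi> n) n)"
  have p: "coeff p n = (if n < N then fps_nth \<Phi> n else 0)" for n
    by (simp add: p_def coeff_sum)
  have pt: "poly p t = (\<Sum>n<N. fps_nth \<Phi> n * t ^ n)" for t
    by (simp add: p_def poly_sum poly_monom)
  have tau: "absval \<tau> > 0" using assms(1) by (simp add: absval_pos_iff)
  have "absval (\<phi> t - poly p t) \<le> (B / absval \<tau> ^ N) * absval t ^ N" if t: "absval t < absval \<tau>" for t
  proof -
    have *: "absval (fps_nth \<Phi> n * t ^ n) \<le> (B / absval \<tau> ^ N) * absval t ^ N" if "n \<ge> N" for n
    proof -
      have "absval (fps_nth \<Phi> n * t ^ n) = absval (fps_nth \<Phi> n * \<tau> ^ n) * (absval t / absval \<tau>) ^ n"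
        using assms(1) tau by (simp add: absval_mult absval_power power_divide)
      also have "\<dots> \<le> B * (absval t / absval \<tau>) ^ N"
        using t tau that B by (intro mult_mono power_decreasing B) (auto simp: absval_nonneg)
      finally show ?thesis by (simp add: power_divide)
    qed
    have "(\<lambda>n. fps_nth \<Phi> n * t ^ n) sums \<phi> t" using t by (intro assms) simp
    moreover have "(\<lambda>n. if n < N then fps_nth \<Phi> n * t ^ n else 0) sums poly p t"
      using sums_If_finite[of "\<lambda>n. n < N" "\<lambda>n. fps_nth \<Phi> n * t ^ n"] by (simp add: pt lessThan_def)
    ultimately have "(\<lambda>n. fps_nth \<Phi> n * t ^ n - (if n < N then fps_nth \<Phi> n * t ^ n else 0)) sums (\<phi> t - poly p t)"
      unfolding sums_def by (simp only: sum_subtractf tendsto_diff)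
    then show ?thesis
    proof (rule sums_absval_le)
      fix n
      show "absval (fps_nth \<Phi> n * t ^ n - (if n < N then fps_nth \<Phi> n * t ^ n else 0))
           \<le> B / absval \<tau> ^ N * absval t ^ N"
        using *[of n] B tau by (cases "n < N") (auto simp: absval_nonneg)
    qed
  qed
  then have "\<forall>\<^sub>F t in at 0. absval (\<phi> t - poly p t) \<le> (B / absval \<tau> ^ N) * absval t ^ N"
    unfolding eventually_at_0_absval using tau by (intro exI[of _ "absval \<tau>"]) auto
  then have "big_O_power N (\<lambda>t. \<phi> t - poly p t)" unfolding big_O_power_def by blast
  then show "\<exists>p. (\<forall>n<N. coeff p n = fps_nth \<Phi> n) \<and> big_O_power N (\<lambda>t. \<phi> t - poly p t)"
    using p by (intro exI[of _ p]) auto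
qed

text \<open>
  A function whose asymptotic expansion is zero need not vanish, whereas a convergent series with zero coefficients has the
  value zero. This is what convergence is needed for.
\<close>

definition sums_at :: "'a::nonarch_field \<Rightarrow> 'a fps \<Rightarrow> 'a \<Rightarrow> bool" where
  "sums_at t \<Phi> x \<longleftrightarrow> (\<lambda>n. fps_nth \<Phi> n * t ^ n) sums x"

lemma sums_at_const: "sums_at t (fps_const c) c"
proof -
  have "(\<lambda>n. if n = 0 then c else 0) sums c" using sums_single[of 0 "\<lambda>_. c"] by simp
  moreover have "(\<lambda>n. fps_nth (fps_const c) n * t ^ n) = (\<lambda>n. if n = 0 then c else 0)"
    by (auto simp: fun_eq_iff)
  ultimately show ?thesis unfolding sums_at_def by simp
qed

lemma sums_at_add: "sums_at t \<Phi> x \<Longrightarrow> sums_at t \<Psi> y \<Longrightarrow> sums_at t (\<Phi> + \<Psi>) (x + y)"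
  unfolding sums_at_def sums_def by (simp add: ring_distribs sum.distrib tendsto_add)

text \<open>
  The product of two partial sums differs from the partial sum of the Cauchy product by terms $a_i b_j$ with $i + j \ge N$,
  in which one of the two factors is far out. By the ultrametric inequality the difference is as small as its largest term.
\<close>

lemma sums_at_mult:
  assumes "sums_at t \<Phi> x" "sums_at t \<Psi> y"
  shows "sums_at t (\<Phi> * \<Psi>) (x * y)"
proof -
  define a where "a = (\<lambda>n. fps_nth \<Phi> n * t ^ n)"
  define b where "b = (\<lambda>n. fps_nth \<Psi> n * t ^ n)"
  have a: "a sums x" and b: "b sums y" using assms by (auto simp: sums_at_def a_def b_def)
  obtain A where A: "A > 0" "\<And>n. absval (a n) \<le> A" using sums_terms_bounded[OF a] by blast
  obtain B where B: "B > 0" "\<And>n. absval (b n) \<le> B" using sums_terms_bounded[OF b] by blast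
  define D where "D = max A B"
  have D: "D > 0" "\<And>n. absval (a n) \<le> D" "\<And>n. absval (b n) \<le> D"
    using A B by (auto simp: D_def le_max_iff_disj less_max_iff_disj)
  have c: "fps_nth (\<Phi> * \<Psi>) n * t ^ n = (\<Sum>i\<le>n. a i * b (n - i))" for n
    unfolding fps_mult_nth sum_distrib_right a_def b_def atMost_atLeast0
    by (intro sum.cong) (auto simp: algebra_simps simp flip: power_add)
  have "(\<lambda>N. (\<Sum>i<N. a i) * (\<Sum>i<N. b i) - (\<Sum>n<N. \<Sum>i\<le>n. a i * b (n - i))) \<longlonglongrightarrow> 0"
    unfolding tendsto_zero_iff_absval
  proof (rule LIMSEQ_I)
    fix e :: real assume e: "e > 0"
    have "(\<lambda>n. absval (a n)) \<longlonglongrightarrow> 0" "(\<lambda>n. absval (b n)) \<longlonglongrightarrow> 0"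
      using sums_terms_tendsto_0[OF a] sums_terms_tendsto_0[OF b] by (simp_all add: tendsto_zero_iff_absval)
    then have "\<forall>\<^sub>F n in sequentially. absval (a n) < e / (2 * D)" "\<forall>\<^sub>F n in sequentially. absval (b n) < e / (2 * D)"
      using e D by (auto intro!: order_tendstoD(2))
    then have "\<forall>\<^sub>F n in sequentially. absval (a n) < e / (2 * D) \<and> absval (b n) < e / (2 * D)"
      by eventually_elim simp
    then obtain K where K: "\<And>n. n \<ge> K \<Longrightarrow> absval (a n) < e / (2 * D) \<and> absval (b n) < e / (2 * D)"
      by (auto simp: eventually_sequentially)
    have "absval ((\<Sum>i<N. a i) * (\<Sum>i<N. b i) - (\<Sum>n<N. \<Sum>i\<le>n. a i * b (n - i))) \<le> e / 2" if N: "N \<ge> 2 * K" for N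
    proof -
      have "(\<Sum>i<N. a i) * (\<Sum>i<N. b i) = (\<Sum>(i,j)\<in>{..<N}\<times>{..<N}. a i * b j)"
        by (simp add: sum_product sum.cartesian_product)
      moreover have "(\<Sum>n<N. \<Sum>i\<le>n. a i * b (n - i)) = (\<Sum>(i,j)\<in>{(i,j). i + j < N}. a i * b j)"
        by (rule sum.triangle_reindex[symmetric])
      moreover have "(\<Sum>(i,j)\<in>{..<N}\<times>{..<N}. a i * b j) =
          (\<Sum>(i,j)\<in>{..<N}\<times>{..<N} - {(i,j). i + j < N}. a i * b j) + (\<Sum>(i,j)\<in>{(i,j). i + j < N}. a i * b j)"
        by (rule sum.subset_diff) auto
      ultimately have eq: "(\<Sum>i<N. a i) * (\<Sum>i<N. b i) - (\<Sum>n<N. \<Sum>i\<le>n. a i * b (n - i))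
          = (\<Sum>(i,j)\<in>{..<N}\<times>{..<N} - {(i,j). i + j < N}. a i * b j)" by simp
      show ?thesis unfolding eq
      proof (rule absval_sum_le)
        fix ij assume "ij \<in> {..<N}\<times>{..<N} - {(i,j). i + j < N}"
        then obtain i j where ij: "ij = (i,j)" "i + j \<ge> N" by auto
        then have "i \<ge> K \<or> j \<ge> K" using N by linarith
        then have "absval (a i) * absval (b j) \<le> e / 2"
        proof
          assume "i \<ge> K"
          then have "absval (a i) * absval (b j) \<le> e / (2 * D) * D"
            using D K[of i] e by (intro mult_mono) (auto simp: absval_nonneg intro: less_imp_le)
          then show ?thesis using D by simp
        next
          assume "j \<ge> K"
          then have "absval (a i) * absval (b j) \<le> D * (e / (2 * D))"
            using D K[of j] e by (intro mult_mono) (auto simp: absval_nonneg intro: less_imp_le)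
          then show ?thesis using D by simp
        qed
        then show "absval (case ij of (i, j) \<Rightarrow> a i * b j) \<le> e / 2" using ij by (simp add: absval_mult)
      qed (use e in simp)
    qed
    then have "norm (absval ((\<Sum>i<N. a i) * (\<Sum>i<N. b i) - (\<Sum>n<N. \<Sum>i\<le>n. a i * b (n - i))) - 0) < e"
      if "N \<ge> 2 * K" for N
      using e that absval_nonneg by (smt (verit) field_sum_of_halves real_norm_def)
    then show "\<exists>no. \<forall>N\<ge>no. norm (absval ((\<Sum>i<N. a i) * (\<Sum>i<N. b i) - (\<Sum>n<N. \<Sum>i\<le>n. a i * b (n - i))) - 0) < e"
      by blast
  qed
  moreover have "(\<lambda>N. (\<Sum>i<N. a i) * (\<Sum>i<N. b i)) \<longlonglongrightarrow> x * y"
    using a b unfolding sums_def by (rule tendsto_mult)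
  ultimately have "(\<lambda>N. (\<Sum>i<N. a i) * (\<Sum>i<N. b i) -
     ((\<Sum>i<N. a i) * (\<Sum>i<N. b i) - (\<Sum>n<N. \<Sum>i\<le>n. a i * b (n - i)))) \<longlonglongrightarrow> x * y - 0"
    by (intro tendsto_diff)
  then show ?thesis unfolding sums_at_def sums_def c by simp
qed

lemma sums_at_zero_unique: "sums_at t 0 x \<Longrightarrow> x = 0"
  using sums_at_const[of t 0] by (auto simp: sums_at_def dest: sums_unique2)

lemma expands_eventually_nonzero:
  assumes "expands \<phi> \<Phi>" "\<Phi> \<noteq> 0"
  shows "\<forall>\<^sub>F t in at 0. \<phi> t \<noteq> 0"
proof -
  define k where "k = subdegree \<Phi>"
  define \<Psi> where "\<Psi> = fps_shift k \<Phi>"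
  have P: "\<Phi> = fps_X ^ k * \<Psi>" using subdegree_decompose[of \<Phi>] by (simp add: k_def \<Psi>_def mult.commute)
  have "fps_nth \<Psi> 0 \<noteq> 0" using assms by (simp add: \<Psi>_def k_def)
  moreover have "((\<lambda>t. \<phi> t / t ^ k) \<longlongrightarrow> fps_nth \<Psi> 0) (at 0)"
    using assms(1) by (intro expands_tendsto expands_divide_power) (simp flip: P)
  ultimately have "\<forall>\<^sub>F t in at 0. \<phi> t / t ^ k \<noteq> 0"
    by (intro tendsto_imp_eventually_ne)
  then show ?thesis by eventually_elim auto
qed

section \<open>Homogeneous forms\<close>

definition ring_map :: "('r::comm_ring_1 \<Rightarrow> 's::comm_ring_1) \<Rightarrow> bool" where
  "ring_map \<phi> \<longleftrightarrow> \<phi> 1 = 1 \<and> (\<forall>a b. \<phi> (a + b) = \<phi> a + \<phi> b) \<and> (\<forall>a b. \<phi> (a * b) = \<phi> a * \<phi> b)"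

lemma ring_map_id: "ring_map (\<lambda>c. c)"
  by (simp add: ring_map_def)

lemma ring_map_const_poly: "ring_map (\<lambda>c. [:c:])"
  by (simp add: ring_map_def one_poly_eq_simps)

lemma ring_map_add: "ring_map \<phi> \<Longrightarrow> \<phi> (a + b) = \<phi> a + \<phi> b"
  and ring_map_mult: "ring_map \<phi> \<Longrightarrow> \<phi> (a * b) = \<phi> a * \<phi> b"
  and ring_map_one: "ring_map \<phi> \<Longrightarrow> \<phi> 1 = 1"
  by (auto simp: ring_map_def)

lemma ring_map_zero: "ring_map \<phi> \<Longrightarrow> \<phi> 0 = 0"
  using ring_map_add[of \<phi> 0 0] by simp

lemma ring_map_sum: "ring_map \<phi> \<Longrightarrow> \<phi> (sum f A) = (\<Sum>x\<in>A. \<phi> (f x))"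
  by (induction A rule: infinite_finite_induct) (auto simp: ring_map_zero ring_map_add)

lemma ring_map_power: "ring_map \<phi> \<Longrightarrow> \<phi> (a ^ n) = \<phi> a ^ n"
  by (induction n) (auto simp: ring_map_one ring_map_mult)

text \<open>
  The value at \<open>(x, y)\<close> of the form of degree \<open>d\<close> with dehomogenization \<open>p\<close>. The map \<open>\<phi>\<close> embeds the ring of
  coefficients into the ring that contains the arguments, so that values at points and substitutions of polynomials are
  instances of the same notion.
\<close>

definition form :: "('r::comm_ring_1 \<Rightarrow> 's::comm_ring_1) \<Rightarrow> nat \<Rightarrow> 'r poly \<Rightarrow> 's \<Rightarrow> 's \<Rightarrow> 's" where
  "form \<phi> d p x y = (\<Sum>i\<le>d. \<phi> (coeff p i) * x ^ i * y ^ (d - i))"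

abbreviation hev :: "nat \<Rightarrow> 'r::comm_ring_1 poly \<Rightarrow> 'r \<Rightarrow> 'r \<Rightarrow> 'r" where
  "hev \<equiv> form (\<lambda>c. c)"

abbreviation hcomp :: "nat \<Rightarrow> 'r::comm_ring_1 poly \<Rightarrow> 'r poly \<Rightarrow> 'r poly \<Rightarrow> 'r poly" where
  "hcomp \<equiv> form (\<lambda>c. [:c:])"

lemma form_map:
  assumes "ring_map \<psi>"
  shows "\<psi> (form \<phi> d p x y) = form (\<lambda>c. \<psi> (\<phi> c)) d p (\<psi> x) (\<psi> y)"
  unfolding form_def
  by (simp add: ring_map_sum[OF assms] ring_map_mult[OF assms] ring_map_power[OF assms])

lemma ring_map_poly: "ring_map (\<lambda>p. poly p z)"
  by (simp add: ring_map_def)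

lemma poly_hcomp: "poly (hcomp d p X Y) z = hev d p (poly X z) (poly Y z)"
  using form_map[OF ring_map_poly, of "\<lambda>c. [:c:]" d p X Y z] by simp

lemma form_add: "ring_map \<phi> \<Longrightarrow> form \<phi> d (p + q) x y = form \<phi> d p x y + form \<phi> d q x y"
  unfolding form_def by (simp add: ring_map_add ring_distribs sum.distrib)

lemma form_zero: "ring_map \<phi> \<Longrightarrow> form \<phi> d 0 x y = 0"
  unfolding form_def by (simp add: ring_map_zero)

lemma form_sum: "ring_map \<phi> \<Longrightarrow> form \<phi> d (\<Sum>i\<in>A. p i) x y = (\<Sum>i\<in>A. form \<phi> d (p i) x y)"
  by (induction A rule: infinite_finite_induct) (auto simp: form_zero form_add)

lemma form_smult: "ring_map \<phi> \<Longrightarrow> form \<phi> d (smult c p) x y = \<phi> c * form \<phi> d p x y"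
  unfolding form_def by (simp add: ring_map_mult sum_distrib_left mult_ac)

lemma form_uminus: "ring_map \<phi> \<Longrightarrow> form \<phi> d (- p) x y = - form \<phi> d p x y"
  using form_add[of \<phi> d p "-p" x y] by (simp add: form_zero add_eq_0_iff)

lemma form_diff: "ring_map \<phi> \<Longrightarrow> form \<phi> d (p - q) x y = form \<phi> d p x y - form \<phi> d q x y"
  using form_add[of \<phi> d p "-q" x y] by (simp add: form_uminus)

lemma form_pCons:
  "form \<phi> (Suc d) (pCons c p) x y = \<phi> c * y ^ Suc d + x * form \<phi> d p x y"
  unfolding form_def
  by (subst sum.atMost_Suc_shift) (simp add: sum_distrib_left mult_ac)

lemma form_scale: "form \<phi> d p (c * x) (c * y) = c ^ d * form \<phi> d p x y"
proof -
  have "\<phi> (coeff p i) * (c * x) ^ i * (c * y) ^ (d - i) = c ^ d * (\<phi> (coeff p i) * x ^ i * y ^ (d - i))"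
    if "i \<le> d" for i
  proof -
    have "c ^ d = c ^ i * c ^ (d - i)" using that by (simp flip: power_add)
    then show ?thesis by (simp add: power_mult_distrib mult_ac)
  qed
  then show ?thesis unfolding form_def by (simp add: sum_distrib_left)
qed

lemma form_raise_degree:
  assumes "ring_map \<phi>" "degree p \<le> d"
  shows "form \<phi> (k + d) p x y = y ^ k * form \<phi> d p x y"
proof -
  have "form \<phi> (k + d) p x y = (\<Sum>i\<le>d. \<phi> (coeff p i) * x ^ i * y ^ (k + d - i))"
    unfolding form_def
    by (rule sum.mono_neutral_right) (use assms in \<open>auto simp: coeff_eq_0 ring_map_zero\<close>)
  also have "\<dots> = (\<Sum>i\<le>d. y ^ k * (\<phi> (coeff p i) * x ^ i * y ^ (d - i)))"
  proof (intro sum.cong refl)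
    fix i assume "i \<in> {..d}"
    then have "k + d - i = k + (d - i)" by simp
    then show "\<phi> (coeff p i) * x ^ i * y ^ (k + d - i) = y ^ k * (\<phi> (coeff p i) * x ^ i * y ^ (d - i))"
      by (simp add: power_add mult_ac)
  qed
  also have "\<dots> = y ^ k * form \<phi> d p x y" unfolding form_def sum_distrib_left ..
  finally show ?thesis .
qed

lemma form_const: "ring_map \<phi> \<Longrightarrow> form \<phi> d [:c:] x y = \<phi> c * y ^ d"
  using form_raise_degree[of \<phi> "[:c:]" 0 d x y] by (simp add: form_def)

lemma form_mult:
  assumes "ring_map \<phi>" "degree p \<le> d" "degree q \<le> e"
  shows "form \<phi> (d + e) (p * q) x y = form \<phi> d p x y * form \<phi> e q x y"
  using assms(2)
proof (induction d arbitrary: p)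
  case 0
  then obtain c where "p = [:c:]" by (auto elim: degree_eq_zeroE)
  moreover have "form \<phi> 0 [:c:] x y = \<phi> c" by (simp add: form_def)
  ultimately show ?case using assms(1) by (simp add: form_smult)
next
  case (Suc d)
  obtain c p' where p: "p = pCons c p'" by (cases p)
  have deg: "degree p' \<le> d" using Suc.prems by (auto simp: p split: if_splits)
  have "form \<phi> (Suc d + e) (p * q) x y
      = form \<phi> (Suc d + e) (smult c q) x y + form \<phi> (Suc (d + e)) (pCons 0 (p' * q)) x y"
    by (simp add: p form_add[OF assms(1)])
  also have "\<dots> = \<phi> c * (y ^ Suc d * form \<phi> e q x y) + x * (form \<phi> d p' x y * form \<phi> e q x y)"
    using Suc.IH[OF deg] form_raise_degree[OF assms(1) assms(3), of "Suc d" x y]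
    by (simp add: form_smult[OF assms(1)] form_pCons ring_map_zero[OF assms(1)])
  also have "\<dots> = form \<phi> (Suc d) p x y * form \<phi> e q x y"
    by (simp add: p form_pCons algebra_simps)
  finally show ?case .
qed

lemma form_power:
  assumes "ring_map \<phi>" "degree p \<le> d"
  shows "form \<phi> (n * d) (p ^ n) x y = form \<phi> d p x y ^ n"
proof (induction n)
  case 0
  show ?case using assms by (simp add: form_def ring_map_one)
next
  case (Suc n)
  have "degree (p ^ n) \<le> n * d"
    using degree_power_le[of p n] assms(2) by (metis le_trans mult.commute mult_le_mono1)
  then show ?case using form_mult[OF assms(1) assms(2), of "p ^ n" "n * d" x y] Suc by simp
qed

lemma degree_hcomp:
  assumes "degree X \<le> D" "degree Y \<le> D"
  shows "degree (hcomp d p X Y) \<le> d * D"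
  unfolding form_def
proof (rule degree_sum_le)
  fix i assume i: "i \<in> {..d}"
  have "degree ([:coeff p i:] * X ^ i * Y ^ (d - i)) \<le> 0 + degree X * i + degree Y * (d - i)"
    by (intro order.trans[OF degree_mult_le] add_mono degree_power_le) auto
  also have "\<dots> \<le> D * i + D * (d - i)" using assms by (intro add_mono) auto
  also have "\<dots> = d * D" using i by (simp flip: distrib_left)
  finally show "degree ([:coeff p i:] * X ^ i * Y ^ (d - i)) \<le> d * D" .
qed auto

lemma form_hcomp:
  assumes "ring_map \<phi>" "degree X \<le> D" "degree Y \<le> D"
  shows "form \<phi> (d * D) (hcomp d p X Y) x y = form \<phi> d p (form \<phi> D X x y) (form \<phi> D Y x y)"
proof -
  have *: "form \<phi> (d * D) ([:c:] * X ^ i * Y ^ (d - i)) x y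
      = \<phi> c * form \<phi> D X x y ^ i * form \<phi> D Y x y ^ (d - i)" if i: "i \<le> d" for i c
  proof -
    have dX: "degree (X ^ i) \<le> i * D" if "degree X \<le> D" for X :: "'a poly" and i
      using degree_power_le[of X i] that by (metis le_trans mult.commute mult_le_mono1)
    have d: "d * D = i * D + (d - i) * D" using i by (simp flip: distrib_right)
    have "form \<phi> (d * D) (smult c (X ^ i * Y ^ (d - i))) x y
        = \<phi> c * (form \<phi> (i * D) (X ^ i) x y * form \<phi> ((d - i) * D) (Y ^ (d - i)) x y)"
      unfolding d form_smult[OF assms(1)]
      by (subst form_mult[OF assms(1)]) (auto intro!: dX assms)
    then show ?thesis
      unfolding form_power[OF assms(1) assms(2)] form_power[OF assms(1) assms(3)]
      by (simp add: mult.assoc)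
  qed
  have "form \<phi> (d * D) (hcomp d p X Y) x y = (\<Sum>i\<le>d. form \<phi> (d * D) ([:coeff p i:] * X ^ i * Y ^ (d - i)) x y)"
    unfolding form_def[of "\<lambda>c. [:c:]"] by (rule form_sum[OF assms(1)])
  also have "\<dots> = (\<Sum>i\<le>d. \<phi> (coeff p i) * form \<phi> D X x y ^ i * form \<phi> D Y x y ^ (d - i))"
    by (intro sum.cong refl *) simp
  finally show ?thesis by (simp add: form_def[of \<phi> d])
qed

lemma hev_1: "degree p \<le> d \<Longrightarrow> hev d p z 1 = poly p z"
  unfolding form_def poly_altdef
  by (simp, rule sum.mono_neutral_right) (auto simp: coeff_eq_0)

section \<open>Wronskians\<close>

definition wronskian :: "'r::idom poly \<Rightarrow> 'r poly \<Rightarrow> 'r poly" where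
  "wronskian p q = pderiv p * q - p * pderiv q"

lemma wronskian_smult: "wronskian (smult a p) (smult b q) = smult (a * b) (wronskian p q)"
  by (simp add: wronskian_def pderiv_smult smult_diff_right mult.commute)

lemma wronskian_mult: "wronskian (h * p) (h * q) = h\<^sup>2 * wronskian p q"
  by (simp add: wronskian_def pderiv_mult algebra_simps power2_eq_square)

lemma wronskian_linear_combination:
  "wronskian (smult a p + smult b q) (smult c p + smult e q) = smult (a * e - b * c) (wronskian p q)"
  by (simp add: wronskian_def pderiv_smult pderiv_add algebra_simps smult_diff_right smult_diff_left smult_add_right)

lemma wronskian_pcompose: "wronskian (pcompose p r) (pcompose q r) = pcompose (wronskian p q) r * pderiv r"
  by (simp add: wronskian_def pderiv_pcompose pcompose_diff pcompose_mult algebra_simps)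

lemma coeff_mult_top:
  assumes "degree p \<le> m" "degree q \<le> n"
  shows "coeff (p * q) (m + n) = coeff p m * coeff q n"
proof -
  have "coeff (p * q) (m + n) = (\<Sum>i\<in>{m}. coeff p i * coeff q (m + n - i))"
    unfolding coeff_mult
  proof (rule sum.mono_neutral_right)
    show "\<forall>i\<in>{..m + n} - {m}. coeff p i * coeff q (m + n - i) = 0"
    proof
      fix i assume "i \<in> {..m + n} - {m}"
      then have "i > m \<or> m + n - i > n" by auto
      then show "coeff p i * coeff q (m + n - i) = 0" using assms by (auto simp: coeff_eq_0)
    qed
  qed auto
  then show ?thesis by simp
qed

text \<open>
  The two contributions to the coefficient of degree $2d - 1$ cancel. The Wronskian is the Jacobian of the map, up to a
  constant factor, and the bound is the number of critical points of a map of degree \<open>d\<close>.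
\<close>

lemma degree_wronskian_le:
  assumes "degree p \<le> d" "degree q \<le> d"
  shows "degree (wronskian p q) \<le> 2 * d - 2"
proof (cases "d = 0")
  case True
  then show ?thesis using assms by (auto simp: wronskian_def elim!: degree_eq_zeroE)
next
  case False
  have dp: "degree (pderiv p) \<le> d - 1" "degree (pderiv q) \<le> d - 1"
    by (rule degree_le; use assms False in \<open>auto simp: coeff_pderiv coeff_eq_0\<close>)+
  show ?thesis
  proof (rule degree_le, intro allI impI)
    fix i assume i: "2 * d - 2 < i"
    show "coeff (wronskian p q) i = 0"
    proof (cases "i = 2 * d - 1")
      case True
      then have eq: "i = (d - 1) + d" "i = d + (d - 1)" using False by auto
      have "coeff (pderiv p * q) i = coeff (pderiv p) (d - 1) * coeff q d"
        unfolding eq(1) by (rule coeff_mult_top) (use dp assms in auto)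
      moreover have "coeff (p * pderiv q) i = coeff p d * coeff (pderiv q) (d - 1)"
        unfolding eq(2) by (rule coeff_mult_top) (use dp assms in auto)
      ultimately show ?thesis using False by (simp add: wronskian_def coeff_pderiv mult_ac)
    next
      case False
      then have "degree (pderiv p * q) < i" "degree (p * pderiv q) < i"
        using i degree_mult_le[of "pderiv p" q] degree_mult_le[of p "pderiv q"] dp assms by linarith+
      then show ?thesis by (simp add: wronskian_def coeff_eq_0)
    qed
  qed
qed

text \<open>
  Euler's relation $d\,p = x p_x + y p_y$ has been used to eliminate the derivative with respect to the second variable.
\<close>

lemma pderiv_hcomp:
  fixes X Y :: "'r::idom poly"
  assumes "degree p \<le> Suc d"
  shows "Y * pderiv (hcomp (Suc d) p X Y)
     = of_nat (Suc d) * pderiv Y * hcomp (Suc d) p X Y + wronskian X Y * hcomp d (pderiv p) X Y"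
  using assms
proof (induction d arbitrary: p)
  case 0
  obtain a p' where p: "p = pCons a p'" by (cases p)
  with 0 have "degree p' = 0" by (auto split: if_splits)
  then obtain b where "p' = [:b:]" by (rule degree_eq_zeroE)
  then have "p = [:a, b:]" using p by simp
  then show ?case by (simp add: form_def wronskian_def pderiv_pCons pderiv_add pderiv_smult algebra_simps)
next
  case (Suc d)
  obtain c q where p: "p = pCons c q" by (cases p)
  have deg: "degree q \<le> Suc d" using Suc.prems by (auto simp: p split: if_splits)
  let ?G = "hcomp (Suc d) q X Y" and ?H = "hcomp d (pderiv q) X Y"
  have 1: "hcomp (Suc (Suc d)) p X Y = [:c:] * Y ^ Suc (Suc d) + X * ?G"
    by (simp add: p form_pCons)
  have 2: "hcomp (Suc d) (pderiv p) X Y = ?G + X * ?H"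
    by (simp add: p pderiv_pCons form_add[OF ring_map_const_poly] form_pCons)
  have 3: "pderiv (hcomp (Suc (Suc d)) p X Y)
      = [:c:] * (of_nat (Suc (Suc d)) * Y ^ Suc d * pderiv Y) + pderiv X * ?G + X * pderiv ?G"
    unfolding 1 by (simp add: pderiv_add pderiv_mult pderiv_smult pderiv_power_Suc of_nat_poly algebra_simps del: power_Suc)
  show ?case
    unfolding 3 unfolding 2 1
    using arg_cong[OF Suc.IH[OF deg], of "\<lambda>Z. X * Z"]
    by (simp add: wronskian_def algebra_simps)
qed

text \<open>
  The chain rule: the critical points of a composition are those of the inner map and the preimages of those of the outer map.
\<close>

lemma wronskian_hcomp:
  fixes X Y :: "'r::idom poly"
  assumes "degree p \<le> d" "degree q \<le> d" "d > 0"
  shows "wronskian (hcomp d p X Y) (hcomp d q X Y)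
    = hcomp (2 * d - 2) (wronskian p q) X Y * wronskian X Y"
proof (cases "Y = 0")
  case True
  obtain d' where d: "d = Suc d'" using assms by (cases d) auto
  have "hcomp d p X 0 = smult (coeff p d) (X ^ d)" for p :: "'r poly"
  proof -
    have "hcomp d p X 0 = (\<Sum>i\<in>{d}. [:coeff p i:] * X ^ i * 0 ^ (d - i))"
      unfolding form_def by (rule sum.mono_neutral_right) auto
    then show ?thesis by simp
  qed
  then show ?thesis using True
    by (simp add: wronskian_smult) (simp add: wronskian_def mult.commute)
next
  case False
  obtain d' where d: "d = Suc d'" using assms by (cases d) auto
  note rm = ring_map_const_poly
  let ?P = "hcomp d p X Y" and ?Q = "hcomp d q X Y"
  let ?p = "hcomp d' (pderiv p) X Y" and ?q = "hcomp d' (pderiv q) X Y"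
  have dp: "degree (pderiv p) \<le> d'" "degree (pderiv q) \<le> d'"
    by (rule degree_le; use assms d in \<open>auto simp: coeff_pderiv coeff_eq_0\<close>)+
  have "Y * wronskian ?P ?Q = (Y * pderiv ?P) * ?Q - ?P * (Y * pderiv ?Q)"
    by (simp add: wronskian_def algebra_simps)
  also have "\<dots> = wronskian X Y * (?p * ?Q - ?P * ?q)"
    using pderiv_hcomp[of p d' Y X] pderiv_hcomp[of q d' Y X] assms by (simp add: d algebra_simps)
  also have "?p * ?Q - ?P * ?q = hcomp (d' + d) (wronskian p q) X Y"
    using form_mult[OF rm dp(1) assms(2), of X Y] form_mult[OF rm assms(1) dp(2), of X Y]
    by (simp add: wronskian_def form_diff[OF rm] add.commute)
  also have "\<dots> = Y * hcomp (2 * d - 2) (wronskian p q) X Y"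
    using form_raise_degree[OF rm degree_wronskian_le[OF assms(1,2)], of 1 X Y] by (simp add: d mult_2)
  finally have "Y * wronskian ?P ?Q = Y * (hcomp (2 * d - 2) (wronskian p q) X Y * wronskian X Y)"
    by (simp add: mult_ac)
  then show ?thesis using False by simp
qed

section \<open>Nondegenerate pairs of forms\<close>

definition in_ideal :: "'r::comm_ring_1 \<Rightarrow> 'r \<Rightarrow> 'r \<Rightarrow> bool" where
  "in_ideal a b x \<longleftrightarrow> (\<exists>u v. x = u * a + v * b)"

lemma in_ideal_add: "in_ideal a b x \<Longrightarrow> in_ideal a b y \<Longrightarrow> in_ideal a b (x + y)"
proof -
  assume "in_ideal a b x" "in_ideal a b y"
  then obtain u v u' v' where "x = u * a + v * b" "y = u' * a + v' * b" by (auto simp: in_ideal_def)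
  then have "x + y = (u + u') * a + (v + v') * b" by (simp add: algebra_simps)
  then show ?thesis unfolding in_ideal_def by blast
qed

lemma in_ideal_mult: "in_ideal a b x \<Longrightarrow> in_ideal a b (c * x)"
proof -
  assume "in_ideal a b x"
  then obtain u v where "x = u * a + v * b" by (auto simp: in_ideal_def)
  then have "c * x = (c * u) * a + (c * v) * b" by (simp add: algebra_simps)
  then show ?thesis unfolding in_ideal_def by blast
qed

lemma in_ideal_self: "in_ideal a b a" "in_ideal a b b"
  unfolding in_ideal_def by (rule exI[of _ 1], rule exI[of _ 0], simp)
    (rule exI[of _ 0], rule exI[of _ 1], simp)

lemma in_ideal_trans: "in_ideal c e a \<Longrightarrow> in_ideal c e b \<Longrightarrow> in_ideal a b x \<Longrightarrow> in_ideal c e x"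
proof -
  assume *: "in_ideal c e a" "in_ideal c e b" "in_ideal a b x"
  then obtain u v where "x = u * a + v * b" by (auto simp: in_ideal_def)
  then show ?thesis using * by (auto intro: in_ideal_add in_ideal_mult)
qed

text \<open>
  Every term of the binomial expansion is divisible by $a^m$ or by $b^n$.
\<close>

lemma add_power_in_ideal: "in_ideal (a ^ m) (b ^ n) ((a + b) ^ (m + n))"
proof (induction "m + n" arbitrary: m n)
  case 0
  then show ?case using in_ideal_self by auto
next
  case (Suc k)
  show ?case
  proof (cases "m = 0 \<or> n = 0")
    case True
    then have "in_ideal (a ^ m) (b ^ n) 1" using in_ideal_self by (metis power_0)
    from in_ideal_mult[OF this, of "(a + b) ^ (m + n)"] show ?thesis by simp
  next
    case False
    then obtain m' n' where mn: "m = Suc m'" "n = Suc n'" by (auto simp: gr0_conv_Suc)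
    have 1: "in_ideal (a ^ m') (b ^ n) ((a + b) ^ (m' + n))" by (rule Suc(1)) (use Suc mn in auto)
    have 2: "in_ideal (a ^ m) (b ^ n') ((a + b) ^ (m + n'))" by (rule Suc(1)) (use Suc mn in auto)
    have A: "in_ideal (a ^ m) (b ^ n) (a * (a + b) ^ (m' + n))"
    proof -
      obtain u v where "(a + b) ^ (m' + n) = u * a ^ m' + v * b ^ n" using 1 by (auto simp: in_ideal_def)
      then have "a * (a + b) ^ (m' + n) = u * a ^ m + (a * v) * b ^ n" by (simp add: mn algebra_simps)
      then show ?thesis unfolding in_ideal_def by blast
    qed
    have B: "in_ideal (a ^ m) (b ^ n) (b * (a + b) ^ (m + n'))"
    proof -
      obtain u v where "(a + b) ^ (m + n') = u * a ^ m + v * b ^ n'" using 2 by (auto simp: in_ideal_def)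
      then have "b * (a + b) ^ (m + n') = (b * u) * a ^ m + v * b ^ n" by (simp add: mn algebra_simps)
      then show ?thesis unfolding in_ideal_def by blast
    qed
    have "(a + b) ^ (m + n) = a * (a + b) ^ (m' + n) + b * (a + b) ^ (m + n')"
      by (simp add: mn algebra_simps)
    then show ?thesis using in_ideal_add[OF A B] by simp
  qed
qed

text \<open>
  Up to a nonzero constant, the ideal of the two forms contains a power of each variable; in other words, their resultant does
  not vanish. The variables are replaced by arbitrary polynomials because this makes the property stable under
  composition and yields Bezout identities along every line.
\<close>

definition nondegenerate :: "nat \<Rightarrow> 'r::idom poly \<Rightarrow> 'r poly \<Rightarrow> bool" where
  "nondegenerate d p q \<longleftrightarrow> (\<exists>\<rho> N. \<rho> \<noteq> 0 \<and> (\<forall>U V.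
     in_ideal (hcomp d p U V) (hcomp d q U V) ([:\<rho>:] * U ^ N) \<and>
     in_ideal (hcomp d p U V) (hcomp d q U V) ([:\<rho>:] * V ^ N)))"

lemma const_poly_power: "[:c:] ^ n = [:(c::'r::comm_ring_1) ^ n:]"
  by (induction n) (auto simp: one_pCons)

lemma nondegenerate_hcomp:
  assumes "nondegenerate d p q" "nondegenerate D X Y" "degree X \<le> D" "degree Y \<le> D"
  shows "nondegenerate (d * D) (hcomp d p X Y) (hcomp d q X Y)"
proof -
  obtain \<rho> N where r: "\<rho> \<noteq> 0"
    "\<And>U V. in_ideal (hcomp d p U V) (hcomp d q U V) ([:\<rho>:] * U ^ N)"
    "\<And>U V. in_ideal (hcomp d p U V) (hcomp d q U V) ([:\<rho>:] * V ^ N)"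
    using assms(1) by (auto simp: nondegenerate_def)
  obtain \<sigma> M where s: "\<sigma> \<noteq> 0"
    "\<And>U V. in_ideal (hcomp D X U V) (hcomp D Y U V) ([:\<sigma>:] * U ^ M)"
    "\<And>U V. in_ideal (hcomp D X U V) (hcomp D Y U V) ([:\<sigma>:] * V ^ M)"
    using assms(2) by (auto simp: nondegenerate_def)
  have key: "in_ideal (hcomp d p x y) (hcomp d q x y) ([:\<rho> * \<sigma> ^ (N + N):] * W ^ (M * (N + N)))"
    if xy: "in_ideal x y ([:\<sigma>:] * W ^ M)" for x y W
  proof -
    obtain u v where uv: "[:\<sigma>:] * W ^ M = u * x + v * y" using xy by (auto simp: in_ideal_def)
    have "in_ideal (hcomp d p x y) (hcomp d q x y) ([:\<rho>:] * (u * x) ^ N)"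
      using in_ideal_mult[OF r(2)[of x y], of "u ^ N"] by (simp add: power_mult_distrib mult_ac)
    moreover have "in_ideal (hcomp d p x y) (hcomp d q x y) ([:\<rho>:] * (v * y) ^ N)"
      using in_ideal_mult[OF r(3)[of x y], of "v ^ N"] by (simp add: power_mult_distrib mult_ac)
    moreover have "in_ideal ([:\<rho>:] * (u * x) ^ N) ([:\<rho>:] * (v * y) ^ N) ([:\<rho>:] * (u * x + v * y) ^ (N + N))"
    proof -
      obtain a b where "(u * x + v * y) ^ (N + N) = a * (u * x) ^ N + b * (v * y) ^ N"
        using add_power_in_ideal[of "u * x" N "v * y" N] by (auto simp: in_ideal_def)
      then have "[:\<rho>:] * (u * x + v * y) ^ (N + N) = a * ([:\<rho>:] * (u * x) ^ N) + b * ([:\<rho>:] * (v * y) ^ N)"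
        by (simp add: smult_add_right)
      then show ?thesis unfolding in_ideal_def by blast
    qed
    ultimately have "in_ideal (hcomp d p x y) (hcomp d q x y) ([:\<rho>:] * (u * x + v * y) ^ (N + N))"
      by (rule in_ideal_trans)
    moreover have "[:\<rho>:] * (u * x + v * y) ^ (N + N) = [:\<rho> * \<sigma> ^ (N + N):] * W ^ (M * (N + N))"
      unfolding uv[symmetric] power_mult_distrib const_poly_power power_mult by (simp add: mult.commute)
    ultimately show ?thesis by simp
  qed
  show ?thesis
    unfolding nondegenerate_def
    by (rule exI[of _ "\<rho> * \<sigma> ^ (N + N)"], rule exI[of _ "M * (N + N)"])
      (use r(1) s in \<open>auto simp: form_hcomp[OF ring_map_const_poly assms(3,4)] simp del: mult_pCons_left intro!: key\<close>)
qed

lemma nondegenerate_smultD: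
  assumes "nondegenerate d (smult c p) (smult c q)"
  shows "nondegenerate d p q"
proof -
  have "in_ideal (hcomp d p U V) (hcomp d q U V) x"
    if "in_ideal (hcomp d (smult c p) U V) (hcomp d (smult c q) U V) x" for U V x
    using that by (rule in_ideal_trans[rotated 2])
      (auto simp: form_smult[OF ring_map_const_poly] simp del: mult_pCons_left intro: in_ideal_mult in_ideal_self)
  then show ?thesis using assms unfolding nondegenerate_def by blast
qed

lemma nondegenerate_linear_combination:
  assumes "nondegenerate d p q" "a * e - b * c \<noteq> 0"
  shows "nondegenerate d (smult a p + smult b q) (smult c p + smult e q)"
proof -
  obtain \<rho> N where r: "\<rho> \<noteq> 0"
    "\<And>U V. in_ideal (hcomp d p U V) (hcomp d q U V) ([:\<rho>:] * U ^ N)"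
    "\<And>U V. in_ideal (hcomp d p U V) (hcomp d q U V) ([:\<rho>:] * V ^ N)"
    using assms(1) by (auto simp: nondegenerate_def)
  define D where "D = a * e - b * c"
  note rm = ring_map_const_poly
  have *: "in_ideal (hcomp d (smult a p + smult b q) U V) (hcomp d (smult c p + smult e q) U V) ([:D:] * x)"
    if x: "in_ideal (hcomp d p U V) (hcomp d q U V) x" for U V x
  proof -
    let ?P = "hcomp d p U V" and ?Q = "hcomp d q U V"
    let ?P' = "hcomp d (smult a p + smult b q) U V" and ?Q' = "hcomp d (smult c p + smult e q) U V"
    obtain u v where x: "x = u * ?P + v * ?Q" using x by (auto simp: in_ideal_def)
    have P': "?P' = smult a ?P + smult b ?Q" and Q': "?Q' = smult c ?P + smult e ?Q"
      by (simp_all add: form_add[OF rm] form_smult[OF rm])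
    have "[:D:] * ?P = [:e:] * ?P' + [:-b:] * ?Q'" "[:D:] * ?Q = [:-c:] * ?P' + [:a:] * ?Q'"
      unfolding P' Q' D_def by (simp_all add: smult_add_right algebra_simps smult_diff_left)
    then have "in_ideal ?P' ?Q' ([:D:] * ?P)" "in_ideal ?P' ?Q' ([:D:] * ?Q)"
      unfolding in_ideal_def by blast+
    then have "in_ideal ?P' ?Q' (u * ([:D:] * ?P) + v * ([:D:] * ?Q))"
      by (rule in_ideal_add[OF in_ideal_mult in_ideal_mult])
    moreover have "u * ([:D:] * ?P) + v * ([:D:] * ?Q) = [:D:] * x" by (simp add: x smult_add_right)
    ultimately show ?thesis by simp
  qed
  show ?thesis
    unfolding nondegenerate_def
  proof (intro exI conjI allI)
    show "D * \<rho> \<noteq> 0" using assms(2) r(1) by (simp add: D_def)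
    have D: "[:D * \<rho>:] * x = [:D:] * ([:\<rho>:] * x)" for x by (simp add: mult.commute)
    show "in_ideal (hcomp d (smult a p + smult b q) U V) (hcomp d (smult c p + smult e q) U V) ([:D * \<rho>:] * U ^ N)"
      for U V unfolding D by (rule *[OF r(2)])
    show "in_ideal (hcomp d (smult a p + smult b q) U V) (hcomp d (smult c p + smult e q) U V) ([:D * \<rho>:] * V ^ N)"
      for U V unfolding D by (rule *[OF r(3)])
  qed
qed

lemma nondegenerate_bezout:
  assumes "nondegenerate d p q" and "u * U + v * V = 1"
  shows "\<exists>A B \<rho>. \<rho> \<noteq> 0 \<and> A * hcomp d p U V + B * hcomp d q U V = [:\<rho>:]"
proof -
  obtain \<rho> N where r: "\<rho> \<noteq> 0"
    "in_ideal (hcomp d p U V) (hcomp d q U V) ([:\<rho>:] * U ^ N)"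
    "in_ideal (hcomp d p U V) (hcomp d q U V) ([:\<rho>:] * V ^ N)"
    using assms(1) unfolding nondegenerate_def by metis
  obtain a b where "(u * U + v * V) ^ (N + N) = a * (u * U) ^ N + b * (v * V) ^ N"
    using add_power_in_ideal[of "u * U" N "v * V" N] by (auto simp: in_ideal_def)
  then have eq: "[:\<rho>:] = (a * u ^ N) * ([:\<rho>:] * U ^ N) + (b * v ^ N) * ([:\<rho>:] * V ^ N)"
  proof -
    assume "(u * U + v * V) ^ (N + N) = a * (u * U) ^ N + b * (v * V) ^ N"
    then have "1 = a * (u * U) ^ N + b * (v * V) ^ N" using assms(2) by simp
    then have "[:\<rho>:] * 1 = [:\<rho>:] * (a * (u * U) ^ N + b * (v * V) ^ N)" by (rule arg_cong)
    then have E: "[:\<rho>:] = smult \<rho> (a * (u * U) ^ N + b * (v * V) ^ N)" by simp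
    show ?thesis by (subst E) (simp add: power_mult_distrib smult_add_right mult_ac)
  qed
  have "in_ideal (hcomp d p U V) (hcomp d q U V) [:\<rho>:]"
    by (subst eq) (intro in_ideal_add in_ideal_mult r)
  then obtain A B where "[:\<rho>:] = A * hcomp d p U V + B * hcomp d q U V"
    unfolding in_ideal_def by blast
  then show ?thesis using r(1) by metis
qed

text \<open>The form obtained by exchanging the two variables.\<close>

definition reversal :: "nat \<Rightarrow> 'r::comm_ring_1 poly \<Rightarrow> 'r poly" where
  "reversal d p = (\<Sum>i\<le>d. monom (coeff p (d - i)) i)"

lemma coeff_reversal: "coeff (reversal d p) i = (if i \<le> d then coeff p (d - i) else 0)"
  by (simp add: reversal_def coeff_sum)

lemma degree_reversal: "degree (reversal d p) \<le> d"
  by (rule degree_le) (simp add: coeff_reversal)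

lemma form_reversal: "form \<phi> d (reversal d p) x y = form \<phi> d p y x"
proof -
  have "form \<phi> d (reversal d p) x y = (\<Sum>i\<in>{..d}. \<phi> (coeff p (d - i)) * x ^ i * y ^ (d - i))"
    by (simp add: form_def coeff_reversal)
  also have "\<dots> = (\<Sum>i\<in>{..d}. \<phi> (coeff p i) * x ^ (d - i) * y ^ i)"
    by (rule sum.reindex_bij_witness[of _ "\<lambda>i. d - i" "\<lambda>i. d - i"]) auto
  finally show ?thesis by (simp add: form_def mult_ac)
qed

lemma nondegenerateI:
  assumes pq: "degree p \<le> d" "degree q \<le> d"
    and 1: "A * p + B * q = [:\<rho>:]" "\<rho> \<noteq> 0"
    and 2: "A' * reversal d p + B' * reversal d q = [:\<rho>':]" "\<rho>' \<noteq> 0"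
  shows "nondegenerate d p q"
proof -
  note rm = ring_map_const_poly
  define N where "N = Max {degree A, degree B, degree A', degree B'}"
  have N: "degree A \<le> N" "degree B \<le> N" "degree A' \<le> N" "degree B' \<le> N"
    by (auto simp: N_def)
  have I: "in_ideal (hcomp d p U V) (hcomp d q U V) ([:\<rho>:] * V ^ (N + d))" for U V
  proof -
    have "[:\<rho>:] * V ^ (N + d) = hcomp (N + d) (A * p + B * q) U V"
      unfolding 1(1) by (rule form_const[OF rm, symmetric])
    also have "\<dots> = hcomp N A U V * hcomp d p U V + hcomp N B U V * hcomp d q U V"
      by (simp add: form_add[OF rm] form_mult[OF rm] N pq)
    finally show ?thesis unfolding in_ideal_def by blast
  qed
  have J: "in_ideal (hcomp d p U V) (hcomp d q U V) ([:\<rho>':] * U ^ (N + d))" for U V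
  proof -
    have "[:\<rho>':] * U ^ (N + d) = hcomp (N + d) (A' * reversal d p + B' * reversal d q) V U"
      unfolding 2(1) by (rule form_const[OF rm, symmetric])
    also have "\<dots> = hcomp N A' V U * hcomp d (reversal d p) V U + hcomp N B' V U * hcomp d (reversal d q) V U"
      by (simp add: form_add[OF rm] form_mult[OF rm] N degree_reversal)
    finally show ?thesis unfolding in_ideal_def form_reversal by blast
  qed
  show ?thesis unfolding nondegenerate_def
  proof (intro exI conjI allI)
    show "\<rho> * \<rho>' \<noteq> 0" using 1 2 by simp
    show "in_ideal (hcomp d p U V) (hcomp d q U V) ([:\<rho> * \<rho>':] * U ^ (N + d))" for U V
      using in_ideal_mult[OF J[of U V], of "[:\<rho>:]"] by (simp add: mult.commute)
    show "in_ideal (hcomp d p U V) (hcomp d q U V) ([:\<rho> * \<rho>':] * V ^ (N + d))" for U V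
      using in_ideal_mult[OF I[of U V], of "[:\<rho>':]"] by (simp add: mult.commute)
  qed
qed

section \<open>Orders of Wronskians\<close>

lemma order_linear_power_mult:
  fixes a :: "'r::idom poly"
  assumes "poly a v \<noteq> 0"
  shows "order v ([:-v, 1:] ^ n * a) = n"
proof -
  have "[:-v, 1:] ^ n * a \<noteq> 0" using assms by auto
  then show ?thesis using assms by (subst order_mult) (auto simp: order_power_n_n order_0I)
qed

lemma order_decompE:
  fixes p :: "'r::idom poly"
  assumes "p \<noteq> 0"
  obtains a where "p = [:-v, 1:] ^ order v p * a" "poly a v \<noteq> 0"
  using order_decomp[OF assms, of v] by (auto simp: poly_eq_0_iff_dvd)

lemma linear_mult_pderiv_power:
  "[:-v, 1:] * pderiv ([:-v, 1:] ^ n * a) = [:-v, 1:] ^ n * (of_nat n * a + [:-v, 1:] * pderiv (a :: 'r::idom poly))"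
proof (cases n)
  case (Suc k)
  have "pderiv ([:-v, 1:] ^ n) = of_nat n * [:-v, 1:] ^ k"
    unfolding Suc by (subst pderiv_power_Suc) (simp add: pderiv_pCons of_nat_poly)
  then have "pderiv ([:-v, 1:] ^ n * a) = of_nat n * [:-v, 1:] ^ k * a + [:-v, 1:] ^ n * pderiv a"
    by (simp add: pderiv_mult mult_ac)
  moreover have "[:-v, 1:] ^ n = [:-v, 1:] * [:-v, 1:] ^ k" by (simp add: Suc)
  ultimately show ?thesis by (simp only: distrib_left mult_ac)
qed simp

text \<open>
  With $p = (z - v)^i a$ and $q = (z - v)^j b$ the product $(z - v) W$ equals $(z - v)^{i + j} ((i - j) a b + (z - v) (a' b - a b'))$,
  and $i - j$ is not zero in \<open>K\<close>.
\<close>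

lemma order_wronskian:
  fixes p q :: "'r::{idom, ring_char_0} poly"
  assumes "p \<noteq> 0" "q \<noteq> 0" "order v p \<noteq> order v q"
  shows "wronskian p q \<noteq> 0" "Suc (order v (wronskian p q)) = order v p + order v q"
proof -
  define i j where "i = order v p" and "j = order v q"
  obtain a where a: "p = [:-v, 1:] ^ i * a" "poly a v \<noteq> 0" using order_decompE[OF assms(1)] i_def by metis
  obtain b where b: "q = [:-v, 1:] ^ j * b" "poly b v \<noteq> 0" using order_decompE[OF assms(2)] j_def by metis
  define l where "l = [:-v, 1::'r:]"
  define e where "e = (of_nat i - of_nat j) * (a * b) + l * wronskian a b"
  have "l * wronskian p q = (l * pderiv p) * q - p * (l * pderiv q)"
    by (simp add: wronskian_def algebra_simps)
  also have "l * pderiv p = l ^ i * (of_nat i * a + l * pderiv a)"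
    unfolding l_def a(1) by (rule linear_mult_pderiv_power)
  also have "l * pderiv q = l ^ j * (of_nat j * b + l * pderiv b)"
    unfolding l_def b(1) by (rule linear_mult_pderiv_power)
  also have "l ^ i * (of_nat i * a + l * pderiv a) * q - p * (l ^ j * (of_nat j * b + l * pderiv b)) = l ^ (i + j) * e"
  proof -
    have ring: "L * (I * x + l * x') * (M * y) - L * x * (M * (J * y + l * y')) =
        L * M * ((I - J) * (x * y) + l * (x' * y - x * y'))" for L M I J x y x' y' :: "'r poly"
      by (simp add: algebra_simps)
    have p: "p = l ^ i * a" and q: "q = l ^ j * b" using a(1) b(1) by (simp_all only: l_def)
    show ?thesis unfolding e_def wronskian_def power_add
      by (subst p, subst q) (rule ring)
  qed
  finally have eq: "l * wronskian p q = l ^ (i + j) * e" .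
  have "poly e v = (of_nat i - of_nat j) * (poly a v * poly b v)" by (simp add: e_def l_def)
  then have e: "poly e v \<noteq> 0" using a(2) b(2) assms(3) by (simp add: i_def j_def)
  then have ne: "l * wronskian p q \<noteq> 0" unfolding eq by (auto simp: l_def)
  then show "wronskian p q \<noteq> 0" by auto
  have "order v (l * wronskian p q) = i + j"
    unfolding eq unfolding l_def by (rule order_linear_power_mult[OF e])
  moreover have "order v (l * wronskian p q) = 1 + order v (wronskian p q)"
    using order_mult[OF ne, of v] order_power_n_n[of v 1] by (simp add: l_def)
  ultimately show "Suc (order v (wronskian p q)) = order v p + order v q" by (simp add: i_def j_def)
qed

lemma degree_wronskian:
  fixes p q :: "'r::{idom, ring_char_0} poly"
  assumes "p \<noteq> 0" "q \<noteq> 0" "degree p \<noteq> degree q"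
  shows "Suc (degree (wronskian p q)) = degree p + degree q"
proof -
  define m n where "m = degree p" and "n = degree q"
  have d1: "degree (pCons 0 (pderiv p)) \<le> m" "degree (pCons 0 (pderiv q)) \<le> n"
    by (rule degree_le; simp add: coeff_pCons coeff_pderiv coeff_eq_0 m_def n_def split: nat.splits)+
  have c1: "coeff (pCons 0 (pderiv p)) m = of_nat m * coeff p m" "coeff (pCons 0 (pderiv q)) n = of_nat n * coeff q n"
    by (auto simp: coeff_pCons coeff_pderiv split: nat.splits)
  have eq: "pCons 0 (wronskian p q) = pCons 0 (pderiv p) * q - p * pCons 0 (pderiv q)"
    by (simp add: wronskian_def)
  have "coeff (pCons 0 (wronskian p q)) (m + n) = (of_nat m - of_nat n) * (coeff p m * coeff q n)"
    unfolding eq using d1 by (simp only: coeff_diff coeff_mult_top m_def n_def order.refl)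
      (simp only: c1[unfolded m_def n_def] algebra_simps)
  then have nz: "coeff (pCons 0 (wronskian p q)) (m + n) \<noteq> 0"
    using assms by (simp add: m_def n_def)
  then have "degree (pCons 0 (wronskian p q)) \<ge> m + n" by (rule le_degree)
  moreover have "degree (pCons 0 (wronskian p q)) \<le> m + n"
    unfolding eq
    by (intro degree_diff_le order.trans[OF degree_mult_le] add_mono d1) (auto simp: m_def n_def)
  ultimately show ?thesis using nz by (auto simp: m_def n_def split: if_splits)
qed

lemma size_proots_alg_closed:
  fixes p :: "'r::alg_closed_field poly"
  shows "size (proots p) = degree p"
proof (cases "p = 0")
  case False
  then obtain A where A: "size A = degree p" "p = smult (lead_coeff p) (\<Prod>x\<in>#A. [:-x, 1:])"
    using alg_closed_imp_factorization by blast
  have "proots p = proots (\<Prod>x\<in>#A. [:-x, 1:])" by (subst A(2)) (use False in simp)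
  also have "\<dots> = A"
  proof (induction A)
    case (add x A)
    have "(\<Prod>x\<in>#A. [:- x, 1:]) \<noteq> 0" by (auto simp: prod_mset_zero_iff)
    then show ?case using add by (simp add: proots_mult del: mult_pCons_left)
  qed simp
  finally show ?thesis using A by simp
qed simp

lemma sum_order_le:
  fixes p :: "'r::idom poly"
  assumes "p \<noteq> 0" "finite A"
  shows "(\<Sum>v\<in>A. order v p) \<le> degree p"
proof -
  have fin: "finite {v. poly p v = 0}" using assms poly_roots_finite by blast
  have "(\<Sum>v\<in>A. order v p) = (\<Sum>v\<in>A \<inter> {v. poly p v = 0}. order v p)"
    by (rule sum.mono_neutral_right) (use assms in \<open>auto simp: order_0I\<close>)
  also have "\<dots> \<le> (\<Sum>v\<in>{v. poly p v = 0}. order v p)"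
    by (rule sum_mono2) (use fin in auto)
  also have "\<dots> = size (proots p)"
    using assms by (simp add: size_multiset_overloaded_eq)
  also have "\<dots> \<le> degree p" by (rule size_proots_le)
  finally show ?thesis .
qed

lemma coeff_linear_power_pred: "coeff ([:a, 1::'r::comm_ring_1:] ^ Suc k) k = of_nat (Suc k) * a"
proof (induction k)
  case (Suc k)
  have top: "coeff ([:a, 1::'r:] ^ n) n = 1" for n
  proof (induction n)
    case (Suc n)
    have "degree ([:a, 1::'r:] ^ n) \<le> n" using degree_power_le[of "[:a, 1::'r:]" n] by simp
    from coeff_mult_top[OF _ this, of "[:a, 1:]" 1] Suc show ?case by simp
  qed simp
  have "coeff ([:a, 1::'r:] ^ Suc (Suc k)) (Suc k) = a * coeff ([:a, 1:] ^ Suc k) (Suc k) + coeff ([:a, 1:] ^ Suc k) k"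
    by (subst power_Suc) (simp add: coeff_pCons del: power_Suc)
  then show ?case using Suc top[of "Suc k"] by (simp add: algebra_simps del: power_Suc)
qed auto

lemma order_pcompose_shift:
  fixes p :: "'r::idom poly"
  assumes "p \<noteq> 0"
  shows "order 0 (pcompose p [:v, 1:]) = order v p"
proof -
  obtain a where a: "p = [:-v, 1:] ^ order v p * a" "poly a v \<noteq> 0" using order_decompE[OF assms] by blast
  have "pcompose ([:-v, 1:] ^ n) [:v, 1:] = [:-0, 1:] ^ n" for n
  proof (induction n)
    case (Suc n)
    then show ?case unfolding power_Suc pcompose_mult by (simp add: pcompose_pCons)
  qed (simp add: pcompose_1)
  then have "pcompose p [:v, 1:] = [:-0, 1:] ^ order v p * pcompose a [:v, 1:]"
    by (subst a(1)) (simp add: pcompose_mult)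
  moreover have "poly (pcompose a [:v, 1:]) 0 \<noteq> 0" using a by (simp add: poly_pcompose)
  ultimately show ?thesis using order_linear_power_mult[of "pcompose a [:v, 1:]" 0] by simp
qed

lemma order_full_degree:
  fixes p :: "'r::idom poly"
  assumes "p \<noteq> 0" "order v p = degree p"
  obtains c where "c \<noteq> 0" "p = smult c ([:-v, 1:] ^ degree p)"
proof -
  obtain a where a: "p = [:-v, 1:] ^ order v p * a" "poly a v \<noteq> 0" using order_decompE[OF assms(1)] by blast
  then have "degree p = order v p + degree a"
    by (subst a(1), subst degree_mult_eq) (auto simp: degree_linear_power)
  then have "degree a = 0" using assms by simp
  then obtain c where "a = [:c:]" by (rule degree_eq_zeroE)
  then show ?thesis using a assms that[of c] by auto
qed

text \<open>
  The assumption on the degrees says that $p / q$ has a pole at infinity. Otherwise every zero \<open>v\<close> of the Wronskian would be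
  a pole of $p / q$ too, so its order there would be at most $2\,\mathrm{ord}_v q - 2$. Summation over all \<open>v\<close> bounds the
  degree of the Wronskian by $2 \deg q - 2$, but that degree is $\deg p + \deg q - 1$.
\<close>

lemma exists_branch_direction:
  fixes p q :: "'r::{alg_closed_field, field_char_0} poly"
  assumes "p \<noteq> 0" "q \<noteq> 0" "degree q < degree p" "degree q > 0"
  obtains v where "poly (wronskian p q) v = 0" "order v q \<le> order v p"
proof (rule ccontr)
  assume "\<not> thesis"
  then have lt: "order v p < order v q" if "poly (wronskian p q) v = 0" for v
    using that not_less \<open>\<And>v. \<lbrakk>poly (wronskian p q) v = 0; order v q \<le> order v p\<rbrakk> \<Longrightarrow> thesis\<close> by blast
  define W where "W = wronskian p q"
  have deg: "Suc (degree W) = degree p + degree q" unfolding W_def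
    by (rule degree_wronskian) (use assms in auto)
  have W0: "W \<noteq> 0" using deg assms by auto
  define Z where "Z = {v. poly W v = 0}"
  have fin: "finite Z" unfolding Z_def using W0 poly_roots_finite by blast
  have "degree W > 0" using deg assms by simp
  then have ne: "Z \<noteq> {}" unfolding Z_def using alg_closed_imp_poly_has_root by blast
  have "degree W = size (proots W)" by (simp add: size_proots_alg_closed)
  also have "\<dots> = (\<Sum>v\<in>Z. order v W)" using W0 by (simp add: size_multiset_overloaded_eq Z_def)
  finally have "degree W + 2 * card Z = (\<Sum>v\<in>Z. order v W + 2)"
    unfolding sum.distrib by simp
  also have "\<dots> \<le> (\<Sum>v\<in>Z. 2 * order v q)"
  proof (rule sum_mono)
    fix v assume "v \<in> Z"
    then have l: "order v p < order v q" using lt by (simp add: Z_def W_def)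
    then have "Suc (order v W) = order v p + order v q" unfolding W_def
      by (intro order_wronskian assms) auto
    then show "order v W + 2 \<le> 2 * order v q" using l by linarith
  qed
  also have "\<dots> \<le> 2 * degree q" using sum_order_le[OF assms(2) fin] by (simp flip: sum_distrib_left)
  finally have "degree W + 2 * card Z \<le> 2 * degree q" .
  moreover have "card Z > 0" using ne fin by (simp add: card_gt_0_iff)
  ultimately show False using deg assms by linarith
qed

text \<open>
  Here $p / q$ is the limit map at a new scale, \<open>v\<close> is the direction in which to zoom in further, and \<open>w\<close> is the image of this
  direction. The sum of the two orders exceeds the order of the Wronskian at \<open>v\<close> by one, so it is at most
  $n + s$. If it equals $n + s$, then \<open>q\<close> and $p - w q$ are constant multiples of powers of $z - v$. As \<open>p\<close> has no term of degree \<open>s\<close>,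
  $v = 0$ would imply $w = 0$, and both polynomials would be monomials. Hence $v \neq 0$, and the term of \<open>q\<close> of degree $s - 1$
  is present.
\<close>

lemma residue_step:
  fixes p q :: "'r::{alg_closed_field, field_char_0} poly"
  assumes "degree p = n" "degree q = s" "0 < s" "s < n" "coeff p s = 0"
    and not_monom: "(\<exists>i<n. coeff p i \<noteq> 0) \<or> (\<exists>i<s. coeff q i \<noteq> 0)"
  obtains v w where
    "wronskian (pcompose (p - smult w q) [:v, 1:]) (pcompose q [:v, 1:]) \<noteq> 0"
    "poly (wronskian (pcompose (p - smult w q) [:v, 1:]) (pcompose q [:v, 1:])) 0 = 0"
    "order 0 (pcompose q [:v, 1:]) < order 0 (pcompose (p - smult w q) [:v, 1:])"
    "order 0 (pcompose (p - smult w q) [:v, 1:]) + order 0 (pcompose q [:v, 1:]) \<le> n + s"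
    "order 0 (pcompose (p - smult w q) [:v, 1:]) + order 0 (pcompose q [:v, 1:]) < n + s \<or> coeff q (s - 1) \<noteq> 0"
proof -
  have nz: "p \<noteq> 0" "q \<noteq> 0" using assms by auto
  obtain v where v: "poly (wronskian p q) v = 0" "order v q \<le> order v p"
    using exists_branch_direction[of p q] assms nz by metis
  define k where "k = order v q"
  obtain b where b: "q = [:-v, 1:] ^ k * b" "poly b v \<noteq> 0" using order_decompE[OF nz(2)] k_def by metis
  have "[:-v, 1:] ^ k dvd p" using v by (simp add: order_divides k_def)
  then obtain a where a: "p = [:-v, 1:] ^ k * a" by auto
  define w where "w = poly a v / poly b v"
  define r where "r = p - smult w q"
  have degW: "Suc (degree (wronskian p q)) = n + s"
    using degree_wronskian[OF nz] assms by simp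
  have W0: "wronskian p q \<noteq> 0" using degW assms by auto
  have Wr: "wronskian r q = wronskian p q"
    by (simp add: r_def wronskian_def pderiv_diff pderiv_smult algebra_simps)
  have r0: "r \<noteq> 0" using W0 Wr by (auto simp: wronskian_def)
  have rk: "r = [:-v, 1:] ^ k * (a - smult w b)" by (subst r_def, subst a, subst b(1)) (simp add: algebra_simps)
  have "poly (a - smult w b) v = 0" using b by (simp add: w_def)
  then obtain a' where "a - smult w b = [:-v, 1:] * a'"
    unfolding poly_eq_0_iff_dvd by (elim dvdE)
  then have "r = [:-v, 1:] ^ Suc k * a'" by (subst rk) (simp add: mult_ac del: mult_pCons_left mult_pCons_right)
  then have "[:-v, 1:] ^ Suc k dvd r" by (rule dvdI)
  then have ord: "order v q < order v r" using r0 by (simp only: order_divides k_def) simp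
  have ordW: "Suc (order v (wronskian p q)) = order v r + order v q"
    using order_wronskian(2)[OF r0 nz(2), of v] ord by (simp add: Wr)
  have le: "order v r + order v q \<le> n + s"
    using order_degree[OF W0, of v] ordW degW by linarith
  have "degree (- smult w q) < degree p" using assms by simp
  from degree_add_eq_left[OF this] have degr: "degree r = n" using assms by (simp add: r_def)
  show thesis
  proof (rule that[of w v])
    have pd: "pderiv [:v, 1:] = (1::'r poly)" by (simp add: pderiv_pCons one_pCons)
    have WW: "wronskian (pcompose (p - smult w q) [:v, 1:]) (pcompose q [:v, 1:]) = pcompose (wronskian p q) [:v, 1:]"
      unfolding wronskian_pcompose using Wr by (simp add: pd r_def)
    show "wronskian (pcompose (p - smult w q) [:v, 1:]) (pcompose q [:v, 1:]) \<noteq> 0"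
      unfolding WW using W0 by (simp add: pcompose_eq_0_iff)
    show "poly (wronskian (pcompose (p - smult w q) [:v, 1:]) (pcompose q [:v, 1:])) 0 = 0"
      unfolding WW using v by (simp add: poly_pcompose)
    have oo: "order 0 (pcompose (p - smult w q) [:v, 1:]) = order v r" "order 0 (pcompose q [:v, 1:]) = order v q"
      using order_pcompose_shift[OF r0] order_pcompose_shift[OF nz(2)] by (simp_all add: r_def)
    show "order 0 (pcompose q [:v, 1:]) < order 0 (pcompose (p - smult w q) [:v, 1:])"
      unfolding oo by (rule ord)
    show "order 0 (pcompose (p - smult w q) [:v, 1:]) + order 0 (pcompose q [:v, 1:]) \<le> n + s"
      unfolding oo by (rule le)
    show "order 0 (pcompose (p - smult w q) [:v, 1:]) + order 0 (pcompose q [:v, 1:]) < n + s \<or> coeff q (s - 1) \<noteq> 0"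
      unfolding oo
    proof (rule disjCI)
      assume c: "\<not> coeff q (s - 1) \<noteq> 0"
      show "order v r + order v q < n + s"
      proof (rule ccontr)
        assume "\<not> order v r + order v q < n + s"
        then have full: "order v r = n" "order v q = s"
          using order_degree[OF r0, of v] order_degree[OF nz(2), of v] degr assms by linarith+
        obtain c1 where c1: "c1 \<noteq> 0" "q = smult c1 ([:-v, 1:] ^ s)"
          using order_full_degree[OF nz(2), of v] full assms by metis
        obtain c2 where c2: "c2 \<noteq> 0" "r = smult c2 ([:-v, 1:] ^ n)"
          using order_full_degree[OF r0, of v] full degr by metis
        obtain s' where s': "s = Suc s'" using assms by (cases s) auto
        have "coeff q (s - 1) = c1 * (of_nat s * (-v))"
          unfolding c1(2) using coeff_linear_power_pred[of "-v" s'] by (simp add: s')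
        then have "v = 0" using c c1 assms by simp
        then have q: "q = monom c1 s" and r: "r = monom c2 n"
          using c1 c2 by (simp_all add: monom_altdef)
        have p: "p = monom c2 n + smult w (monom c1 s)" using r q by (simp add: r_def algebra_simps)
        have "coeff p s = w * c1" using assms by (simp add: p)
        then have "w = 0" using assms c1 by simp
        then show False using not_monom by (auto simp: p q split: if_splits)
      qed
    qed
  qed
qed

section \<open>Families of polynomials\<close>

lemma coeff_ring_map: "ring_map \<phi> \<Longrightarrow> coeff (map_poly \<phi> p) i = \<phi> (coeff p i)"
  by (simp add: coeff_map_poly ring_map_zero)

lemma ring_map_map_poly:
  assumes "ring_map \<phi>"
  shows "ring_map (map_poly \<phi>)"
  unfolding ring_map_def
proof (intro conjI allI)
  show "map_poly \<phi> 1 = 1"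
    by (rule poly_eqI) (simp add: coeff_ring_map[OF assms] coeff_1 ring_map_one[OF assms] ring_map_zero[OF assms])
  show "map_poly \<phi> (a + b) = map_poly \<phi> a + map_poly \<phi> b" for a b
    by (rule poly_eqI) (simp add: coeff_ring_map[OF assms] ring_map_add[OF assms])
  show "map_poly \<phi> (a * b) = map_poly \<phi> a * map_poly \<phi> b" for a b
    by (rule poly_eqI) (simp add: coeff_ring_map[OF assms] ring_map_mult[OF assms] coeff_mult ring_map_sum[OF assms])
qed

lemma map_poly_const: "ring_map \<phi> \<Longrightarrow> map_poly \<phi> [:c:] = [:\<phi> c:]"
  by (rule poly_eqI) (simp add: coeff_ring_map coeff_pCons ring_map_zero split: nat.splits)

lemma map_poly_pCons: "ring_map \<phi> \<Longrightarrow> map_poly \<phi> (pCons c p) = pCons (\<phi> c) (map_poly \<phi> p)"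
  by (rule poly_eqI) (simp add: coeff_ring_map coeff_pCons split: nat.splits)

lemma map_poly_hcomp:
  assumes "ring_map \<phi>"
  shows "map_poly \<phi> (hcomp d p X Y) = hcomp d (map_poly \<phi> p) (map_poly \<phi> X) (map_poly \<phi> Y)"
  using form_map[OF ring_map_map_poly[OF assms], of "\<lambda>c. [:c:]" d p X Y]
  by (simp add: form_def map_poly_const[OF assms] coeff_ring_map[OF assms])

lemma map_poly_smult: "ring_map \<phi> \<Longrightarrow> map_poly \<phi> (smult c p) = smult (\<phi> c) (map_poly \<phi> p)"
  by (rule poly_eqI) (simp add: coeff_ring_map ring_map_mult)

lemma map_poly_diff: "ring_map \<phi> \<Longrightarrow> map_poly \<phi> (p - q) = map_poly \<phi> p - map_poly \<phi> q"
  using ring_map_add[OF ring_map_map_poly, of \<phi> "p - q" q] by (simp add: algebra_simps)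

lemma map_poly_pcompose:
  assumes "ring_map \<phi>"
  shows "map_poly \<phi> (pcompose p r) = pcompose (map_poly \<phi> p) (map_poly \<phi> r)"
  by (induction p) (simp_all add: pcompose_pCons map_poly_pCons[OF assms] map_poly_const[OF assms]
      ring_map_add[OF ring_map_map_poly[OF assms]] ring_map_mult[OF ring_map_map_poly[OF assms]])

definition poly_tendsto :: "('b \<Rightarrow> 'a::nonarch_field poly) \<Rightarrow> 'a poly \<Rightarrow> 'b filter \<Rightarrow> bool" where
  "poly_tendsto P p F \<longleftrightarrow>
     (\<forall>i. ((\<lambda>t. coeff (P t) i) \<longlongrightarrow> coeff p i) F) \<and> (\<exists>D. \<forall>\<^sub>F t in F. degree (P t) \<le> D)"

definition poly_expands :: "('a::nonarch_field \<Rightarrow> 'a poly) \<Rightarrow> 'a fps poly \<Rightarrow> bool" where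
  "poly_expands P \<P> \<longleftrightarrow>
     (\<forall>i. expands (\<lambda>t. coeff (P t) i) (coeff \<P> i)) \<and> (\<exists>D. \<forall>\<^sub>F t in at 0. degree (P t) \<le> D)"

text \<open>
  The limit of the members of a family as \<open>t\<close> tends to 0.
\<close>

definition reduction :: "'a::comm_ring_1 fps poly \<Rightarrow> 'a poly" where
  "reduction = map_poly (\<lambda>\<Phi>. fps_nth \<Phi> 0)"

lemma ring_map_fps_nth_0: "ring_map (\<lambda>\<Phi>. fps_nth \<Phi> 0)"
  by (simp add: ring_map_def)

lemma ring_map_fps_const: "ring_map fps_const"
  by (simp add: ring_map_def flip: fps_const_add fps_const_mult)

lemma coeff_reduction: "coeff (reduction \<P>) i = fps_nth (coeff \<P> i) 0"
  by (simp add: reduction_def coeff_ring_map[OF ring_map_fps_nth_0])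

lemma poly_expands_tendsto: "poly_expands P \<P> \<Longrightarrow> poly_tendsto P (reduction \<P>) (at 0)"
  unfolding poly_expands_def poly_tendsto_def by (auto simp: coeff_reduction intro: expands_tendsto)

lemma tendsto_form:
  assumes "\<And>i. ((\<lambda>t. coeff (P t) i) \<longlongrightarrow> coeff p i) F" "(x \<longlongrightarrow> a) F" "(y \<longlongrightarrow> b) F"
  shows "((\<lambda>t. hev d (P t) (x t) (y t)) \<longlongrightarrow> hev d p a (b::'a::nonarch_field)) F"
proof -
  have pow: "((\<lambda>t. f t ^ n) \<longlongrightarrow> l ^ n) F" if "(f \<longlongrightarrow> l) F" for f and l :: 'a and n
    by (induction n) (auto intro: tendsto_mult that)
  show ?thesis unfolding form_def by (intro tendsto_sum tendsto_mult assms pow)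
qed

lemma tendsto_poly:
  assumes "poly_tendsto P p F" "(z \<longlongrightarrow> a) F"
  shows "((\<lambda>t. poly (P t) (z t)) \<longlongrightarrow> poly p (a::'a::nonarch_field)) F"
proof -
  obtain D where D: "\<forall>\<^sub>F t in F. degree (P t) \<le> D" using assms by (auto simp: poly_tendsto_def)
  define D' where "D' = max D (degree p)"
  have "((\<lambda>t. hev D' (P t) (z t) 1) \<longlongrightarrow> hev D' p a 1) F"
    using assms by (intro tendsto_form tendsto_const) (auto simp: poly_tendsto_def)
  moreover have "\<forall>\<^sub>F t in F. hev D' (P t) (z t) 1 = poly (P t) (z t)"
    using D by eventually_elim (auto simp: D'_def intro: hev_1)
  moreover have "hev D' p a 1 = poly p a" by (rule hev_1) (simp add: D'_def)
  ultimately show ?thesis by (simp add: tendsto_cong)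
qed

lemma poly_tendsto_mult:
  assumes "poly_tendsto P p F" "poly_tendsto Q q F"
  shows "poly_tendsto (\<lambda>t. P t * Q t) (p * q) F"
proof -
  obtain D E where "\<forall>\<^sub>F t in F. degree (P t) \<le> D" "\<forall>\<^sub>F t in F. degree (Q t) \<le> E"
    using assms by (auto simp: poly_tendsto_def)
  then have "\<forall>\<^sub>F t in F. degree (P t * Q t) \<le> D + E"
    by eventually_elim (meson add_mono degree_mult_le order.trans)
  then show ?thesis using assms unfolding poly_tendsto_def coeff_mult
    by (auto intro!: tendsto_sum tendsto_mult)
qed

lemma poly_tendsto_diff:
  assumes "poly_tendsto P p F" "poly_tendsto Q q F"
  shows "poly_tendsto (\<lambda>t. P t - Q t) (p - q) F"
proof -
  obtain D E where "\<forall>\<^sub>F t in F. degree (P t) \<le> D" "\<forall>\<^sub>F t in F. degree (Q t) \<le> E"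
    using assms by (auto simp: poly_tendsto_def)
  then have "\<forall>\<^sub>F t in F. degree (P t - Q t) \<le> max D E"
    by eventually_elim (auto intro!: degree_diff_le simp: le_max_iff_disj)
  then show ?thesis using assms unfolding poly_tendsto_def by (auto intro!: tendsto_diff)
qed

lemma poly_tendsto_pderiv:
  fixes P :: "'b \<Rightarrow> 'a::nonarch_field poly"
  assumes "poly_tendsto P p F"
  shows "poly_tendsto (\<lambda>t. pderiv (P t)) (pderiv p) F"
proof -
  obtain D where D: "\<forall>\<^sub>F t in F. degree (P t) \<le> D"
    using assms by (auto simp: poly_tendsto_def)
  have "degree (pderiv q) \<le> D" if "degree q \<le> D" for q :: "'a poly"
    by (rule degree_le) (use that in \<open>auto simp: coeff_pderiv coeff_eq_0\<close>)
  then have "\<forall>\<^sub>F t in F. degree (pderiv (P t)) \<le> D" using D by (auto elim: eventually_mono)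
  then show ?thesis using assms unfolding poly_tendsto_def coeff_pderiv
    by (auto intro!: tendsto_mult)
qed

lemma poly_tendsto_wronskian:
  "poly_tendsto P p F \<Longrightarrow> poly_tendsto Q q F \<Longrightarrow> poly_tendsto (\<lambda>t. wronskian (P t) (Q t)) (wronskian p q) F"
  unfolding wronskian_def by (intro poly_tendsto_diff poly_tendsto_mult poly_tendsto_pderiv)

text \<open>
  Splitting off one root at a time multiplies the constant coefficient by at least \<open>e\<close> in absolute value, while each other
  coefficient becomes a difference of two coefficients of the quotient, one of them multiplied by the root.
\<close>

lemma coeff_le_of_roots_outside:
  fixes p :: "'a::{nonarch_field, alg_closed_field} poly"
  assumes "\<And>z. poly p z = 0 \<Longrightarrow> absval z \<ge> e" "e > 0"
  shows "absval (coeff p j) \<le> absval (coeff p 0) / e ^ j"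
  using assms(1)
proof (induction "degree p" arbitrary: p j)
  case 0
  then obtain c where "p = [:c:]" by (metis degree_eq_zeroE)
  then show ?case by (cases j) (use assms(2) in \<open>auto simp: coeff_pCons absval_nonneg\<close>)
next
  case (Suc k)
  then obtain z where z: "poly p z = 0" using alg_closed_imp_poly_has_root[of p] by auto
  then obtain q where q: "p = [:-z, 1:] * q" unfolding poly_eq_0_iff_dvd by (elim dvdE)
  have q0: "q \<noteq> 0" using Suc(2) q by auto
  have "degree p = Suc (degree q)" unfolding q by (subst degree_mult_eq) (use q0 in auto)
  then have dq: "k = degree q" using Suc(2) by simp
  have rq: "absval y \<ge> e" if "poly q y = 0" for y using Suc.prems[of y] that by (simp add: q)
  note IH = Suc.hyps(1)[OF dq rq]
  have ze: "absval z \<ge> e" by (rule Suc.prems[OF z])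
  have c0: "absval (coeff p 0) = absval z * absval (coeff q 0)" by (simp add: q absval_mult)
  show ?case
  proof (cases j)
    case (Suc i)
    have A: "absval (coeff q i) \<le> absval (coeff p 0) / e ^ j"
    proof -
      have "absval (coeff q i) \<le> absval (coeff q 0) / e ^ i" by (rule IH)
      also have "\<dots> = e * absval (coeff q 0) / e ^ j" using assms by (simp add: Suc)
      also have "\<dots> \<le> absval (coeff p 0) / e ^ j"
        unfolding c0 using ze assms by (intro divide_right_mono mult_right_mono) (auto simp: absval_nonneg)
      finally show ?thesis .
    qed
    have B: "absval (z * coeff q j) \<le> absval (coeff p 0) / e ^ j"
      using mult_left_mono[OF IH[of j] absval_nonneg[of z]] by (simp add: absval_mult c0)
    have "coeff p j = coeff q i - z * coeff q j" by (simp add: q Suc coeff_pCons)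
    then show ?thesis using A B absval_diff_le_max[of "coeff q i" "z * coeff q j"] by simp
  qed simp
qed

text \<open>
  The infimum of the absolute values of the solutions at a given \<open>t\<close> need not be attained, so \<open>c t\<close> is a solution that is minimal up
  to an error $|t|$, which is harmless in the limit.
\<close>

lemma exists_function_tending_to_0:
  assumes "\<And>e. e > 0 \<Longrightarrow> \<forall>\<^sub>F t in at 0. \<exists>z. R t z \<and> absval z < e"
  shows "\<exists>c::'a::nonarch_field \<Rightarrow> 'a. (c \<longlongrightarrow> 0) (at 0) \<and> (\<forall>\<^sub>F t in at 0. R t (c t))"
proof -
  define V where "V t = {absval z |z. R t z}" for t
  define c where "c t = (SOME z. R t z \<and> (\<forall>y. R t y \<longrightarrow> absval z \<le> absval y + absval t))" for t :: 'a
  have ex: "\<exists>z. R t z \<and> (\<forall>y. R t y \<longrightarrow> absval z \<le> absval y + absval t)" if "R t z0" "t \<noteq> 0" for t z0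
  proof -
    have ne: "V t \<noteq> {}" using that by (auto simp: V_def)
    have bd: "bdd_below (V t)" by (rule bdd_belowI[of _ 0]) (auto simp: V_def absval_nonneg)
    have "Inf (V t) < Inf (V t) + absval t" using that by (simp add: absval_pos_iff)
    then obtain x where x: "x \<in> V t" "x < Inf (V t) + absval t"
      using cInf_less_iff[OF ne bd] by blast
    then obtain z where z: "x = absval z" "R t z" by (auto simp: V_def)
    have "Inf (V t) \<le> absval y" if "R t y" for y
      using that by (intro cInf_lower bd) (auto simp: V_def)
    then show ?thesis using x z by force
  qed
  have nz: "\<forall>\<^sub>F t in at (0::'a). t \<noteq> 0" by (simp add: eventually_at_filter)
  have c: "R t (c t) \<and> (\<forall>y. R t y \<longrightarrow> absval (c t) \<le> absval y + absval t)" if "R t z0" "t \<noteq> 0" for t z0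
    unfolding c_def by (rule someI_ex[OF ex[OF that]])
  have "(c \<longlongrightarrow> 0) (at 0)"
    unfolding tendsto_iff dist_absval
  proof (intro allI impI)
    fix e :: real assume e: "e > 0"
    have small: "\<forall>\<^sub>F t in at (0::'a). absval t < e / 2"
      unfolding eventually_at_0_absval using e by (intro exI[of _ "e / 2"]) auto
    have half: "\<forall>\<^sub>F t in at 0. \<exists>z. R t z \<and> absval z < e / 2" using e by (intro assms) simp
    show "\<forall>\<^sub>F t in at 0. absval (c t - 0) < e"
      using nz small half
    proof eventually_elim
      case (elim t)
      then obtain z where z: "R t z" "absval z < e / 2" by blast
      have "absval (c t) \<le> absval z + absval t" using c[OF z(1) elim(1)] z by blast
      then show ?case using z elim by simp
    qed
  qed
  moreover have "\<forall>\<^sub>F t in at 0. R t (c t)"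
    using assms[OF zero_less_one] nz by eventually_elim (use c in blast)
  ultimately show ?thesis by blast
qed

lemma root_near_root_of_limit:
  fixes P :: "'a::{nonarch_field, alg_closed_field} \<Rightarrow> 'a poly"
  assumes "poly_tendsto P p (at 0)" "p \<noteq> 0" "poly p 0 = 0"
  shows "\<exists>c. (c \<longlongrightarrow> 0) (at 0) \<and> (\<forall>\<^sub>F t in at 0. poly (P t) (c t) = 0)"
proof (rule exists_function_tending_to_0)
  fix e :: real assume e: "e > 0"
  obtain j where j: "coeff p j \<noteq> 0" using assms(2) by (meson leading_coeff_neq_0)
  have lim: "((\<lambda>t. coeff (P t) i) \<longlongrightarrow> coeff p i) (at 0)" for i using assms(1) by (simp add: poly_tendsto_def)
  define h where "h = absval (coeff p j) / 2"
  have h: "h > 0" using j by (simp add: h_def absval_pos_iff)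
  have 1: "\<forall>\<^sub>F t in at 0. absval (coeff (P t) j) > h"
    by (rule order_tendstoD(1)[OF tendsto_absval[OF lim]]) (use h in \<open>simp add: h_def\<close>)
  have "\<forall>\<^sub>F t in at 0. absval (coeff (P t) 0) < h * e ^ j"
    by (rule order_tendstoD(2)[OF tendsto_absval[OF lim]]) (use h e assms(3) in \<open>simp add: poly_0_coeff_0\<close>)
  with 1 show "\<forall>\<^sub>F t in at 0. \<exists>z. poly (P t) z = 0 \<and> absval z < e"
  proof eventually_elim
    case (elim t)
    show ?case
    proof (rule ccontr)
      assume "\<not> (\<exists>z. poly (P t) z = 0 \<and> absval z < e)"
      then have "absval (coeff (P t) j) \<le> absval (coeff (P t) 0) / e ^ j"
        by (intro coeff_le_of_roots_outside e) (auto simp: not_less)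
      also have "\<dots> < h" using elim e by (simp add: field_simps)
      finally show False using elim by simp
    qed
  qed
qed

lemma poly_expands_cong:
  assumes "poly_expands P \<P>" "\<forall>\<^sub>F t in at 0. P t = Q t"
  shows "poly_expands Q \<P>"
proof -
  obtain D where "\<forall>\<^sub>F t in at 0. degree (P t) \<le> D" using assms by (auto simp: poly_expands_def)
  then have "\<forall>\<^sub>F t in at 0. degree (Q t) \<le> D" using assms(2) by eventually_elim simp
  moreover have "expands (\<lambda>t. coeff (Q t) i) (coeff \<P> i)" for i
    by (rule expands_cong[of "\<lambda>t. coeff (P t) i"])
      (use assms in \<open>auto simp: poly_expands_def elim: eventually_mono\<close>)
  ultimately show ?thesis by (auto simp: poly_expands_def)
qed

lemma poly_expands_const: "expands \<phi> \<Phi> \<Longrightarrow> poly_expands (\<lambda>t. [:\<phi> t:]) [:\<Phi>:]"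
  unfolding poly_expands_def
  by (auto simp: coeff_pCons expands_zero split: nat.splits intro!: exI[of _ 0])

lemma poly_expands_constant: "poly_expands (\<lambda>_. p) (map_poly fps_const p)"
  unfolding poly_expands_def
  by (auto simp: coeff_ring_map[OF ring_map_fps_const] expands_const intro!: exI[of _ "degree p"])

lemma poly_expands_add:
  assumes "poly_expands P \<P>" "poly_expands Q \<Q>"
  shows "poly_expands (\<lambda>t. P t + Q t) (\<P> + \<Q>)"
proof -
  obtain D E where "\<forall>\<^sub>F t in at 0. degree (P t) \<le> D" "\<forall>\<^sub>F t in at 0. degree (Q t) \<le> E"
    using assms by (auto simp: poly_expands_def)
  then have "\<forall>\<^sub>F t in at 0. degree (P t + Q t) \<le> max D E"
    by eventually_elim (auto intro!: degree_add_le simp: le_max_iff_disj)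
  then show ?thesis using assms by (auto simp: poly_expands_def intro!: expands_add)
qed

lemma poly_expands_mult:
  assumes "poly_expands P \<P>" "poly_expands Q \<Q>"
  shows "poly_expands (\<lambda>t. P t * Q t) (\<P> * \<Q>)"
proof -
  obtain D E where "\<forall>\<^sub>F t in at 0. degree (P t) \<le> D" "\<forall>\<^sub>F t in at 0. degree (Q t) \<le> E"
    using assms by (auto simp: poly_expands_def)
  then have "\<forall>\<^sub>F t in at 0. degree (P t * Q t) \<le> D + E"
    by eventually_elim (meson add_mono degree_mult_le order.trans)
  then show ?thesis using assms unfolding poly_expands_def coeff_mult
    by (auto intro!: expands_sum expands_mult)
qed

lemma poly_expands_smult:
  "expands \<phi> \<Phi> \<Longrightarrow> poly_expands P \<P> \<Longrightarrow> poly_expands (\<lambda>t. smult (\<phi> t) (P t)) (smult \<Phi> \<P>)"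
  using poly_expands_mult[OF poly_expands_const] by fastforce

lemma poly_expands_diff:
  assumes "poly_expands P \<P>" "poly_expands Q \<Q>"
  shows "poly_expands (\<lambda>t. P t - Q t) (\<P> - \<Q>)"
  using poly_expands_add[OF assms(1) poly_expands_smult[OF expands_const[of "-1"] assms(2)]]
  by (simp flip: fps_const_neg)

lemma poly_expands_sum:
  assumes "\<And>i. i \<in> A \<Longrightarrow> poly_expands (P i) (\<P> i)"
  shows "poly_expands (\<lambda>t. \<Sum>i\<in>A. P i t) (\<Sum>i\<in>A. \<P> i)"
  using assms
  by (induction A rule: infinite_finite_induct)
    (auto intro: poly_expands_add poly_expands_const[OF expands_zero, simplified])

lemma poly_expands_power:
  assumes "poly_expands P \<P>"
  shows "poly_expands (\<lambda>t. P t ^ n) (\<P> ^ n)"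
  by (induction n) (use poly_expands_const[OF expands_const[of 1]] in
      \<open>auto intro: poly_expands_mult assms simp: one_pCons\<close>)

lemma poly_expands_coeff: "poly_expands P \<P> \<Longrightarrow> expands (\<lambda>t. coeff (P t) i) (coeff \<P> i)"
  by (simp add: poly_expands_def)

lemma poly_expands_hcomp:
  assumes "poly_expands P \<P>" "poly_expands X \<X>" "poly_expands Y \<Y>"
  shows "poly_expands (\<lambda>t. hcomp d (P t) (X t) (Y t)) (hcomp d \<P> \<X> \<Y>)"
  unfolding form_def
  by (intro poly_expands_sum poly_expands_mult poly_expands_power poly_expands_const poly_expands_coeff assms)

lemma pcompose_eq_hcomp:
  assumes "degree p \<le> D"
  shows "pcompose p r = hcomp D p r 1"
  using assms
proof (induction D arbitrary: p)
  case 0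
  then obtain c where "p = [:c:]" by (auto elim: degree_eq_zeroE)
  then show ?case by (simp add: form_def)
next
  case (Suc D)
  obtain c q where p: "p = pCons c q" by (cases p)
  have "degree q \<le> D" using Suc.prems by (auto simp: p split: if_splits)
  then have "pcompose q r = hcomp D q r 1" by (rule Suc.IH)
  then show ?case by (simp only: p pcompose_pCons form_pCons power_one mult_1_right)
qed

lemma poly_expands_pcompose:
  assumes "poly_expands P \<P>"
  shows "poly_expands (\<lambda>t. pcompose (P t) r) (pcompose \<P> (map_poly fps_const r))"
proof -
  obtain D where D: "\<forall>\<^sub>F t in at 0. degree (P t) \<le> D" using assms by (auto simp: poly_expands_def)
  define E where "E = max D (degree \<P>)"
  have 1: "poly_expands (\<lambda>t. hcomp E (P t) r 1) (hcomp E \<P> (map_poly fps_const r) 1)"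
    using poly_expands_hcomp[OF assms poly_expands_constant poly_expands_constant, of E r 1]
    by (simp add: ring_map_one[OF ring_map_map_poly[OF ring_map_fps_const]])
  have 2: "hcomp E \<P> (map_poly fps_const r) 1 = pcompose \<P> (map_poly fps_const r)"
    by (rule pcompose_eq_hcomp[symmetric]) (simp add: E_def)
  have 3: "\<forall>\<^sub>F t in at 0. hcomp E (P t) r 1 = pcompose (P t) r"
    using D by eventually_elim (auto simp: E_def intro!: pcompose_eq_hcomp[symmetric])
  show ?thesis using poly_expands_cong[OF 1 3] unfolding 2 .
qed

section \<open>Critical points in bad or critical directions\<close>

lemma coeff_below_order_0: 
  fixes p :: "'r::idom poly"
  assumes "p \<noteq> 0"
  shows "i < order 0 p \<Longrightarrow> coeff p i = 0" "coeff p (order 0 p) \<noteq> 0"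
proof -
  obtain a where a: "p = [:-0, 1:] ^ order 0 p * a" "poly a 0 \<noteq> 0" using order_decompE[OF assms] by blast
  have m: "[:-0, 1:] ^ n = monom (1::'r) n" for n by (simp add: monom_altdef)
  have p: "p = monom 1 (order 0 p) * a" using a(1) unfolding m .
  show "i < order 0 p \<Longrightarrow> coeff p i = 0" by (subst p) (simp add: coeff_monom_mult)
  show "coeff p (order 0 p) \<noteq> 0" by (subst (1) p) (use a in \<open>simp add: coeff_monom_mult poly_0_coeff_0\<close>)
qed

definition substX :: "nat \<Rightarrow> 'a::comm_ring_1 fps \<Rightarrow> 'a fps" where
  "substX b \<Phi> = fps_compose \<Phi> (fps_X ^ b)"

lemma substX_nth: "b > 0 \<Longrightarrow> fps_nth (substX b \<Phi>) n = (if b dvd n then fps_nth \<Phi> (n div b) else 0)"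
  by (simp add: substX_def fps_X_power_compose_nth)

lemma ring_map_substX:
  assumes "b > 0"
  shows "ring_map (substX b :: 'a::idom fps \<Rightarrow> _)"
  unfolding ring_map_def substX_def
  using assms by (auto simp: fps_compose_add_distrib intro!: fps_compose_mult_distrib)

lemma substX_eq_0_iff:
  assumes "b > 0"
  shows "substX b \<Phi> = 0 \<longleftrightarrow> \<Phi> = 0"
proof
  assume "substX b \<Phi> = 0"
  then have "fps_nth (substX b \<Phi>) (b * n) = 0" for n by simp
  then show "\<Phi> = 0" using assms by (auto simp: substX_nth fps_eq_iff)
qed (use assms in \<open>auto simp: fps_eq_iff substX_nth\<close>)

lemma fps_X_power_dvdI:
  assumes "\<And>i. i < n \<Longrightarrow> fps_nth \<Phi> i = 0"
  shows "fps_X ^ n dvd (\<Phi> :: 'a::comm_ring_1 fps)"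
proof -
  have "\<Phi> = fps_X ^ n * fps_shift n \<Phi>"
    by (rule fps_ext) (use assms in \<open>auto simp: fps_X_power_mult_nth\<close>)
  then show ?thesis by (rule dvdI)
qed

text \<open>
  The substitution $z = t^a y$ after the base change $t \mapsto t^b$. The last hypothesis says that, to the left of \<open>n\<close>, the Newton
  polygon lies on or above the line of slope $-a/b$ through $(n, 0)$; the terms on this line are those that survive in the limit.
\<close>

lemma rescale_family:
  fixes P :: "'a::{nonarch_field, field_char_0} \<Rightarrow> 'a poly"
  assumes P: "poly_expands P \<P>" and b: "b > 0" and a: "a > 0"
    and low: "\<And>i k. i < n \<Longrightarrow> b * k < a * (n - i) \<Longrightarrow> fps_nth (coeff \<P> i) k = 0"
  obtains \<S> where
    "poly_expands (\<lambda>t. smult (inverse (t ^ (a * n))) (pcompose (P (t ^ b)) [:0, t ^ a:])) \<S>"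
    "pcompose (map_poly (substX b) \<P>) [:0, fps_X ^ a:] = smult (fps_X ^ (a * n)) \<S>"
    "\<And>i. fps_nth (coeff \<S> i) 0 = (if i \<le> n then fps_nth (substX b (coeff \<P> i)) (a * (n - i)) else 0)"
proof -
  note rm = ring_map_substX[OF b, where 'a='a]
  let ?T = "pcompose (map_poly (substX b) \<P>) [:0, fps_X ^ a:]"
  have cT: "coeff ?T i = fps_X ^ (a * i) * substX b (coeff \<P> i)" for i
    by (simp add: coeff_pcompose_linear coeff_ring_map[OF rm] power_mult)
  have "fps_X ^ (a * n) dvd coeff ?T i" for i
  proof (rule fps_X_power_dvdI)
    fix k assume k: "k < a * n"
    show "fps_nth (coeff ?T i) k = 0"
    proof (cases "k < a * i")
      case True
      then show ?thesis by (simp only: cT fps_X_power_mult_nth if_True)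
    next
      case False
      then have "a * i < a * n" using k by linarith
      then have i: "i < n" by simp
      have "k - a * i < a * (n - i)" using False k by (simp add: diff_mult_distrib2)
      moreover have "b * ((k - a * i) div b) \<le> k - a * i" by simp
      ultimately have "fps_nth (coeff \<P> i) ((k - a * i) div b) = 0" by (intro low[OF i]) linarith
      then show ?thesis using False by (simp add: cT fps_X_power_mult_nth substX_nth[OF b])
    qed
  qed
  then have "[:fps_X ^ (a * n):] dvd ?T" by (simp add: const_poly_dvd_iff)
  then obtain \<S> where S: "?T = smult (fps_X ^ (a * n)) \<S>" by (auto elim: dvdE)
  have cS: "fps_X ^ (a * n) * coeff \<S> i = fps_X ^ (a * i) * substX b (coeff \<P> i)" for i
    using cT[of i] by (simp add: S)
  show thesis
  proof (rule that[OF _ S])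
    show "fps_nth (coeff \<S> i) 0 = (if i \<le> n then fps_nth (substX b (coeff \<P> i)) (a * (n - i)) else 0)" for i
    proof -
      have "fps_nth (coeff \<S> i) 0 = fps_nth (fps_X ^ (a * n) * coeff \<S> i) (a * n)"
        by (simp add: fps_X_power_mult_nth)
      also have "\<dots> = (if i \<le> n then fps_nth (substX b (coeff \<P> i)) (a * (n - i)) else 0)"
        unfolding cS using a by (auto simp: fps_X_power_mult_nth diff_mult_distrib2)
      finally show ?thesis .
    qed
    obtain D where D: "\<forall>\<^sub>F t in at 0. degree (P t) \<le> D" using P by (auto simp: poly_expands_def)
    have "\<forall>\<^sub>F t in at 0. degree (P (t ^ b)) \<le> D"
      by (rule eventually_compose_filterlim[OF D filterlim_power_at_0[OF b]])
    then have deg: "\<forall>\<^sub>F t in at 0. degree (smult (inverse (t ^ (a * n))) (pcompose (P (t ^ b)) [:0, t ^ a:])) \<le> D"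
    proof eventually_elim
      case (elim t)
      have "degree (pcompose (P (t ^ b)) [:0, t ^ a:]) \<le> degree (P (t ^ b)) * degree [:0, t ^ a:]"
        by (rule degree_pcompose_le)
      also have "\<dots> \<le> degree (P (t ^ b)) * 1" by (rule mult_left_mono) auto
      finally show ?case using elim by (auto intro: order.trans[OF degree_smult_le])
    qed
    have "expands (\<lambda>t. coeff (smult (inverse (t ^ (a * n))) (pcompose (P (t ^ b)) [:0, t ^ a:])) i) (coeff \<S> i)" for i
    proof -
      have "poly (monom 1 (a * i)) = (\<lambda>t::'a. t ^ (a * i))" by (simp add: fun_eq_iff poly_monom)
      then have "expands (\<lambda>t::'a. t ^ (a * i)) (fps_X ^ (a * i))"
        using expands_poly[of "monom 1 (a * i) :: 'a poly"] by (simp add: fps_of_poly_monom poly_monom)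
      moreover have "expands (\<lambda>t. coeff (P (t ^ b)) i) (substX b (coeff \<P> i))"
        unfolding substX_def by (rule expands_subst_power[OF poly_expands_coeff[OF P] b])
      ultimately have "expands (\<lambda>t. t ^ (a * i) * coeff (P (t ^ b)) i) (fps_X ^ (a * n) * coeff \<S> i)"
        unfolding cS by (rule expands_mult)
      from expands_divide_power[OF this] show ?thesis
        by (simp add: coeff_pcompose_linear divide_inverse mult_ac flip: power_mult)
    qed
    with deg show "poly_expands (\<lambda>t. smult (inverse (t ^ (a * n))) (pcompose (P (t ^ b)) [:0, t ^ a:])) \<S>"
      unfolding poly_expands_def by blast
  qed
qed

lemma exists_root_function:
  assumes "b > 0"
  obtains r :: "'a::{nonarch_field, alg_closed_field} \<Rightarrow> 'a" where "\<And>t. r t ^ b = t" "filterlim r (at 0) (at 0)"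
proof -
  define r where "r t = (SOME y. y ^ b = t)" for t :: 'a
  have r: "r t ^ b = t" for t unfolding r_def by (rule someI_ex[OF nth_root_exists[OF assms]])
  have "filterlim r (at 0) (at 0)"
    unfolding filterlim_at
  proof
    have "\<forall>\<^sub>F t in at (0::'a). t \<noteq> 0" by (simp add: eventually_at_filter)
    then show "\<forall>\<^sub>F t in at 0. r t \<in> UNIV \<and> r t \<noteq> 0"
    proof eventually_elim
      case (elim t)
      then show ?case using r[of t] assms by (auto simp: zero_power)
    qed
    show "(r \<longlongrightarrow> 0) (at 0)" unfolding tendsto_iff dist_absval
    proof (intro allI impI)
      fix e :: real assume e: "e > 0"
      have "absval (r t) < e" if "absval t < e ^ b" for t
      proof (rule ccontr)
        assume "\<not> absval (r t) < e"
        then have "e ^ b \<le> absval (r t) ^ b" using e by (intro power_mono) auto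
        also have "\<dots> = absval t" by (simp add: r flip: absval_power)
        finally show False using that by simp
      qed
      then show "\<forall>\<^sub>F t in at 0. absval (r t - 0) < e"
        unfolding eventually_at_0_absval using e by (intro exI[of _ "e ^ b"]) auto
    qed
  qed
  then show thesis using that r by blast
qed

definition has_critical_family :: "('a::nonarch_field \<Rightarrow> 'a poly) \<Rightarrow> ('a \<Rightarrow> 'a poly) \<Rightarrow> bool" where
  "has_critical_family P Q \<longleftrightarrow> (\<exists>c. (c \<longlongrightarrow> 0) (at 0) \<and>
     (\<forall>\<^sub>F t in at 0. poly (wronskian (P t) (Q t)) (c t) = 0 \<and> poly (Q t) (c t) \<noteq> 0) \<and>
     ((\<lambda>t. poly (P t) (c t) / poly (Q t) (c t)) \<longlongrightarrow> 0) (at 0))"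

lemma wronskian_affine:
  "wronskian (smult a p + smult b q) q = smult a (wronskian p q)"
  using wronskian_linear_combination[of a p b q 0 1] by simp

text \<open>
  The quotient $a / b$ is the smallest slope that occurs in either of the two Newton polygons; since it is attained, the two limits at the
  new scale are not both monomials. The fraction is reduced in order that an integral slope does not
  require a base change.
\<close>

lemma newton_slope:
  fixes \<P> \<Q> :: "'a::field fps poly"
  assumes P0: "\<And>i. i < n \<Longrightarrow> fps_nth (coeff \<P> i) 0 = 0" and Q0: "\<And>i. i < s \<Longrightarrow> fps_nth (coeff \<Q> i) 0 = 0"
    and ex: "(\<exists>i<n. coeff \<P> i \<noteq> 0) \<or> (\<exists>i<s. coeff \<Q> i \<noteq> 0)"
  obtains a b where "a > 0" "b > 0" "coprime a b"
    "\<And>i k. i < n \<Longrightarrow> b * k < a * (n - i) \<Longrightarrow> fps_nth (coeff \<P> i) k = 0"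
    "\<And>i k. i < s \<Longrightarrow> b * k < a * (s - i) \<Longrightarrow> fps_nth (coeff \<Q> i) k = 0"
    "(\<exists>i<n. fps_nth (substX b (coeff \<P> i)) (a * (n - i)) \<noteq> 0) \<or>
     (\<exists>i<s. fps_nth (substX b (coeff \<Q> i)) (a * (s - i)) \<noteq> 0)"
proof -
  define G where "G = (\<lambda>i. (subdegree (coeff \<P> i), n - i)) ` {i. i < n \<and> coeff \<P> i \<noteq> 0}
    \<union> (\<lambda>i. (subdegree (coeff \<Q> i), s - i)) ` {i. i < s \<and> coeff \<Q> i \<noteq> 0}"
  have fin: "finite G" and ne: "G \<noteq> {}" using ex by (auto simp: G_def)
  have pos: "u > 0 \<and> g > 0" if "(u, g) \<in> G" for u g
    using that P0 Q0 by (auto simp: G_def subdegree_eq_0_iff intro!: Nat.gr0I)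
  define ratio where "ratio x = real (fst x) / real (snd x)" for x :: "nat \<times> nat"
  obtain x where x: "x \<in> G" "\<And>y. y \<in> G \<Longrightarrow> ratio x \<le> ratio y"
    using ex_is_arg_min_if_finite[OF fin ne, of ratio] by (auto simp: is_arg_min_linorder)
  obtain u g where ug: "x = (u, g)" by (cases x)
  have pug: "u > 0" "g > 0" using pos x ug by auto
  define d where "d = gcd u g"
  define a where "a = u div d"
  define b where "b = g div d"
  have ud: "u = a * d" and gd: "g = b * d" by (simp_all add: a_def b_def d_def)
  have a: "a > 0" and b: "b > 0" and d: "d > 0" using pug ud gd by (auto intro!: Nat.gr0I)
  have cop: "coprime a b" using pug by (simp add: a_def b_def d_def div_gcd_coprime)
  have le: "a * g' \<le> b * u'" if "(u', g') \<in> G" for u' g'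
  proof -
    have "real u / real g \<le> real u' / real g'" using x(2)[OF that] by (simp add: ratio_def ug)
    then have "real u * real g' \<le> real u' * real g" using pos[OF that] pug by (simp add: field_simps)
    then have "u * g' \<le> u' * g" by (metis of_nat_mult of_nat_le_iff)
    then have "d * (a * g') \<le> d * (b * u')" by (simp add: ud gd mult_ac)
    then show ?thesis using d by simp
  qed
  show thesis
  proof (rule that[OF a b cop])
    fix i k assume i: "i < n" and k: "b * k < a * (n - i)"
    show "fps_nth (coeff \<P> i) k = 0"
    proof (cases "coeff \<P> i = 0")
      case False
      then have "(subdegree (coeff \<P> i), n - i) \<in> G" using i by (auto simp: G_def)
      from le[OF this] k have "b * k < b * subdegree (coeff \<P> i)" by linarith
      then show ?thesis by (intro nth_less_subdegree_zero) simp
    qed simp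
  next
    fix i k assume i: "i < s" and k: "b * k < a * (s - i)"
    show "fps_nth (coeff \<Q> i) k = 0"
    proof (cases "coeff \<Q> i = 0")
      case False
      then have "(subdegree (coeff \<Q> i), s - i) \<in> G" using i by (auto simp: G_def)
      from le[OF this] k have "b * k < b * subdegree (coeff \<Q> i)" by linarith
      then show ?thesis by (intro nth_less_subdegree_zero) simp
    qed simp
  next
    have *: "fps_nth (substX b \<Phi>) (a * g) \<noteq> 0" if "\<Phi> \<noteq> 0" "subdegree \<Phi> = u" for \<Phi> :: "'a fps"
    proof -
      have "a * g = b * u" by (simp add: ud gd)
      then show ?thesis using that b nth_subdegree_nonzero[of \<Phi>] by (simp add: substX_nth)
    qed
    from x(1) show "(\<exists>i<n. fps_nth (substX b (coeff \<P> i)) (a * (n - i)) \<noteq> 0) \<or>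
     (\<exists>i<s. fps_nth (substX b (coeff \<Q> i)) (a * (s - i)) \<noteq> 0)"
      unfolding ug G_def using * by (elim UnE imageE) auto
  qed
qed

text \<open>
  The direction 0 is mapped to the direction 0, because \<open>P\<close> has more zeros there than \<open>Q\<close>, and it is bad or critical, because
  the Wronskian vanishes there. The claim is that it contains a critical point of $P / Q$ whose value lies in the direction 0 as well. Let
  \<open>n\<close> and \<open>s\<close> be the orders of the two limits at 0. If $s = 0$, then $P / Q$ has no pole nearby, and every root of the Wronskian near 0 will
  do. If $s > 0$, one zooms in at the scale given by \<open>newton_slope\<close>, recentred by \<open>residue_step\<close>, and argues by
  induction on the pair of $n + s$ and the order of the constant \<open>\<rho>\<close>. When $n + s$ does not decrease, the
  slope is an integer \<open>a\<close>, and $P$ and $Q$ are divisible by $t^{a s}$ after the substitution, so that \<open>\<rho>\<close> loses this factor.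
\<close>

theorem critical_family:
  fixes P Q :: "'a::{nonarch_field, alg_closed_field, field_char_0} \<Rightarrow> 'a poly"
  assumes "poly_expands P \<P>" "poly_expands Q \<Q>" "A * \<P> + B * \<Q> = [:\<rho>:]" "\<rho> \<noteq> 0"
    "wronskian (reduction \<P>) (reduction \<Q>) \<noteq> 0" "poly (wronskian (reduction \<P>) (reduction \<Q>)) 0 = 0"
    "order 0 (reduction \<Q>) < order 0 (reduction \<P>)"
  shows "has_critical_family P Q"
proof -
  have "\<forall>P Q \<P> \<Q> A B \<rho>. (order 0 (reduction \<P>) + order 0 (reduction \<Q>), subdegree \<rho>) = x \<longrightarrow>
      poly_expands P \<P> \<longrightarrow> poly_expands Q \<Q> \<longrightarrow> A * \<P> + B * \<Q> = [:\<rho>:] \<longrightarrow> \<rho> \<noteq> 0 \<longrightarrow>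
      wronskian (reduction \<P>) (reduction \<Q>) \<noteq> 0 \<longrightarrow> poly (wronskian (reduction \<P>) (reduction \<Q>)) 0 = 0 \<longrightarrow>
      order 0 (reduction \<Q>) < order 0 (reduction \<P>) \<longrightarrow>
      has_critical_family (P :: 'a \<Rightarrow> 'a poly) Q" for x
  proof (induction x rule: wf_induct_rule[OF wf_lex_prod[OF wf_less_than wf_less_than]])
    case (1 x)
    show ?case
    proof (intro allI impI)
      fix P Q :: "'a \<Rightarrow> 'a poly" and \<P> \<Q> A B \<rho>
      assume x: "(order 0 (reduction \<P>) + order 0 (reduction \<Q>), subdegree \<rho>) = x"
        and PE: "poly_expands P \<P>" and QE: "poly_expands Q \<Q>"
        and bez: "A * \<P> + B * \<Q> = [:\<rho>:]" and rho: "\<rho> \<noteq> 0"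
        and W0: "wronskian (reduction \<P>) (reduction \<Q>) \<noteq> 0"
        and Wr: "poly (wronskian (reduction \<P>) (reduction \<Q>)) 0 = 0"
        and lt: "order 0 (reduction \<Q>) < order 0 (reduction \<P>)"
      define p q where "p = reduction \<P>" and "q = reduction \<Q>"
      define n s where "n = order 0 p" and "s = order 0 q"
      have nz: "p \<noteq> 0" "q \<noteq> 0" using W0 by (auto simp: p_def q_def wronskian_def)
      have sn: "s < n" using lt by (simp add: s_def n_def p_def q_def)
      have Pt: "poly_tendsto P p (at 0)" and Qt: "poly_tendsto Q q (at 0)"
        unfolding p_def q_def by (rule poly_expands_tendsto[OF PE] poly_expands_tendsto[OF QE])+
      show "has_critical_family P Q"
      proof (cases "s = 0")
        case True
        then have q0: "poly q 0 \<noteq> 0" using nz by (auto simp: s_def order_eq_0_iff)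
        have p0: "poly p 0 = 0" using sn nz by (metis n_def not_less0 order_0I)
        obtain c where c: "(c \<longlongrightarrow> 0) (at 0)" "\<forall>\<^sub>F t in at 0. poly (wronskian (P t) (Q t)) (c t) = 0"
          using root_near_root_of_limit[OF poly_tendsto_wronskian[OF Pt Qt]] W0 Wr by (auto simp: p_def q_def)
        have 1: "((\<lambda>t. poly (P t) (c t)) \<longlongrightarrow> poly p 0) (at 0)" by (rule tendsto_poly[OF Pt c(1)])
        have 2: "((\<lambda>t. poly (Q t) (c t)) \<longlongrightarrow> poly q 0) (at 0)" by (rule tendsto_poly[OF Qt c(1)])
        have 3: "((\<lambda>t. poly (P t) (c t) / poly (Q t) (c t)) \<longlongrightarrow> 0) (at 0)"
          using tendsto_divide_nonarch[OF 1 2 q0] p0 by simp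
        have 4: "\<forall>\<^sub>F t in at 0. poly (Q t) (c t) \<noteq> 0" by (rule tendsto_imp_eventually_ne[OF 2 q0])
        show ?thesis unfolding has_critical_family_def
          using c 3 eventually_conj[OF c(2) 4] by blast
      next
        case False
        then have s: "s > 0" by simp
        define ps qs where "ps t = coeff (P t) s" and "qs t = coeff (Q t) s" for t
        define ps' qs' where "ps' = coeff \<P> s" and "qs' = coeff \<Q> s"
        have pse: "expands ps ps'" and qse: "expands qs qs'"
          unfolding ps_def qs_def ps'_def qs'_def by (rule poly_expands_coeff[OF PE] poly_expands_coeff[OF QE])+
        have ps0: "fps_nth ps' 0 = 0" using coeff_below_order_0(1)[OF nz(1), of s] sn
          by (simp add: ps'_def p_def coeff_reduction n_def)
        have qs0: "fps_nth qs' 0 \<noteq> 0" using coeff_below_order_0(2)[OF nz(2)]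
          by (simp add: qs'_def q_def coeff_reduction s_def)
        \<comment> \<open>Remove the term of degree s from P. This moves the target by ps / qs, which tends to 0.\<close>
        define P' where "P' t = smult (qs t) (P t) - smult (ps t) (Q t)" for t
        define \<P>' where "\<P>' = smult qs' \<P> - smult ps' \<Q>"
        have PE': "poly_expands P' \<P>'" unfolding P'_def \<P>'_def
          by (intro poly_expands_diff poly_expands_smult PE QE pse qse)
        have redP': "reduction \<P>' = smult (fps_nth qs' 0) p"
          by (rule poly_eqI) (simp add: coeff_reduction \<P>'_def p_def ps0)
        have P's: "coeff \<P>' s = 0" by (simp add: \<P>'_def ps'_def qs'_def mult.commute)
        have bez': "A * \<P>' + (smult qs' B + smult ps' A) * \<Q> = [:qs' * \<rho>:]"
          using arg_cong[OF bez, of "smult qs'"] by (simp add: \<P>'_def algebra_simps smult_add_right)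
        have cP': "fps_nth (coeff \<P>' i) 0 = fps_nth qs' 0 * coeff p i" for i
          using arg_cong[OF redP', of "\<lambda>p. coeff p i"] by (simp add: coeff_reduction)
        have lowP: "fps_nth (coeff \<P>' i) 0 = 0" if "i < n" for i
          using coeff_below_order_0(1)[OF nz(1), of i] that by (simp add: cP' n_def)
        have lowQ: "fps_nth (coeff \<Q> i) 0 = 0" if "i < s" for i
          using coeff_below_order_0(1)[OF nz(2), of i] that by (simp add: q_def coeff_reduction s_def)
        \<comment> \<open>Otherwise both constant terms would vanish, contrary to the Bezout identity.\<close>
        have ex: "(\<exists>i<n. coeff \<P>' i \<noteq> 0) \<or> (\<exists>i<s. coeff \<Q> i \<noteq> 0)"
        proof (rule ccontr)
          assume "\<not> ((\<exists>i<n. coeff \<P>' i \<noteq> 0) \<or> (\<exists>i<s. coeff \<Q> i \<noteq> 0))"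
          then have "coeff \<P>' 0 = 0" "coeff \<Q> 0 = 0" using s sn by auto
          then have "coeff (A * \<P>' + (smult qs' B + smult ps' A) * \<Q>) 0 = 0" by (simp add: coeff_mult)
          then have "qs' * \<rho> = 0" unfolding bez' by simp
          then show False using rho qs0 by auto
        qed
        obtain a b where ab: "a > 0" "b > 0" "coprime a b"
          and lowP': "\<And>i k. i < n \<Longrightarrow> b * k < a * (n - i) \<Longrightarrow> fps_nth (coeff \<P>' i) k = 0"
          and lowQ': "\<And>i k. i < s \<Longrightarrow> b * k < a * (s - i) \<Longrightarrow> fps_nth (coeff \<Q> i) k = 0"
          and exx: "(\<exists>i<n. fps_nth (substX b (coeff \<P>' i)) (a * (n - i)) \<noteq> 0) \<or>
             (\<exists>i<s. fps_nth (substX b (coeff \<Q> i)) (a * (s - i)) \<noteq> 0)"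
          using newton_slope[OF lowP lowQ ex] by metis
        note rm = ring_map_substX[OF ab(2), where 'a='a]
        define P1 where "P1 t = smult (inverse (t ^ (a * n))) (pcompose (P' (t ^ b)) [:0, t ^ a:])" for t
        define Q1 where "Q1 t = smult (inverse (t ^ (a * s))) (pcompose (Q (t ^ b)) [:0, t ^ a:])" for t
        obtain \<S> where S: "poly_expands P1 \<S>"
          "pcompose (map_poly (substX b) \<P>') [:0, fps_X ^ a:] = smult (fps_X ^ (a * n)) \<S>"
          "\<And>i. fps_nth (coeff \<S> i) 0 = (if i \<le> n then fps_nth (substX b (coeff \<P>' i)) (a * (n - i)) else 0)"
          using rescale_family[OF PE' ab(2,1) lowP'] unfolding P1_def by blast
        obtain \<T> where T: "poly_expands Q1 \<T>"
          "pcompose (map_poly (substX b) \<Q>) [:0, fps_X ^ a:] = smult (fps_X ^ (a * s)) \<T>"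
          "\<And>i. fps_nth (coeff \<T> i) 0 = (if i \<le> s then fps_nth (substX b (coeff \<Q> i)) (a * (s - i)) else 0)"
          using rescale_family[OF QE ab(2,1) lowQ'] unfolding Q1_def by blast
        define p1 q1 where "p1 = reduction \<S>" and "q1 = reduction \<T>"
        have cp1: "coeff p1 i = (if i \<le> n then fps_nth (substX b (coeff \<P>' i)) (a * (n - i)) else 0)" for i
          by (simp add: p1_def coeff_reduction S(3))
        have cq1: "coeff q1 i = (if i \<le> s then fps_nth (substX b (coeff \<Q> i)) (a * (s - i)) else 0)" for i
          by (simp add: q1_def coeff_reduction T(3))
        have "coeff p1 n \<noteq> 0" using coeff_below_order_0(2)[OF nz(1)] qs0 ab
          by (simp add: cp1 substX_nth cP' n_def)
        then have dp1: "degree p1 = n" by (intro antisym degree_le le_degree) (auto simp: cp1)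
        have "coeff q1 s \<noteq> 0" using coeff_below_order_0(2)[OF nz(2)] ab
          by (simp add: cq1 substX_nth s_def q_def coeff_reduction)
        then have dq1: "degree q1 = s" by (intro antisym degree_le le_degree) (auto simp: cq1)
        have p1s: "coeff p1 s = 0" using sn ab by (simp add: cp1 P's substX_nth)
        have nm: "(\<exists>i<n. coeff p1 i \<noteq> 0) \<or> (\<exists>i<s. coeff q1 i \<noteq> 0)"
          using exx by (auto simp: cp1 cq1)
        obtain v w where vw:
          "wronskian (pcompose (p1 - smult w q1) [:v, 1:]) (pcompose q1 [:v, 1:]) \<noteq> 0"
          "poly (wronskian (pcompose (p1 - smult w q1) [:v, 1:]) (pcompose q1 [:v, 1:])) 0 = 0"
          "order 0 (pcompose q1 [:v, 1:]) < order 0 (pcompose (p1 - smult w q1) [:v, 1:])"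
          "order 0 (pcompose (p1 - smult w q1) [:v, 1:]) + order 0 (pcompose q1 [:v, 1:]) \<le> n + s"
          "order 0 (pcompose (p1 - smult w q1) [:v, 1:]) + order 0 (pcompose q1 [:v, 1:]) < n + s \<or> coeff q1 (s - 1) \<noteq> 0"
          using residue_step[OF dp1 dq1 s sn p1s nm] by metis
        define r :: "'a fps poly" where "r = map_poly fps_const [:v, 1:]"
        define P2 where "P2 t = pcompose (P1 t - smult w (Q1 t)) [:v, 1:]" for t
        define Q2 where "Q2 t = pcompose (Q1 t) [:v, 1:]" for t
        define \<P>2 where "\<P>2 = pcompose (\<S> - smult (fps_const w) \<T>) r"
        define \<Q>2 where "\<Q>2 = pcompose \<T> r"
        have PE2: "poly_expands P2 \<P>2" unfolding P2_def \<P>2_def r_def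
          by (intro poly_expands_pcompose poly_expands_diff poly_expands_smult expands_const S(1) T(1))
        have QE2: "poly_expands Q2 \<Q>2" unfolding Q2_def \<Q>2_def r_def
          by (intro poly_expands_pcompose T(1))
        have redr: "reduction r = [:v, 1:]"
          by (rule poly_eqI) (simp add: r_def coeff_reduction coeff_ring_map[OF ring_map_fps_const])
        have redP2: "reduction \<P>2 = pcompose (p1 - smult w q1) [:v, 1:]"
          unfolding \<P>2_def p1_def q1_def redr[symmetric] unfolding reduction_def
          by (simp add: map_poly_pcompose[OF ring_map_fps_nth_0] map_poly_diff[OF ring_map_fps_nth_0]
              map_poly_smult[OF ring_map_fps_nth_0])
        have redQ2: "reduction \<Q>2 = pcompose q1 [:v, 1:]"
          unfolding \<Q>2_def q1_def redr[symmetric] unfolding reduction_def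
          by (simp add: map_poly_pcompose[OF ring_map_fps_nth_0])
        define h where "h F = pcompose (map_poly (substX b) F) [:0, fps_X ^ a:]" for F :: "'a fps poly"
        have h_add: "h (F + G) = h F + h G" and h_mult: "h (F * G) = h F * h G" for F G
          by (simp_all add: h_def ring_map_add[OF ring_map_map_poly[OF rm]] ring_map_mult[OF ring_map_map_poly[OF rm]]
              pcompose_add pcompose_mult)
        have h_const: "h [:\<Phi>:] = [:substX b \<Phi>:]" for \<Phi>
          by (simp add: h_def map_poly_const[OF rm])
        define m where "m = n - s"
        have n_eq: "n = m + s" using sn by (simp add: m_def)
        define A1 where "A1 = smult (fps_X ^ (a * m)) (h A)"
        define B1 where "B1 = h (smult qs' B + smult ps' A)"
        define \<sigma> where "\<sigma> = substX b (qs' * \<rho>)"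
        have qr: "qs' * \<rho> \<noteq> 0" using rho qs0 by auto
        have sigma0: "\<sigma> \<noteq> 0" using qr ab by (simp add: \<sigma>_def substX_eq_0_iff)
        have "h A * smult (fps_X ^ (a * n)) \<S> + B1 * smult (fps_X ^ (a * s)) \<T> = [:\<sigma>:]"
          using arg_cong[OF bez', of h] unfolding h_add h_mult h_const \<sigma>_def B1_def
          by (simp add: S(2) T(2) h_def)
        then have fac: "smult (fps_X ^ (a * s)) (A1 * \<S> + B1 * \<T>) = [:\<sigma>:]"
          by (simp add: A1_def n_eq power_add distrib_left smult_add_right mult_ac)
        define \<rho>1 where "\<rho>1 = coeff (A1 * \<S> + B1 * \<T>) 0"
        have sig: "\<sigma> = fps_X ^ (a * s) * \<rho>1" using arg_cong[OF fac, of "\<lambda>F. coeff F 0"] by (simp add: \<rho>1_def)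
        then have rho1: "\<rho>1 \<noteq> 0" using sigma0 by auto
        have bez1: "A1 * \<S> + B1 * \<T> = [:\<rho>1:]"
        proof (rule poly_eqI)
          fix i
          show "coeff (A1 * \<S> + B1 * \<T>) i = coeff [:\<rho>1:] i"
          proof (cases i)
            case (Suc j)
            have "fps_X ^ (a * s) * coeff (A1 * \<S> + B1 * \<T>) i = 0"
              using arg_cong[OF fac, of "\<lambda>F. coeff F i"] by (simp add: Suc)
            then show ?thesis by (simp add: Suc)
          qed (simp add: \<rho>1_def)
        qed
        have bez2: "pcompose A1 r * \<P>2 + pcompose (B1 + smult (fps_const w) A1) r * \<Q>2 = [:\<rho>1:]"
        proof -
          have "A1 * (\<S> - smult (fps_const w) \<T>) + (B1 + smult (fps_const w) A1) * \<T> = [:\<rho>1:]"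
            using bez1 by (simp add: algebra_simps)
          from arg_cong[OF this, of "\<lambda>F. pcompose F r"] show ?thesis
            by (simp add: \<P>2_def \<Q>2_def pcompose_add pcompose_mult pcompose_const)
        qed
        \<comment> \<open>Either the sum of the orders drops, or the slope is integral and the constant loses a power of t.\<close>
        have smaller: "((order 0 (reduction \<P>2) + order 0 (reduction \<Q>2), subdegree \<rho>1), x) \<in> less_than <*lex*> less_than"
        proof (cases "order 0 (reduction \<P>2) + order 0 (reduction \<Q>2) < n + s")
          case True
          then show ?thesis by (simp flip: x add: n_def s_def p_def q_def)
        next
          case False
          then have eq: "order 0 (reduction \<P>2) + order 0 (reduction \<Q>2) = n + s"
            and c: "coeff q1 (s - 1) \<noteq> 0" using vw(4,5) by (simp_all add: redP2 redQ2)
          have "fps_nth (substX b (coeff \<Q> (s - 1))) a \<noteq> 0"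
            using c s by (simp add: cq1 split: if_splits)
          then have "b dvd a" using ab by (auto simp: substX_nth split: if_splits)
          then have b1: "b = 1" using ab(3) by (metis coprime_common_divisor_nat dvd_refl)
          have "subdegree \<sigma> = a * s + subdegree \<rho>1" using rho1 by (simp add: sig)
          moreover have "subdegree \<sigma> = subdegree \<rho>"
            using qs0 rho by (simp add: \<sigma>_def b1 substX_def) 
              (metis add_0 qr mult_eq_0_iff subdegree_eq_0 subdegree_mult)
          ultimately have "subdegree \<rho>1 < subdegree \<rho>" using ab s by simp
          then show ?thesis using eq by (simp flip: x add: n_def s_def p_def q_def)
        qed
        have "has_critical_family P2 Q2"
          using 1[OF smaller] PE2 QE2 bez2 rho1 vw by (metis redP2 redQ2)
        then obtain c2 where c2: "(c2 \<longlongrightarrow> 0) (at 0)"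
          "\<forall>\<^sub>F t in at 0. poly (wronskian (P2 t) (Q2 t)) (c2 t) = 0 \<and> poly (Q2 t) (c2 t) \<noteq> 0"
          "((\<lambda>t. poly (P2 t) (c2 t) / poly (Q2 t) (c2 t)) \<longlongrightarrow> 0) (at 0)"
          by (auto simp: has_critical_family_def)
        \<comment> \<open>The critical point in the old coordinate, as a function of the new parameter.\<close>
        define e where "e t = t ^ a * (v + c2 t)" for t
        have tpow: "((\<lambda>t::'a. t ^ k) \<longlongrightarrow> 0 ^ k) (at 0)" for k
          using tendsto_poly_fixed[OF tendsto_id_at_0, of "monom (1::'a) k"] by (simp add: poly_monom)
        have nz0: "\<forall>\<^sub>F t in at (0::'a). t \<noteq> 0" by (simp add: eventually_at_filter)
        have e0: "(e \<longlongrightarrow> 0) (at 0)"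
        proof -
          have "(e \<longlongrightarrow> 0 ^ a * (v + 0)) (at 0)" unfolding e_def by (intro tendsto_intros tpow c2)
          then show ?thesis using ab by (simp add: zero_power)
        qed
        have qst: "((\<lambda>t. qs (t ^ b)) \<longlongrightarrow> fps_nth qs' 0) (at 0)"
          by (rule filterlim_compose[OF expands_tendsto[OF qse] filterlim_power_at_0[OF ab(2)]])
        have pst: "((\<lambda>t. ps (t ^ b)) \<longlongrightarrow> 0) (at 0)"
          using filterlim_compose[OF expands_tendsto[OF pse] filterlim_power_at_0[OF ab(2)]] ps0 by simp
        have qsne: "\<forall>\<^sub>F t in at 0. qs (t ^ b) \<noteq> 0" by (rule tendsto_imp_eventually_ne[OF qst qs0])
        have main: "\<forall>\<^sub>F t in at 0. poly (wronskian (P (t ^ b)) (Q (t ^ b))) (e t) = 0 \<and> poly (Q (t ^ b)) (e t) \<noteq> 0 \<and>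
            poly (P (t ^ b)) (e t) / poly (Q (t ^ b)) (e t) =
            (t ^ (a * m) * (poly (P2 t) (c2 t) / poly (Q2 t) (c2 t) + w) + ps (t ^ b)) / qs (t ^ b)"
          using c2(2) nz0 qsne
        proof eventually_elim
          case (elim t)
          have t0: "t \<noteq> 0" using elim by simp
          have Q2t: "poly (Q2 t) (c2 t) = inverse (t ^ (a * s)) * poly (Q (t ^ b)) (e t)"
            by (simp add: Q2_def Q1_def poly_pcompose e_def mult.commute)
          have P2t: "poly (P2 t) (c2 t) = inverse (t ^ (a * n)) * poly (P' (t ^ b)) (e t)
              - w * (inverse (t ^ (a * s)) * poly (Q (t ^ b)) (e t))"
            by (simp add: P2_def P1_def Q1_def poly_pcompose e_def mult.commute)
          have P't: "poly (P' (t ^ b)) (e t) = qs (t ^ b) * poly (P (t ^ b)) (e t) - ps (t ^ b) * poly (Q (t ^ b)) (e t)"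
            by (simp add: P'_def)
          have Qne: "poly (Q (t ^ b)) (e t) \<noteq> 0" using elim Q2t by auto
          have tn: "t ^ (a * n) = t ^ (a * m) * t ^ (a * s)" by (simp add: n_eq power_add distrib_left)
          have "poly (P2 t) (c2 t) / poly (Q2 t) (c2 t) + w
              = inverse (t ^ (a * m)) * (poly (P' (t ^ b)) (e t) / poly (Q (t ^ b)) (e t))"
            unfolding P2t Q2t tn using Qne t0 by (simp add: field_simps)
          then have "t ^ (a * m) * (poly (P2 t) (c2 t) / poly (Q2 t) (c2 t) + w)
              = poly (P' (t ^ b)) (e t) / poly (Q (t ^ b)) (e t)" using t0 by simp
          then have C: "poly (P (t ^ b)) (e t) / poly (Q (t ^ b)) (e t) =
            (t ^ (a * m) * (poly (P2 t) (c2 t) / poly (Q2 t) (c2 t) + w) + ps (t ^ b)) / qs (t ^ b)"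
            using elim Qne by (simp add: P't field_simps)
          define W where "W = wronskian (P (t ^ b)) (Q (t ^ b))"
          have "wronskian (P' (t ^ b)) (Q (t ^ b)) = smult (qs (t ^ b)) W"
            using wronskian_affine[of "qs (t ^ b)" "P (t ^ b)" "- ps (t ^ b)" "Q (t ^ b)"] by (simp add: P'_def W_def)
          then have "wronskian (P1 t) (Q1 t)
             = smult (inverse (t ^ (a * n)) * inverse (t ^ (a * s)) * qs (t ^ b)) (pcompose W [:0, t ^ a:] * pderiv [:0, t ^ a:])"
            by (simp add: P1_def Q1_def wronskian_smult wronskian_pcompose pcompose_smult)
          moreover have "wronskian (P2 t) (Q2 t) = pcompose (wronskian (P1 t) (Q1 t)) [:v, 1:]"
            using wronskian_affine[of 1 "P1 t" "-w" "Q1 t"]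
            by (simp add: P2_def Q2_def wronskian_pcompose pderiv_pCons)
          ultimately have "poly (wronskian (P2 t) (Q2 t)) (c2 t)
             = inverse (t ^ (a * n)) * inverse (t ^ (a * s)) * qs (t ^ b) * (poly W (e t) * t ^ a)"
            by (simp add: poly_pcompose e_def pderiv_pCons mult.commute)
          then have "poly W (e t) = 0" using elim by simp
          then show ?case using Qne C by (simp add: W_def)
        qed
        have lim: "((\<lambda>t. poly (P (t ^ b)) (e t) / poly (Q (t ^ b)) (e t)) \<longlongrightarrow> 0) (at 0)"
        proof -
          have "((\<lambda>t. (t ^ (a * m) * (poly (P2 t) (c2 t) / poly (Q2 t) (c2 t) + w) + ps (t ^ b)) / qs (t ^ b))
              \<longlongrightarrow> (0 ^ (a * m) * (0 + w) + 0) / fps_nth qs' 0) (at 0)"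
            by (intro tendsto_divide_nonarch tendsto_add tendsto_mult tpow c2 tendsto_const pst qst qs0)
          moreover have "(0::'a) ^ (a * m) = 0" using ab sn by (simp add: m_def zero_power)
          ultimately have "((\<lambda>t. (t ^ (a * m) * (poly (P2 t) (c2 t) / poly (Q2 t) (c2 t) + w) + ps (t ^ b)) / qs (t ^ b))
              \<longlongrightarrow> 0) (at 0)" by simp
          then show ?thesis
            by (rule tendsto_cong[THEN iffD2, rotated]) (use main in eventually_elim, simp)
        qed
        obtain rt :: "'a \<Rightarrow> 'a" where rt: "\<And>t. rt t ^ b = t" "filterlim rt (at 0) (at 0)"
          using exists_root_function[OF ab(2)] by blast
        show ?thesis unfolding has_critical_family_def
        proof (intro exI[of _ "\<lambda>t. e (rt t)"] conjI)
          show "((\<lambda>t. e (rt t)) \<longlongrightarrow> 0) (at 0)" by (rule filterlim_compose[OF e0 rt(2)])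
          show "\<forall>\<^sub>F t in at 0. poly (wronskian (P t) (Q t)) (e (rt t)) = 0 \<and> poly (Q t) (e (rt t)) \<noteq> 0"
            using eventually_compose_filterlim[OF main rt(2)] by (auto simp: rt(1) elim: eventually_mono)
          show "((\<lambda>t. poly (P t) (e (rt t)) / poly (Q t) (e (rt t))) \<longlongrightarrow> 0) (at 0)"
            using filterlim_compose[OF lim rt(2)] by (simp add: rt(1))
        qed
      qed
    qed
  qed
  then show ?thesis using assms by blast
qed

section \<open>Analytic families of coprime pairs\<close>

definition converges :: "('a::nonarch_field \<Rightarrow> 'a) \<Rightarrow> 'a fps \<Rightarrow> bool" where
  "converges \<phi> \<Phi> \<longleftrightarrow> (\<forall>\<^sub>F t in at 0. sums_at t \<Phi> (\<phi> t))"

definition poly_converges :: "('a::nonarch_field \<Rightarrow> 'a poly) \<Rightarrow> 'a fps poly \<Rightarrow> bool" where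
  "poly_converges P \<P> \<longleftrightarrow>
     (\<forall>i. converges (\<lambda>t. coeff (P t) i) (coeff \<P> i)) \<and> (\<exists>D. \<forall>\<^sub>F t in at 0. degree (P t) \<le> D)"

lemma converges_expands:
  assumes "converges \<phi> \<Phi>"
  shows "expands \<phi> \<Phi>"
proof -
  obtain e where e: "e > 0" "\<And>t. t \<noteq> 0 \<Longrightarrow> absval t < e \<Longrightarrow> sums_at t \<Phi> (\<phi> t)"
    using assms unfolding converges_def eventually_at_0_absval by auto
  obtain \<tau> :: 'a where tau: "\<tau> \<noteq> 0" "absval \<tau> < e" using exists_small_absval[OF e(1)] by blast
  define \<psi> where "\<psi> t = (if t = 0 then fps_nth \<Phi> 0 else \<phi> t)" for t
  have "(\<lambda>n. fps_nth \<Phi> n * t ^ n) sums \<psi> t" if "absval t \<le> absval \<tau>" for t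
  proof (cases "t = 0")
    case True
    have "(\<lambda>n. if n = 0 then fps_nth \<Phi> 0 else 0) sums fps_nth \<Phi> 0"
      using sums_single[of 0 "\<lambda>_. fps_nth \<Phi> 0"] by simp
    moreover have "(\<lambda>n. fps_nth \<Phi> n * t ^ n) = (\<lambda>n. if n = 0 then fps_nth \<Phi> 0 else 0)"
      using True by (auto simp: fun_eq_iff)
    ultimately show ?thesis using True by (simp add: \<psi>_def)
  next
    case False
    then show ?thesis using e(2)[of t] that tau by (simp add: \<psi>_def sums_at_def)
  qed
  then have "expands \<psi> \<Phi>" by (rule sums_expands[OF tau(1)])
  moreover have "\<forall>\<^sub>F t in at 0. \<psi> t = \<phi> t" by (simp add: \<psi>_def eventually_at_filter)
  ultimately show ?thesis by (rule expands_cong)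
qed

lemma poly_converges_expands: "poly_converges P \<P> \<Longrightarrow> poly_expands P \<P>"
  unfolding poly_converges_def poly_expands_def by (auto intro: converges_expands)

lemma converges_const: "converges (\<lambda>_. c) (fps_const c)"
  unfolding converges_def by (simp add: sums_at_const)

lemma converges_add:
  assumes "converges \<phi> \<Phi>" "converges \<psi> \<Psi>"
  shows "converges (\<lambda>t. \<phi> t + \<psi> t) (\<Phi> + \<Psi>)"
  using assms unfolding converges_def by (rule eventually_elim2) (rule sums_at_add)

lemma converges_mult:
  assumes "converges \<phi> \<Phi>" "converges \<psi> \<Psi>"
  shows "converges (\<lambda>t. \<phi> t * \<psi> t) (\<Phi> * \<Psi>)"
  using assms unfolding converges_def by (rule eventually_elim2) (rule sums_at_mult)

lemma converges_diff:
  assumes "converges \<phi> \<Phi>" "converges \<psi> \<Psi>"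
  shows "converges (\<lambda>t. \<phi> t - \<psi> t) (\<Phi> - \<Psi>)"
  using converges_add[OF assms(1) converges_mult[OF converges_const[of "-1"] assms(2)]]
  by (simp flip: fps_const_neg)

lemma converges_eventually_zero_iff:
  assumes "converges \<phi> \<Phi>"
  shows "\<Phi> = 0 \<Longrightarrow> \<forall>\<^sub>F t in at 0. \<phi> t = 0" "\<Phi> \<noteq> 0 \<Longrightarrow> \<forall>\<^sub>F t in at 0. \<phi> t \<noteq> 0"
  using assms expands_eventually_nonzero[OF converges_expands[OF assms]]
  by (auto simp: converges_def elim!: eventually_mono dest: sums_at_zero_unique)

lemma poly_converges_zero:
  assumes "poly_converges P 0"
  shows "\<forall>\<^sub>F t in at 0. P t = 0"
proof -
  obtain D where D: "\<forall>\<^sub>F t in at 0. degree (P t) \<le> D" using assms by (auto simp: poly_converges_def)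
  have "\<forall>\<^sub>F t in at 0. coeff (P t) i = 0" for i
    using assms converges_eventually_zero_iff(1)[of _ "0::'a fps"] by (auto simp: poly_converges_def)
  then have "\<forall>\<^sub>F t in at 0. \<forall>i\<in>{..D}. coeff (P t) i = 0" by (simp add: eventually_ball_finite)
  with D show ?thesis
  proof eventually_elim
    case (elim t)
    show ?case
    proof (rule poly_eqI)
      fix i
      show "coeff (P t) i = coeff 0 i" using elim by (cases "i \<le> D") (auto simp: coeff_eq_0)
    qed
  qed
qed

lemma poly_converges_smult_diff:
  assumes "poly_converges P \<P>" "poly_converges Q \<Q>" "converges \<phi> \<Phi>" "converges \<psi> \<Psi>"
  shows "poly_converges (\<lambda>t. smult (\<phi> t) (P t) - smult (\<psi> t) (monom 1 k * Q t)) (smult \<Phi> \<P> - smult \<Psi> (monom 1 k * \<Q>))"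
proof -
  obtain D E where "\<forall>\<^sub>F t in at 0. degree (P t) \<le> D" "\<forall>\<^sub>F t in at 0. degree (Q t) \<le> E"
    using assms by (auto simp: poly_converges_def)
  then have "\<forall>\<^sub>F t in at 0. degree (smult (\<phi> t) (P t) - smult (\<psi> t) (monom 1 k * Q t)) \<le> max D (k + E)"
  proof eventually_elim
    case (elim t)
    have "degree (monom 1 k * Q t) \<le> k + E"
      using degree_mult_le[of "monom 1 k" "Q t"] degree_monom_le[of "1::'a" k] elim by linarith
    then have "degree (smult (\<psi> t) (monom 1 k * Q t)) \<le> max D (k + E)"
      using degree_smult_le[of "\<psi> t" "monom 1 k * Q t"] by linarith
    moreover have "degree (smult (\<phi> t) (P t)) \<le> max D (k + E)"
      using degree_smult_le[of "\<phi> t" "P t"] elim by linarith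
    ultimately show ?case by (intro degree_diff_le)
  qed
  moreover have "converges (\<lambda>t. coeff (smult (\<phi> t) (P t) - smult (\<psi> t) (monom 1 k * Q t)) i)
      (coeff (smult \<Phi> \<P> - smult \<Psi> (monom 1 k * \<Q>)) i)" for i
    using assms converges_const[of 0] unfolding poly_converges_def
    by (auto simp: coeff_monom_mult intro!: converges_diff converges_mult)
  ultimately show ?thesis unfolding poly_converges_def by blast
qed

text \<open>
  The Euclidean algorithm with pseudo-division, carried out simultaneously for the series and for the members of the family. A
  nonzero leading coefficient is a convergent series, so its value is not zero for small $t \neq 0$. Hence each
  division step preserves the coprimality of the members, and a vanishing remainder can only occur next to a constant.
\<close>

lemma bezout_of_coprime_family:
  fixes P Q :: "'a::nonarch_field \<Rightarrow> 'a poly"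
  assumes "poly_converges P \<P>" "poly_converges Q \<Q>" "\<forall>\<^sub>F t in at 0. coprime (P t) (Q t)"
  shows "\<exists>A B \<rho>. \<rho> \<noteq> 0 \<and> A * \<P> + B * \<Q> = [:\<rho>:]"
  using assms
proof (induction "degree \<P> + degree \<Q>" arbitrary: P Q \<P> \<Q> rule: less_induct)
  case less
  have main: "\<exists>A B \<rho>. \<rho> \<noteq> 0 \<and> A * \<P>' + B * \<Q>' = [:\<rho>:]"
    if size: "degree \<P>' + degree \<Q>' = degree \<P> + degree \<Q>" and le: "degree \<Q>' \<le> degree \<P>'"
      and P: "poly_converges P' \<P>'" and Q: "poly_converges Q' \<Q>'"
      and cop: "\<forall>\<^sub>F t in at 0. coprime (P' t) (Q' t)" for P' Q' :: "'a \<Rightarrow> 'a poly" and \<P>' \<Q>'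
  proof (cases "degree \<Q>' = 0")
    case True
    then obtain c where c: "\<Q>' = [:c:]" by (rule degree_eq_zeroE)
    show ?thesis
    proof (cases "c = 0")
      case False
      then show ?thesis using c by (intro exI[of _ 0] exI[of _ 1] exI[of _ c]) auto
    next
      case True
      then have "\<forall>\<^sub>F t in at 0. Q' t = 0" using poly_converges_zero Q c by simp
      with cop have unit: "\<forall>\<^sub>F t in at 0. P' t \<noteq> 0 \<and> degree (P' t) = 0"
        by eventually_elim (metis coprime_0_right_iff is_unit_iff_degree not_is_unit_0)
      have conv: "converges (\<lambda>t. coeff (P' t) i) (coeff \<P>' i)" for i using P by (simp add: poly_converges_def)
      have hi: "coeff \<P>' i = 0" if "i > 0" for i
      proof (rule ccontr)
        assume "coeff \<P>' i \<noteq> 0"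
        from unit converges_eventually_zero_iff(2)[OF conv this] have "\<forall>\<^sub>F t in at (0::'a). False"
          by eventually_elim (use that in \<open>auto simp: coeff_eq_0\<close>)
        then show False by (simp add: eventually_False)
      qed
      have lo: "coeff \<P>' 0 \<noteq> 0"
      proof
        assume "coeff \<P>' 0 = 0"
        from unit converges_eventually_zero_iff(1)[OF conv this] have "\<forall>\<^sub>F t in at (0::'a). False"
          by eventually_elim (auto elim!: degree_eq_zeroE)
        then show False by (simp add: eventually_False)
      qed
      have "\<P>' = [:coeff \<P>' 0:]"
        by (rule poly_eqI) (use hi in \<open>auto simp: coeff_pCons split: nat.splits\<close>)
      then show ?thesis using lo by (intro exI[of _ 1] exI[of _ 0] exI[of _ "coeff \<P>' 0"]) auto
    qed
  next
    case False
    define m n where "m = degree \<P>'" and "n = degree \<Q>'"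
    define lp lq where "lp t = coeff (P' t) m" and "lq t = coeff (Q' t) n" for t
    define P2 where "P2 t = smult (lq t) (P' t) - smult (lp t) (monom 1 (m - n) * Q' t)" for t
    define \<P>2 where "\<P>2 = smult (lead_coeff \<Q>') \<P>' - smult (lead_coeff \<P>') (monom 1 (m - n) * \<Q>')"
    have lp: "converges lp (lead_coeff \<P>')" and lq: "converges lq (lead_coeff \<Q>')"
      using P Q by (auto simp: poly_converges_def lp_def[abs_def] lq_def[abs_def] m_def n_def)
    have P2: "poly_converges P2 \<P>2" unfolding P2_def \<P>2_def
      by (rule poly_converges_smult_diff[OF P Q lq lp])
    have "lead_coeff \<Q>' \<noteq> 0" using False by auto
    then have "\<forall>\<^sub>F t in at 0. lq t \<noteq> 0" by (rule converges_eventually_zero_iff(2)[OF lq])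
    with cop have cop2: "\<forall>\<^sub>F t in at 0. coprime (P2 t) (Q' t)"
    proof eventually_elim
      case (elim t)
      show ?case
      proof (rule coprimeI)
        fix d assume d: "d dvd P2 t" "d dvd Q' t"
        have "smult (lq t) (P' t) = P2 t + smult (lp t) (monom 1 (m - n) * Q' t)" by (simp add: P2_def)
        also have "d dvd \<dots>" using d by (intro dvd_add dvd_smult dvd_mult)
        finally have "d dvd P' t" using elim by (simp add: dvd_smult_iff)
        then show "is_unit d" using elim d by (auto dest: coprime_common_divisor)
      qed
    qed
    have "coeff \<P>2 m = 0" using le by (simp add: \<P>2_def coeff_monom_mult m_def n_def)
    moreover have "degree \<P>2 \<le> m"
    proof -
      have "degree (monom 1 (m - n) * \<Q>') \<le> m"
        using degree_mult_le[of "monom 1 (m - n)" \<Q>'] degree_monom_le[of "1::'a fps" "m - n"] le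
        by (simp add: m_def n_def)
      then show ?thesis unfolding \<P>2_def
        by (intro degree_diff_le order.trans[OF degree_smult_le]) (auto simp: m_def)
    qed
    moreover have "m > 0" using False le by (simp add: m_def)
    ultimately have "degree \<P>2 < m"
      by (metis degree_0 leading_coeff_0_iff le_neq_implies_less)
    then have "degree \<P>2 + degree \<Q>' < degree \<P> + degree \<Q>" using size by (simp add: m_def)
    from less.hyps[OF this P2 Q cop2]
    obtain A B \<rho> where r: "\<rho> \<noteq> 0" "A * \<P>2 + B * \<Q>' = [:\<rho>:]" by blast
    have "smult (lead_coeff \<Q>') A * \<P>' + (B - smult (lead_coeff \<P>') (A * monom 1 (m - n))) * \<Q>' = [:\<rho>:]"
      using r(2) by (simp add: \<P>2_def algebra_simps)
    then show ?thesis using r(1) by blast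
  qed
  show ?case
  proof (cases "degree \<Q> \<le> degree \<P>")
    case True
    then show ?thesis by (rule main[OF refl]) (use less.prems in auto)
  next
    case False
    have "\<exists>A B \<rho>. \<rho> \<noteq> 0 \<and> A * \<Q> + B * \<P> = [:\<rho>:]"
      by (rule main[of \<Q> \<P> Q P]) (use False less.prems in \<open>auto simp: coprime_commute\<close>)
    then show ?thesis by (metis add.commute)
  qed
qed

lemma no_common_root_imp_coprime:
  fixes p q :: "'a::alg_closed_field poly"
  assumes "\<And>z. \<not> (poly p z = 0 \<and> poly q z = 0)"
  shows "coprime p q"
proof (rule coprimeI)
  fix d assume d: "d dvd p" "d dvd q"
  have nr: "poly d z \<noteq> 0" for z using assms[of z] d by (auto elim!: dvdE)
  then have "degree d = 0" using alg_closed_imp_poly_has_root by (metis gr0I)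
  moreover have "d \<noteq> 0" using nr by auto
  ultimately show "is_unit d" by (simp add: is_unit_iff_degree)
qed

lemma coprime_imp_no_common_root:
  fixes p q :: "'a::field poly"
  assumes "coprime p q"
  shows "\<not> (poly p z = 0 \<and> poly q z = 0)"
proof
  assume "poly p z = 0 \<and> poly q z = 0"
  then have "is_unit [:-z, 1:]" using assms by (auto simp: poly_eq_0_iff_dvd dest: coprime_common_divisor)
  then show False by (simp add: is_unit_iff_degree)
qed

lemma hev_eq_poly:
  fixes y :: "'a::field"
  assumes "degree p \<le> d" "y \<noteq> 0"
  shows "hev d p x y = y ^ d * poly p (x / y)"
  using form_scale[of "\<lambda>c. c" d p y "x / y" 1] assms by (simp add: hev_1)

lemma form_at_infinity: "form \<phi> d p x 0 = \<phi> (coeff p d) * x ^ d"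
proof -
  have "form \<phi> d p x 0 = (\<Sum>i\<in>{d}. \<phi> (coeff p i) * x ^ i * 0 ^ (d - i))"
    unfolding form_def by (rule sum.mono_neutral_right) (auto simp: power_0_left split: if_splits)
  then show ?thesis by simp
qed

lemma Rat_degree:
  assumes "f \<in> Rat d"
  shows "degree (fst f) \<le> d" "degree (snd f) \<le> d" "rat_degree f = d" "coprime (fst f) (snd f)"
  using assms by (auto simp: Rat_def rat_degree_def rational_map_def)

lemma Rat_nonvanishing:
  fixes f :: "'a::field rat_coords"
  assumes "f \<in> Rat d" "(x, y) \<noteq> (0, 0)"
  shows "(hev d (fst f) x y, hev d (snd f) x y) \<noteq> (0, 0)"
proof (cases "y = 0")
  case True
  have "\<not> (coeff (fst f) d = 0 \<and> coeff (snd f) d = 0)"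
  proof
    assume c: "coeff (fst f) d = 0 \<and> coeff (snd f) d = 0"
    have "d = degree (fst f) \<or> d = degree (snd f)"
      using assms(1) by (auto simp: Rat_def rat_degree_def max_def split: if_splits)
    then have d0: "d = 0" using c by (metis degree_0 leading_coeff_0_iff)
    then have "fst f = 0" "snd f = 0" using c Rat_degree[OF assms(1)] by (auto elim!: degree_eq_zeroE)
    then show False using Rat_degree(4)[OF assms(1)] by simp
  qed
  then show ?thesis using True assms(2) by (auto simp: form_at_infinity)
next
  case False
  then show ?thesis using coprime_imp_no_common_root[OF Rat_degree(4)[OF assms(1)], of "x / y"] Rat_degree[OF assms(1)]
    by (auto simp: hev_eq_poly)
qed

lemma analytic_family_formal:
  fixes f :: "'a::{nonarch_field, alg_closed_field} \<Rightarrow> 'a rat_coords"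
  assumes "analytic_family d f"
  obtains \<P> \<Q> where "poly_expands (\<lambda>t. fst (f t)) \<P>" "poly_expands (\<lambda>t. snd (f t)) \<Q>"
    "degree \<P> \<le> d" "degree \<Q> \<le> d" "nondegenerate d \<P> \<Q>" "\<forall>\<^sub>F t in at 0. f t \<in> Rat d"
proof -
  obtain r a b where r: "r \<in> absval ` (- {0::'a})"
    and fam': "\<forall>t. absval t \<le> r \<longrightarrow>
        (\<forall>i\<le>d. (\<lambda>n. a i n * t ^ n) sums coeff (fst (f t)) i) \<and>
        (\<forall>i\<le>d. (\<lambda>n. b i n * t ^ n) sums coeff (snd (f t)) i) \<and>
        rat_degree (f t) \<le> d \<and> f t \<noteq> (0, 0) \<and> (t \<noteq> 0 \<longrightarrow> f t \<in> Rat d)"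
    using assms unfolding analytic_family_def by (elim bexE exE) (rule that)
  note fam = fam'[rule_format]
  have r0: "r > 0" using r by (auto simp: absval_pos_iff)
  have ev: "\<forall>\<^sub>F t in at 0. t \<noteq> 0 \<and> absval t \<le> r"
    unfolding eventually_at_0_absval using r0 by (intro exI[of _ r]) auto
  have Rat: "\<forall>\<^sub>F t in at 0. f t \<in> Rat d" using ev by eventually_elim (use fam in blast)
  define F where "F c = (\<Sum>i\<le>d. monom (Abs_fps (c i)) i)" for c :: "nat \<Rightarrow> nat \<Rightarrow> 'a"
  have cF: "coeff (F c) i = (if i \<le> d then Abs_fps (c i) else 0)" for c i by (simp add: F_def coeff_sum)
  have dF: "degree (F c) \<le> d" for c by (rule degree_le) (simp add: cF)
  have conv: "poly_converges P (F c) \<and> poly_converges (\<lambda>t. reversal d (P t)) (reversal d (F c))"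
    if *: "\<forall>\<^sub>F t in at 0. (\<forall>i\<le>d. (\<lambda>n. c i n * t ^ n) sums coeff (P t) i) \<and> degree (P t) \<le> d" for P c
  proof -
    have lo: "converges (\<lambda>t. coeff (P t) i) (Abs_fps (c i))" if "i \<le> d" for i
      unfolding converges_def sums_at_def using * by eventually_elim (use that in simp)
    have hi: "converges (\<lambda>t. coeff (P t) i) 0" if "\<not> i \<le> d" for i
      unfolding converges_def using *
      by eventually_elim (use that sums_at_const[of _ 0] in \<open>auto simp: coeff_eq_0\<close>)
    have "\<forall>\<^sub>F t in at 0. degree (P t) \<le> d" using * by eventually_elim simp
    then show ?thesis using lo hi converges_const[of 0] unfolding poly_converges_def
      by (auto simp: cF coeff_reversal intro!: exI[of _ d] always_eventually degree_reversal)
  qed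
  have P: "\<forall>\<^sub>F t in at 0. (\<forall>i\<le>d. (\<lambda>n. a i n * t ^ n) sums coeff (fst (f t)) i) \<and> degree (fst (f t)) \<le> d"
    using ev by eventually_elim (use fam in \<open>auto simp: rat_degree_def\<close>)
  have Q: "\<forall>\<^sub>F t in at 0. (\<forall>i\<le>d. (\<lambda>n. b i n * t ^ n) sums coeff (snd (f t)) i) \<and> degree (snd (f t)) \<le> d"
    using ev by eventually_elim (use fam in \<open>auto simp: rat_degree_def\<close>)
  note cP = conv[OF P] and cQ = conv[OF Q]
  have cop1: "\<forall>\<^sub>F t in at 0. coprime (fst (f t)) (snd (f t))"
    using Rat by eventually_elim (rule Rat_degree(4))
  have cop2: "\<forall>\<^sub>F t in at 0. coprime (reversal d (fst (f t))) (reversal d (snd (f t)))"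
    using Rat
  proof eventually_elim
    case (elim t)
    show ?case
    proof (rule no_common_root_imp_coprime)
      fix z :: 'a
      have "poly (reversal d p) z = hev d p 1 z" for p
        using hev_1[OF degree_reversal, of d p z] by (simp add: form_reversal)
      then show "\<not> (poly (reversal d (fst (f t))) z = 0 \<and> poly (reversal d (snd (f t))) z = 0)"
        using Rat_nonvanishing[OF elim, of 1 z] by simp
    qed
  qed
  obtain A B \<rho> where 1: "\<rho> \<noteq> 0" "A * F a + B * F b = [:\<rho>:]"
    using bezout_of_coprime_family[of "\<lambda>t. fst (f t)" "F a" "\<lambda>t. snd (f t)" "F b"] cP cQ cop1 by blast
  obtain A' B' \<rho>' where 2: "\<rho>' \<noteq> 0" "A' * reversal d (F a) + B' * reversal d (F b) = [:\<rho>':]"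
    using bezout_of_coprime_family[of "\<lambda>t. reversal d (fst (f t))" _ "\<lambda>t. reversal d (snd (f t))"] cP cQ cop2 by blast
  show thesis
    by (rule that[OF _ _ dF dF nondegenerateI[OF dF dF 1(2,1) 2(2,1)] Rat])
      (use cP cQ in \<open>auto intro: poly_converges_expands\<close>)
qed

section \<open>Points and maps in homogeneous coordinates\<close>

lemma of_hom_scale: "c \<noteq> 0 \<Longrightarrow> of_hom (c * x, c * y) = of_hom (x, y)"
  by simp

lemma of_hom_eq_iff:
  assumes "(x, y) \<noteq> (0, 0)" "(x', y') \<noteq> (0, 0)"
  shows "of_hom (x, y) = of_hom (x', y') \<longleftrightarrow> x * y' = x' * y"
  using assms by (auto simp: field_simps)

lemma of_hom_coords: "of_hom (hom_coords z) = z"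
  by (cases z) auto

lemma hom_coords_nonzero: "hom_coords z \<noteq> (0, 0)"
  by (cases z) auto

lemma hom_coords_of_hom:
  assumes "(x, y) \<noteq> (0, 0)"
  obtains c where "c \<noteq> 0" "x = c * fst (hom_coords (of_hom (x, y)))" "y = c * snd (hom_coords (of_hom (x, y)))"
  using assms that[of y] that[of x] by (cases "y = 0") auto

lemma dist_of_hom:
  fixes x y x' y' :: "'a::nonarch_field"
  assumes "(x, y) \<noteq> (0, 0)" "(x', y') \<noteq> (0, 0)"
  shows "dist (of_hom (x, y)) (of_hom (x', y'))
    = absval (x * y' - y * x') / (max (absval x) (absval y) * max (absval x') (absval y'))"
proof -
  obtain c u v where c: "c \<noteq> 0" "x = c * u" "y = c * v" "hom_coords (of_hom (x, y)) = (u, v)"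
    using hom_coords_of_hom[OF assms(1)] by (metis prod.collapse)
  obtain c' u' v' where c': "c' \<noteq> 0" "x' = c' * u'" "y' = c' * v'" "hom_coords (of_hom (x', y')) = (u', v')"
    using hom_coords_of_hom[OF assms(2)] by (metis prod.collapse)
  have m: "max (absval (k * a)) (absval (k * b)) = absval k * max (absval a) (absval b)" for k a b :: 'a
    by (simp add: absval_mult max_mult_distrib_left absval_nonneg)
  have w: "x * y' - y * x' = (c * c') * (u * v' - v * u')" by (simp add: c(2,3) c'(2,3) algebra_simps)
  have "dist (of_hom (x, y)) (of_hom (x', y'))
      = absval (u * v' - v * u') / (max (absval u) (absval v) * max (absval u') (absval v'))"
    unfolding dist_pline_def c(4) c'(4) by (simp add: hom_wedge_def hom_norm_def)
  also have "\<dots> = absval (x * y' - y * x') / (max (absval x) (absval y) * max (absval x') (absval y'))"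
    unfolding w unfolding c(2,3) c'(2,3) m using c(1) c'(1) by (simp add: absval_mult absval_eq_0_iff)
  finally show ?thesis .
qed

lemma tendsto_of_hom:
  fixes x y :: "'b \<Rightarrow> 'a::nonarch_field"
  assumes "(x \<longlongrightarrow> a) F" "(y \<longlongrightarrow> b) F" "(a, b) \<noteq> (0, 0)"
  shows "((\<lambda>t. of_hom (x t, y t)) \<longlongrightarrow> of_hom (a, b)) F"
proof -
  define M where "M = max (absval a) (absval b)"
  have M: "M > 0" using assms(3) by (auto simp: M_def less_max_iff_disj absval_pos_iff)
  have N: "((\<lambda>t. max (absval (x t)) (absval (y t))) \<longlongrightarrow> M) F"
    unfolding M_def by (intro tendsto_max tendsto_absval assms)
  have "((\<lambda>t. x t * b - y t * a) \<longlongrightarrow> a * b - b * a) F"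
    by (intro tendsto_diff tendsto_mult assms tendsto_const)
  then have "((\<lambda>t. absval (x t * b - y t * a)) \<longlongrightarrow> absval (a * b - b * a)) F"
    by (rule tendsto_absval)
  then have "((\<lambda>t. absval (x t * b - y t * a) / (max (absval (x t)) (absval (y t)) * M)) \<longlongrightarrow> absval (a * b - b * a) / (M * M)) F"
    by (intro tendsto_intros N) (use M in auto)
  moreover have "absval (a * b - b * a) / (M * M) = 0" by (simp add: mult.commute[of a b])
  ultimately have lim: "((\<lambda>t. absval (x t * b - y t * a) / (max (absval (x t)) (absval (y t)) * M)) \<longlongrightarrow> 0) F"
    by (simp only:)
  have "\<forall>\<^sub>F t in F. max (absval (x t)) (absval (y t)) > 0" by (rule order_tendstoD(1)[OF N M])
  then have "\<forall>\<^sub>F t in F. absval (x t * b - y t * a) / (max (absval (x t)) (absval (y t)) * M)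
      = dist (of_hom (x t, y t)) (of_hom (a, b))"
  proof eventually_elim
    case (elim t)
    then have "(x t, y t) \<noteq> (0, 0)" by auto
    from dist_of_hom[OF this assms(3)] show ?case by (simp add: M_def)
  qed
  from tendsto_cong[OF this, of 0] lim have "((\<lambda>t. dist (of_hom (x t, y t)) (of_hom (a, b))) \<longlongrightarrow> 0) F" by blast
  then show ?thesis using tendsto_dist_iff by blast
qed

lemma rat_eval_of_hom:
  fixes f :: "'a::field rat_coords"
  assumes "f \<in> Rat d" "(x, y) \<noteq> (0, 0)"
  shows "rat_eval f (of_hom (x, y)) = of_hom (hev d (fst f) x y, hev d (snd f) x y)"
proof (cases "y = 0")
  case True
  then have "x ^ d \<noteq> 0" using assms by simp
  from of_hom_scale[OF this, of "coeff (fst f) d" "coeff (snd f) d"] show ?thesis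
    using True Rat_degree(3)[OF assms(1)] by (simp add: form_at_infinity mult.commute)
next
  case False
  then have "y ^ d \<noteq> 0" by simp
  from of_hom_scale[OF this, of "poly (fst f) (x / y)" "poly (snd f) (x / y)"] show ?thesis
    using False Rat_degree[OF assms(1)] by (simp add: hev_eq_poly)
qed

fun iterate_pair :: "nat \<Rightarrow> 'r::comm_ring_1 poly \<times> 'r poly \<Rightarrow> nat \<Rightarrow> 'r poly \<times> 'r poly \<Rightarrow> 'r poly \<times> 'r poly" where
  "iterate_pair d f 0 M = M"
| "iterate_pair d f (Suc k) M =
     (hcomp d (fst f) (fst (iterate_pair d f k M)) (snd (iterate_pair d f k M)),
      hcomp d (snd f) (fst (iterate_pair d f k M)) (snd (iterate_pair d f k M)))"

definition apply_inverse :: "'r::comm_ring_1 poly \<times> 'r poly \<Rightarrow> 'r poly \<times> 'r poly \<Rightarrow> 'r poly \<times> 'r poly" where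
  "apply_inverse L F =
     (smult (coeff (snd L) 0) (fst F) + smult (- coeff (fst L) 0) (snd F),
      smult (- coeff (snd L) 1) (fst F) + smult (coeff (fst L) 1) (snd F))"

definition frame_det :: "'r::comm_ring_1 poly \<times> 'r poly \<Rightarrow> 'r" where
  "frame_det L = coeff (fst L) 1 * coeff (snd L) 0 - coeff (fst L) 0 * coeff (snd L) 1"

lemma degree_iterate_pair:
  assumes "degree (fst M) \<le> 1" "degree (snd M) \<le> 1"
  shows "degree (fst (iterate_pair d f k M)) \<le> d ^ k" "degree (snd (iterate_pair d f k M)) \<le> d ^ k"
  by (induction k) (use assms in \<open>auto intro: degree_hcomp\<close>)

lemma degree_apply_inverse:
  assumes "degree (fst F) \<le> D" "degree (snd F) \<le> D"
  shows "degree (fst (apply_inverse L F)) \<le> D" "degree (snd (apply_inverse L F)) \<le> D"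
  using assms by (auto simp: apply_inverse_def intro!: degree_add_le degree_diff_le order.trans[OF degree_smult_le])

lemma hev_1_linear: "hev (Suc 0) p x y = coeff p 0 * y + coeff p (Suc 0) * x"
  by (simp add: form_def)

lemma frame_det_nonzero:
  fixes L :: "'a::field rat_coords"
  assumes "L \<in> Rat 1"
  shows "frame_det L \<noteq> 0"
proof
  assume det: "frame_det L = 0"
  define a b c e where "a = coeff (fst L) 1" "b = coeff (fst L) 0" "c = coeff (snd L) 1" "e = coeff (snd L) 0"
  note defs = this
  have det: "a * e = b * c" using det by (simp add: frame_det_def defs)
  have *: "\<not> (a * x + b * y = 0 \<and> c * x + e * y = 0)" if "(x, y) \<noteq> (0, 0)" for x y
    using Rat_nonvanishing[OF assms that] by (auto simp: hev_1_linear defs add.commute)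
  show False
  proof (cases "a = 0 \<and> b = 0")
    case True
    then show False using *[of e "-c"] *[of 1 0] by (auto simp: mult.commute)
  next
    case False
    then show False using *[of b "-a"] det by (auto simp: mult.commute)
  qed
qed

text \<open>
  The inverse of a map of degree one is given by the adjugate matrix.
\<close>

lemma inv_frame:
  fixes L :: "'a::field rat_coords"
  assumes L: "L \<in> Rat 1" and uv: "(u, v) \<noteq> (0, 0)"
  shows "inv (rat_eval L) (of_hom (u, v)) =
     of_hom (coeff (snd L) 0 * u - coeff (fst L) 0 * v, coeff (fst L) 1 * v - coeff (snd L) 1 * u)"
    and "(coeff (snd L) 0 * u - coeff (fst L) 0 * v, coeff (fst L) 1 * v - coeff (snd L) 1 * u) \<noteq> (0, 0)"
proof -
  define a b c e where "a = coeff (fst L) 1" "b = coeff (fst L) 0" "c = coeff (snd L) 1" "e = coeff (snd L) 0"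
  note defs = this
  define D where "D = a * e - b * c"
  have D: "D \<noteq> 0" using frame_det_nonzero[OF L] by (simp add: frame_det_def D_def defs)
  have ev: "rat_eval L (of_hom (x, y)) = of_hom (a * x + b * y, c * x + e * y)" if "(x, y) \<noteq> (0, 0)" for x y
    unfolding rat_eval_of_hom[OF L that] by (simp add: hev_1_linear defs add.commute)
  have ne: "(a * x + b * y, c * x + e * y) \<noteq> (0, 0)" if "(x, y) \<noteq> (0, 0)" for x y
    using Rat_nonvanishing[OF L that] by (simp add: hev_1_linear defs add.commute)
  define x y where "x = e * u - b * v" "y = a * v - c * u"
  note xy_def = this
  have id: "a * x + b * y = D * u" "c * x + e * y = D * v" by (simp_all add: xy_def D_def algebra_simps)
  have xy: "(x, y) \<noteq> (0, 0)" using id uv D by auto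
  have "rat_eval L (of_hom (x, y)) = of_hom (u, v)"
    unfolding ev[OF xy] id by (rule of_hom_scale[OF D])
  moreover have "inj (rat_eval L)"
  proof (rule injI)
    fix z z' assume eq: "rat_eval L z = rat_eval L z'"
    obtain p q where pq: "z = of_hom (p, q)" "(p, q) \<noteq> (0, 0)"
      using of_hom_coords[of z] hom_coords_nonzero[of z] by (metis prod.collapse)
    obtain p' q' where pq': "z' = of_hom (p', q')" "(p', q') \<noteq> (0, 0)"
      using of_hom_coords[of z'] hom_coords_nonzero[of z'] by (metis prod.collapse)
    have "(a * p + b * q) * (c * p' + e * q') = (a * p' + b * q') * (c * p + e * q)"
      using eq unfolding pq(1) pq'(1) ev[OF pq(2)] ev[OF pq'(2)] of_hom_eq_iff[OF ne[OF pq(2)] ne[OF pq'(2)]] .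
    then have "D * (p * q' - p' * q) = 0" by (simp add: D_def algebra_simps)
    then have "p * q' = p' * q" using D by simp
    then show "z = z'" unfolding pq(1) pq'(1) using of_hom_eq_iff[OF pq(2) pq'(2)] by blast
  qed
  ultimately show "inv (rat_eval L) (of_hom (u, v)) =
     of_hom (coeff (snd L) 0 * u - coeff (fst L) 0 * v, coeff (fst L) 1 * v - coeff (snd L) 1 * u)"
    by (simp add: inv_f_eq xy_def defs)
  show "(coeff (snd L) 0 * u - coeff (fst L) 0 * v, coeff (fst L) 1 * v - coeff (snd L) 1 * u) \<noteq> (0, 0)"
    using xy by (simp add: xy_def defs)
qed

lemma frame_inverse:
  fixes L :: "'a::field rat_coords"
  assumes L: "L \<in> Rat 1"
  shows "rat_eval L (inv (rat_eval L) z) = z" "inv (rat_eval L) (rat_eval L z) = z"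
proof -
  obtain u v where uv: "z = of_hom (u, v)" "(u, v) \<noteq> (0, 0)"
    using of_hom_coords[of z] hom_coords_nonzero[of z] by (metis prod.collapse)
  have D: "frame_det L \<noteq> 0" by (rule frame_det_nonzero[OF L])
  note I = inv_frame[OF L uv(2)]
  have "rat_eval L (inv (rat_eval L) z) = of_hom (frame_det L * u, frame_det L * v)"
    unfolding uv(1) I(1) rat_eval_of_hom[OF L I(2)]
    by (rule arg_cong[of _ _ of_hom]) (simp add: hev_1_linear frame_det_def algebra_simps)
  then show "rat_eval L (inv (rat_eval L) z) = z" unfolding uv(1) of_hom_scale[OF D] .
  note R = Rat_nonvanishing[OF L uv(2)]
  have "inv (rat_eval L) (rat_eval L z) = of_hom (frame_det L * u, frame_det L * v)"
    unfolding uv(1) rat_eval_of_hom[OF L uv(2)] inv_frame(1)[OF L R]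
    by (rule arg_cong[of _ _ of_hom]) (simp add: hev_1_linear frame_det_def algebra_simps)
  then show "inv (rat_eval L) (rat_eval L z) = z" unfolding uv(1) of_hom_scale[OF D] .
qed

lemma iterate_pair_eval:
  fixes f M :: "'a::field rat_coords"
  assumes f: "f \<in> Rat d" and M: "M \<in> Rat 1" and xy: "(x, y) \<noteq> (0, 0)"
  defines "X k \<equiv> fst (iterate_pair d f k M)" and "Y k \<equiv> snd (iterate_pair d f k M)"
  shows "(hev (d ^ k) (X k) x y, hev (d ^ k) (Y k) x y) \<noteq> (0, 0) \<and>
    (rat_eval f ^^ k) (rat_eval M (of_hom (x, y))) = of_hom (hev (d ^ k) (X k) x y, hev (d ^ k) (Y k) x y)"
proof (induction k)
  case 0
  show ?case using Rat_nonvanishing[OF M xy] rat_eval_of_hom[OF M xy] by (simp add: X_def Y_def)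
next
  case (Suc k)
  have dX: "degree (X k) \<le> d ^ k" "degree (Y k) \<le> d ^ k"
    unfolding X_def Y_def using degree_iterate_pair Rat_degree[OF M] by blast+
  have step: "hev (d ^ Suc k) (X (Suc k)) x y = hev d (fst f) (hev (d ^ k) (X k) x y) (hev (d ^ k) (Y k) x y)"
    "hev (d ^ Suc k) (Y (Suc k)) x y = hev d (snd f) (hev (d ^ k) (X k) x y) (hev (d ^ k) (Y k) x y)"
    using form_hcomp[OF ring_map_id dX] by (simp_all add: X_def Y_def)
  show ?case
    unfolding step using Suc Rat_nonvanishing[OF f] rat_eval_of_hom[OF f] by simp
qed

text \<open>
  The zeros of the Jacobian form. This description is stable under composition and treats the point at infinity like any other.
\<close>

definition critical_set :: "nat \<Rightarrow> 'a::field rat_coords \<Rightarrow> 'a pline set" where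
  "critical_set d f = {z. hev (2 * d - 2) (wronskian (fst f) (snd f)) (fst (hom_coords z)) (snd (hom_coords z)) = 0}"

lemma in_form_zeros_iff:
  fixes x y :: "'a::field"
  assumes "(x, y) \<noteq> (0, 0)"
  shows "hev d p (fst (hom_coords (of_hom (x, y)))) (snd (hom_coords (of_hom (x, y)))) = 0 \<longleftrightarrow> hev d p x y = 0"
proof -
  obtain c where c: "c \<noteq> 0" "x = c * fst (hom_coords (of_hom (x, y)))" "y = c * snd (hom_coords (of_hom (x, y)))"
    using hom_coords_of_hom[OF assms] by blast
  have "hev d p x y = c ^ d * hev d p (fst (hom_coords (of_hom (x, y)))) (snd (hom_coords (of_hom (x, y))))"
    by (subst c(2), subst c(3)) (rule form_scale)
  then show ?thesis using c(1) by simp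
qed

lemma form_zeros:
  fixes p :: "'a::field poly"
  assumes "p \<noteq> 0" "degree p \<le> d"
  shows "finite {z. hev d p (fst (hom_coords z)) (snd (hom_coords z)) = 0}" (is "finite ?Z")
    and "card {z. hev d p (fst (hom_coords z)) (snd (hom_coords z)) = 0} \<le> d"
proof -
  define R where "R = {z. poly p z = 0}"
  have R: "finite R" "card R \<le> degree p"
    unfolding R_def using assms poly_roots_finite card_poly_roots_bound by blast+
  have Fin: "Fin z \<in> ?Z \<longleftrightarrow> z \<in> R" for z using assms(2) by (simp add: hev_1 R_def)
  have Inf: "Infty \<in> ?Z \<longleftrightarrow> coeff p d = 0" by (simp add: form_at_infinity)
  have Z: "?Z = Fin ` R \<union> (if coeff p d = 0 then {Infty} else {})"
  proof (rule set_eqI)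
    fix z show "z \<in> ?Z \<longleftrightarrow> z \<in> Fin ` R \<union> (if coeff p d = 0 then {Infty} else {})"
      using Fin Inf by (cases z) auto
  qed
  show "finite ?Z" unfolding Z using R by auto
  have "card ?Z \<le> card (Fin ` R) + card (if coeff p d = 0 then {Infty::'a pline} else {})"
    unfolding Z by (rule card_Un_le)
  also have "card (Fin ` R) \<le> card R" by (rule card_image_le[OF R(1)])
  also have "card R + card (if coeff p d = 0 then {Infty::'a pline} else {}) \<le> d"
  proof (cases "coeff p d = 0")
    case True
    then have "degree p \<noteq> d" using assms(1) by auto
    then show ?thesis using R assms(2) True by simp
  qed (use R assms in auto)
  finally show "card ?Z \<le> d" by simp
qed

lemma wronskian_coprime_nonzero:
  fixes p q :: "'a::{alg_closed_field, field_char_0} poly"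
  assumes "coprime p q" "degree p > 0 \<or> degree q > 0"
  shows "wronskian p q \<noteq> 0"
proof -
  have *: "wronskian p q \<noteq> 0 \<and> wronskian q p \<noteq> 0" if cop: "coprime p q" and deg: "degree p > 0" for p q :: "'a poly"
  proof -
    obtain v where v: "poly p v = 0" using alg_closed_imp_poly_has_root[OF deg] by blast
    have qv: "poly q v \<noteq> 0" using coprime_imp_no_common_root[OF cop] v by blast
    have nz: "p \<noteq> 0" "q \<noteq> 0" using deg qv by auto
    have "order v p \<noteq> 0" "order v q = 0" using v qv nz order_root[of p v] order_0I[of q v] by auto
    then show ?thesis using order_wronskian(1) nz by metis
  qed
  show ?thesis using assms *[of p q] *[of q p] by (auto simp: coprime_commute)
qed

lemma critical_set_card:
  fixes f :: "'a::{alg_closed_field, field_char_0} rat_coords"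
  assumes "f \<in> Rat d" "d > 0"
  shows "finite (critical_set d f)" "card (critical_set d f) \<le> 2 * d - 2"
proof -
  have "wronskian (fst f) (snd f) \<noteq> 0"
    using assms by (intro wronskian_coprime_nonzero) (auto simp: Rat_def rat_degree_def rational_map_def max_def split: if_splits)
  moreover have "degree (wronskian (fst f) (snd f)) \<le> 2 * d - 2"
    using Rat_degree[OF assms(1)] by (intro degree_wronskian_le) auto
  ultimately show "finite (critical_set d f)" "card (critical_set d f) \<le> 2 * d - 2"
    unfolding critical_set_def by (rule form_zeros)+
qed

text \<open>
  The chain rule along the orbit: a critical point of $f^k \circ M$ runs into a critical point of \<open>f\<close> within \<open>k\<close> steps.
\<close>

lemma wronskian_iterate_pair:
  fixes f M :: "'a::field rat_coords"
  assumes f: "f \<in> Rat d" and d: "d > 0" and M: "M \<in> Rat 1" and xy: "(x, y) \<noteq> (0, 0)"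
    and zero: "hev (2 * d ^ k - 2) (wronskian (fst (iterate_pair d f k M)) (snd (iterate_pair d f k M))) x y = 0"
  shows "\<exists>e<k. (rat_eval f ^^ e) (rat_eval M (of_hom (x, y))) \<in> critical_set d f"
  using zero
proof (induction k)
  case 0
  have M0: "fst M = [:coeff (fst M) 0, coeff (fst M) 1:]" and M1: "snd M = [:coeff (snd M) 0, coeff (snd M) 1:]"
    by (rule poly_eqI, use Rat_degree[OF M] in \<open>auto simp: coeff_pCons coeff_eq_0 split: nat.splits\<close>)+
  have "wronskian (fst M) (snd M) = [:frame_det M:]"
    by (subst M0, subst M1) (simp add: wronskian_def frame_det_def pderiv_pCons algebra_simps)
  then show ?case using 0 frame_det_nonzero[OF M] by (simp add: form_def)
next
  case (Suc k)
  define X Y where "X = fst (iterate_pair d f k M)" "Y = snd (iterate_pair d f k M)"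
  note XY_def = this
  define W where "W = wronskian (fst f) (snd f)"
  have dX: "degree X \<le> d ^ k" "degree Y \<le> d ^ k"
    unfolding XY_def using degree_iterate_pair Rat_degree[OF M] by blast+
  have "wronskian (fst (iterate_pair d f (Suc k) M)) (snd (iterate_pair d f (Suc k) M))
      = hcomp (2 * d - 2) W X Y * wronskian X Y"
    unfolding W_def XY_def using wronskian_hcomp[OF Rat_degree(1,2)[OF f] d] by simp
  moreover have "2 * d ^ Suc k - 2 = (2 * d - 2) * d ^ k + (2 * d ^ k - 2)"
  proof -
    have "d ^ k \<ge> 1" "d ^ Suc k \<ge> d ^ k" using d by auto
    then show ?thesis by (simp add: diff_mult_distrib)
  qed
  ultimately have "hev (2 * d - 2) W (hev (d ^ k) X x y) (hev (d ^ k) Y x y) * hev (2 * d ^ k - 2) (wronskian X Y) x y = 0"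
    using Suc.prems form_mult[OF ring_map_id degree_hcomp[OF dX] degree_wronskian_le[OF dX], of "2 * d - 2" W x y]
    by (simp add: form_hcomp[OF ring_map_id dX])
  then consider "hev (2 * d - 2) W (hev (d ^ k) X x y) (hev (d ^ k) Y x y) = 0" | "hev (2 * d ^ k - 2) (wronskian X Y) x y = 0"
    by auto
  then show ?case
  proof cases
    case 1
    have "(hev (d ^ k) X x y, hev (d ^ k) Y x y) \<noteq> (0, 0)"
      and eq: "(rat_eval f ^^ k) (rat_eval M (of_hom (x, y))) = of_hom (hev (d ^ k) X x y, hev (d ^ k) Y x y)"
      using iterate_pair_eval[OF f M xy, of k] by (simp_all add: XY_def)
    from 1 in_form_zeros_iff[OF this(1), of "2 * d - 2" W]
    have "(rat_eval f ^^ k) (rat_eval M (of_hom (x, y))) \<in> critical_set d f"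
      unfolding eq critical_set_def W_def by blast
    then show ?thesis by blast
  next
    case 2
    then have "\<exists>e<k. (rat_eval f ^^ e) (rat_eval M (of_hom (x, y))) \<in> critical_set d f"
      unfolding XY_def by (rule Suc.IH)
    then show ?thesis using less_SucI by blast
  qed
qed

lemma apply_inverse_hev:
  "hev D (fst (apply_inverse L F)) x y = coeff (snd L) 0 * hev D (fst F) x y - coeff (fst L) 0 * hev D (snd F) x y"
  "hev D (snd (apply_inverse L F)) x y = coeff (fst L) 1 * hev D (snd F) x y - coeff (snd L) 1 * hev D (fst F) x y"
  unfolding apply_inverse_def fst_conv snd_conv form_add[OF ring_map_id] form_smult[OF ring_map_id] by simp_all

lemma wronskian_apply_inverse:
  "wronskian (fst (apply_inverse L F)) (snd (apply_inverse L F)) = smult (frame_det L) (wronskian (fst F) (snd F))"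
  unfolding apply_inverse_def fst_conv snd_conv wronskian_linear_combination frame_det_def by (simp add: mult.commute)

lemma nondegenerate_zero:
  assumes "nondegenerate d p q" "hcomp d p U V = 0" "hcomp d q U V = 0"
  shows "U = 0 \<and> V = 0"
proof -
  obtain \<rho> N where r: "\<rho> \<noteq> 0" "in_ideal (hcomp d p U V) (hcomp d q U V) ([:\<rho>:] * U ^ N)"
    "in_ideal (hcomp d p U V) (hcomp d q U V) ([:\<rho>:] * V ^ N)"
    using assms(1) unfolding nondegenerate_def by metis
  have "[:\<rho>:] * U ^ N = 0" using r(2) unfolding assms(2,3) in_ideal_def by auto
  moreover have "[:\<rho>:] * V ^ N = 0" using r(3) unfolding assms(2,3) in_ideal_def by auto
  ultimately show ?thesis using r(1) by simp
qed

section \<open>The change of frames as a family of forms\<close>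

lemma normalise_family:
  fixes P Q :: "'a::{nonarch_field, field_char_0} \<Rightarrow> 'a poly"
  assumes P: "poly_expands P \<P>" and Q: "poly_expands Q \<Q>" and nz: "\<P> \<noteq> 0 \<or> \<Q> \<noteq> 0"
  obtains k \<S> \<T> where "\<P> = smult (fps_X ^ k) \<S>" "\<Q> = smult (fps_X ^ k) \<T>"
    "poly_expands (\<lambda>t. smult (inverse (t ^ k)) (P t)) \<S>" "poly_expands (\<lambda>t. smult (inverse (t ^ k)) (Q t)) \<T>"
    "reduction \<S> \<noteq> 0 \<or> reduction \<T> \<noteq> 0"
proof -
  define good where "good k \<longleftrightarrow> (\<exists>i. fps_nth (coeff \<P> i) k \<noteq> 0 \<or> fps_nth (coeff \<Q> i) k \<noteq> 0)" for k
  define k where "k = (LEAST k. good k)"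
  have "\<exists>k. good k"
    using nz unfolding good_def by (metis coeff_0 fps_ext fps_zero_nth poly_eqI)
  then have gk: "good k" and least: "\<And>j. j < k \<Longrightarrow> \<not> good j"
    unfolding k_def by (auto intro: LeastI_ex dest: not_less_Least)
  have div: "\<exists>\<S>. \<P> = smult (fps_X ^ k) \<S>" if "\<And>i j. j < k \<Longrightarrow> fps_nth (coeff \<P> i) j = 0" for \<P> :: "'a fps poly"
  proof -
    have "[:fps_X ^ k:] dvd \<P>" unfolding const_poly_dvd_iff using that by (auto intro: fps_X_power_dvdI)
    then obtain \<S> where "\<P> = [:fps_X ^ k:] * \<S>" by (elim dvdE)
    then show ?thesis by (intro exI[of _ \<S>]) simp
  qed
  obtain \<S> where S: "\<P> = smult (fps_X ^ k) \<S>" using div[of \<P>] least by (auto simp: good_def)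
  obtain \<T> where T: "\<Q> = smult (fps_X ^ k) \<T>" using div[of \<Q>] least by (auto simp: good_def)
  have exp: "poly_expands (\<lambda>t. smult (inverse (t ^ k)) (P t)) \<S>" if PS: "poly_expands P (smult (fps_X ^ k) \<S>)" for P \<S>
  proof -
    obtain D where D: "\<forall>\<^sub>F t in at 0. degree (P t) \<le> D" using PS by (auto simp: poly_expands_def)
    then have "\<forall>\<^sub>F t in at 0. degree (smult (inverse (t ^ k)) (P t)) \<le> D"
      by eventually_elim (rule order.trans[OF degree_smult_le])
    moreover have "expands (\<lambda>t. coeff (smult (inverse (t ^ k)) (P t)) i) (coeff \<S> i)" for i
      using expands_divide_power[of "\<lambda>t. coeff (P t) i" k "coeff \<S> i"] poly_expands_coeff[OF PS, of i]
      by (simp add: divide_inverse mult.commute)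
    ultimately show ?thesis unfolding poly_expands_def by blast
  qed
  have "reduction \<S> \<noteq> 0 \<or> reduction \<T> \<noteq> 0"
  proof -
    obtain i where "fps_nth (coeff \<P> i) k \<noteq> 0 \<or> fps_nth (coeff \<Q> i) k \<noteq> 0" using gk by (auto simp: good_def)
    then have "coeff (reduction \<S>) i \<noteq> 0 \<or> coeff (reduction \<T>) i \<noteq> 0"
      by (simp add: S T coeff_reduction fps_X_power_mult_nth)
    then show ?thesis by auto
  qed
  then show thesis by (rule that[OF S T exp[OF P[unfolded S]] exp[OF Q[unfolded T]]])
qed

definition represents :: "nat \<Rightarrow> ('a::nonarch_field \<Rightarrow> 'a pline \<Rightarrow> 'a pline) \<Rightarrow> ('a \<Rightarrow> 'a poly) \<Rightarrow> ('a \<Rightarrow> 'a poly) \<Rightarrow> bool" where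
  "represents D \<Phi> X Y \<longleftrightarrow> (\<forall>\<^sub>F t in at 0. \<forall>x y. (x, y) \<noteq> (0, 0) \<longrightarrow>
     (hev D (X t) x y, hev D (Y t) x y) \<noteq> (0, 0) \<and> \<Phi> t (of_hom (x, y)) = of_hom (hev D (X t) x y, hev D (Y t) x y))"

text \<open>
  Division by the largest possible power of \<open>t\<close> makes the reduction nonzero; in a rational map over \<open>K\<close> a common power of \<open>t\<close> is
  invisible. The last conclusion leads from critical points of the composition back to critical points of \<open>f\<close>.
\<close>

lemma frame_change_family:
  fixes f M L :: "'a::{nonarch_field, alg_closed_field, field_char_0} \<Rightarrow> 'a rat_coords"
  assumes d: "d > 0" and f: "analytic_family d f" and M: "moving_frame M" and L: "moving_frame L"
  obtains X Y \<X> \<Y> where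
    "poly_expands X \<X>" "poly_expands Y \<Y>" "degree \<X> \<le> d ^ k" "degree \<Y> \<le> d ^ k"
    "nondegenerate (d ^ k) \<X> \<Y>" "reduction \<X> \<noteq> 0 \<or> reduction \<Y> \<noteq> 0"
    "\<forall>\<^sub>F t in at 0. degree (X t) \<le> d ^ k \<and> degree (Y t) \<le> d ^ k"
    "represents (d ^ k) (\<lambda>t z. inv (rat_eval (L t)) ((rat_eval (f t) ^^ k) (rat_eval (M t) z))) X Y"
    "\<forall>\<^sub>F t in at 0. \<forall>x y. (x, y) \<noteq> (0, 0) \<longrightarrow> hev (2 * d ^ k - 2) (wronskian (X t) (Y t)) x y = 0 \<longrightarrow>
       (\<exists>e<k. (rat_eval (f t) ^^ e) (rat_eval (M t) (of_hom (x, y))) \<in> critical_set d (f t))"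
proof -
  obtain \<F>0 \<F>1 where F: "poly_expands (\<lambda>t. fst (f t)) \<F>0" "poly_expands (\<lambda>t. snd (f t)) \<F>1"
    "degree \<F>0 \<le> d" "degree \<F>1 \<le> d" "nondegenerate d \<F>0 \<F>1" "\<forall>\<^sub>F t in at 0. f t \<in> Rat d"
    using analytic_family_formal[OF f] by metis
  obtain \<M>0 \<M>1 where M: "poly_expands (\<lambda>t. fst (M t)) \<M>0" "poly_expands (\<lambda>t. snd (M t)) \<M>1"
    "degree \<M>0 \<le> 1" "degree \<M>1 \<le> 1" "nondegenerate 1 \<M>0 \<M>1" "\<forall>\<^sub>F t in at 0. M t \<in> Rat 1"
    using analytic_family_formal[OF M[unfolded moving_frame_def]] by metis
  obtain \<L>0 \<L>1 where L: "poly_expands (\<lambda>t. fst (L t)) \<L>0" "poly_expands (\<lambda>t. snd (L t)) \<L>1"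
    "degree \<L>0 \<le> 1" "degree \<L>1 \<le> 1" "nondegenerate 1 \<L>0 \<L>1" "\<forall>\<^sub>F t in at 0. L t \<in> Rat 1"
    using analytic_family_formal[OF L[unfolded moving_frame_def]] by metis
  let ?I = "\<lambda>k t. iterate_pair d (f t) k (M t)" and ?J = "\<lambda>k. iterate_pair d (\<F>0, \<F>1) k (\<M>0, \<M>1)"
  have IJ: "poly_expands (\<lambda>t. fst (?I k t)) (fst (?J k)) \<and> poly_expands (\<lambda>t. snd (?I k t)) (snd (?J k)) \<and>
     nondegenerate (d ^ k) (fst (?J k)) (snd (?J k))" for k
  proof (induction k)
    case (Suc k)
    have "degree (fst (?J k)) \<le> d ^ k" "degree (snd (?J k)) \<le> d ^ k"
      using degree_iterate_pair[of "(\<M>0, \<M>1)"] M(3,4) by auto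
    then show ?case using Suc F by (auto intro: poly_expands_hcomp nondegenerate_hcomp)
  qed (use M in auto)
  define A where "A t = apply_inverse (L t) (?I k t)" for t
  define \<A> where "\<A> = apply_inverse (\<L>0, \<L>1) (?J k)"
  have Ae: "poly_expands (\<lambda>t. fst (A t)) (fst \<A>)" "poly_expands (\<lambda>t. snd (A t)) (snd \<A>)"
    unfolding A_def \<A>_def apply_inverse_def fst_conv snd_conv
    by (intro poly_expands_add poly_expands_smult expands_uminus poly_expands_coeff L(1,2)
        IJ[THEN conjunct1] IJ[THEN conjunct2, THEN conjunct1])+
  have det_exp: "expands (\<lambda>t. frame_det (L t)) (frame_det (\<L>0, \<L>1))"
    unfolding frame_det_def using poly_expands_coeff[OF L(1)] poly_expands_coeff[OF L(2)]
    by (auto intro!: expands_diff expands_mult)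
  have det: "frame_det (\<L>0, \<L>1) \<noteq> 0"
  proof
    assume "frame_det (\<L>0, \<L>1) = 0"
    then have D: "coeff \<L>0 1 * coeff \<L>1 0 = coeff \<L>0 0 * coeff \<L>1 1" by (simp add: frame_det_def)
    have H: "hcomp (Suc 0) p U V = [:coeff p 0:] * V + [:coeff p (Suc 0):] * U" for p U V :: "'a fps poly"
      by (simp add: form_def)
    have Z: "U = 0 \<and> V = 0" if "hcomp 1 \<L>0 U V = 0" "hcomp 1 \<L>1 U V = 0" for U V
      by (rule nondegenerate_zero[OF L(5) that])
    have "[:coeff \<L>0 0:] = 0 \<and> [:- coeff \<L>0 1:] = (0 :: 'a fps poly)"
      by (rule Z) (use D in \<open>simp_all add: H mult.commute\<close>)
    moreover have "[:coeff \<L>1 0:] = 0 \<and> [:- coeff \<L>1 1:] = (0 :: 'a fps poly)"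
      by (rule Z) (use D in \<open>simp_all add: H mult.commute\<close>)
    ultimately have z: "coeff \<L>0 0 = 0" "coeff \<L>0 (Suc 0) = 0" "coeff \<L>1 0 = 0" "coeff \<L>1 (Suc 0) = 0"
      by auto
    have "(1 :: 'a fps poly) = 0 \<and> (1 :: 'a fps poly) = 0" by (rule Z) (simp_all add: H z)
    then show False by simp
  qed
  have nd: "nondegenerate (d ^ k) (fst \<A>) (snd \<A>)"
    unfolding \<A>_def apply_inverse_def fst_conv snd_conv
    by (rule nondegenerate_linear_combination) (use IJ[of k] det in \<open>auto simp: frame_det_def algebra_simps\<close>)
  have dA: "degree (fst \<A>) \<le> d ^ k" "degree (snd \<A>) \<le> d ^ k"
    unfolding \<A>_def by (intro degree_apply_inverse degree_iterate_pair; use M(3,4) in simp)+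
  have "fst \<A> \<noteq> 0 \<or> snd \<A> \<noteq> 0"
  proof (rule ccontr)
    assume "\<not> (fst \<A> \<noteq> 0 \<or> snd \<A> \<noteq> 0)"
    moreover obtain a b \<rho> where "\<rho> \<noteq> 0" "a * hcomp (d ^ k) (fst \<A>) 1 0 + b * hcomp (d ^ k) (snd \<A>) 1 0 = [:\<rho>:]"
      using nondegenerate_bezout[OF nd, of 1 1 0 0] by auto
    ultimately show False by (simp add: form_zero[OF ring_map_const_poly])
  qed
  from normalise_family[OF Ae this]
  obtain c \<S> \<T> where S: "fst \<A> = smult (fps_X ^ c) \<S>" "snd \<A> = smult (fps_X ^ c) \<T>"
    "poly_expands (\<lambda>t. smult (inverse (t ^ c)) (fst (A t))) \<S>" "poly_expands (\<lambda>t. smult (inverse (t ^ c)) (snd (A t))) \<T>"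
    "reduction \<S> \<noteq> 0 \<or> reduction \<T> \<noteq> 0" by blast
  have nz: "\<forall>\<^sub>F t in at (0::'a). t \<noteq> 0" by (simp add: eventually_at_filter)
  show thesis
  proof (rule that[OF S(3,4) _ _ _ S(5)])
    show "degree \<S> \<le> d ^ k" "degree \<T> \<le> d ^ k" using dA by (simp_all add: S(1,2))
    show "nondegenerate (d ^ k) \<S> \<T>" using nd unfolding S(1,2) by (rule nondegenerate_smultD)
    show "\<forall>\<^sub>F t in at 0. degree (smult (inverse (t ^ c)) (fst (A t))) \<le> d ^ k \<and> degree (smult (inverse (t ^ c)) (snd (A t))) \<le> d ^ k"
      using M(6)
    proof eventually_elim
      case (elim t)
      have "degree (fst (A t)) \<le> d ^ k" "degree (snd (A t)) \<le> d ^ k"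
        unfolding A_def by (intro degree_apply_inverse degree_iterate_pair Rat_degree[OF elim])+
      then show ?case by (auto intro: order.trans[OF degree_smult_le])
    qed
    show "represents (d ^ k) (\<lambda>t z. inv (rat_eval (L t)) ((rat_eval (f t) ^^ k) (rat_eval (M t) z)))
      (\<lambda>t. smult (inverse (t ^ c)) (fst (A t))) (\<lambda>t. smult (inverse (t ^ c)) (snd (A t)))"
      unfolding represents_def using F(6) M(6) L(6) nz
    proof (eventually_elim, intro allI impI)
      fix t x y
      assume elim: "f t \<in> Rat d" "M t \<in> Rat 1" "L t \<in> Rat 1" "t \<noteq> 0" and xy: "(x, y) \<noteq> (0::'a, 0::'a)"
      have ne: "inverse (t ^ c) \<noteq> 0" using elim by simp
      note I = iterate_pair_eval[OF elim(1,2) xy, of k]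
      have "(hev (d ^ k) (fst (A t)) x y, hev (d ^ k) (snd (A t)) x y) \<noteq> (0, 0)"
        and "inv (rat_eval (L t)) ((rat_eval (f t) ^^ k) (rat_eval (M t) (of_hom (x, y)))) =
          of_hom (hev (d ^ k) (fst (A t)) x y, hev (d ^ k) (snd (A t)) x y)"
        using I inv_frame[OF elim(3)] unfolding A_def apply_inverse_hev by auto
      then show "(hev (d ^ k) (smult (inverse (t ^ c)) (fst (A t))) x y, hev (d ^ k) (smult (inverse (t ^ c)) (snd (A t))) x y) \<noteq> (0, 0) \<and>
          inv (rat_eval (L t)) ((rat_eval (f t) ^^ k) (rat_eval (M t) (of_hom (x, y)))) =
          of_hom (hev (d ^ k) (smult (inverse (t ^ c)) (fst (A t))) x y, hev (d ^ k) (smult (inverse (t ^ c)) (snd (A t))) x y)"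
        unfolding form_smult[OF ring_map_id] of_hom_scale[OF ne] using ne by auto
    qed
    show "\<forall>\<^sub>F t in at 0. \<forall>x y. (x, y) \<noteq> (0, 0) \<longrightarrow>
       hev (2 * d ^ k - 2) (wronskian (smult (inverse (t ^ c)) (fst (A t))) (smult (inverse (t ^ c)) (snd (A t)))) x y = 0 \<longrightarrow>
       (\<exists>e<k. (rat_eval (f t) ^^ e) (rat_eval (M t) (of_hom (x, y))) \<in> critical_set d (f t))"
      using F(6) M(6) L(6) nz
    proof (eventually_elim, intro allI impI)
      fix t x y
      assume elim: "f t \<in> Rat d" "M t \<in> Rat 1" "L t \<in> Rat 1" "t \<noteq> 0" and xy: "(x, y) \<noteq> (0::'a, 0::'a)"
        and W: "hev (2 * d ^ k - 2) (wronskian (smult (inverse (t ^ c)) (fst (A t))) (smult (inverse (t ^ c)) (snd (A t)))) x y = 0"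
      have "hev (2 * d ^ k - 2) (wronskian (fst (?I k t)) (snd (?I k t))) x y = 0"
        using W elim frame_det_nonzero[OF elim(3)]
        by (simp add: wronskian_smult A_def wronskian_apply_inverse form_smult[OF ring_map_id])
      then show "\<exists>e<k. (rat_eval (f t) ^^ e) (rat_eval (M t) (of_hom (x, y))) \<in> critical_set d (f t)"
        by (rule wronskian_iterate_pair[OF elim(1) d elim(2) xy])
    qed
  qed
qed

section \<open>Limits of the maps in a frame\<close>

lemma proportional_to_coprime:
  fixes p q a b :: "'a::alg_closed_field poly"
  assumes "\<And>z. \<not> (poly p z = 0 \<and> poly q z = 0)" "a * q = p * b"
  shows "\<exists>h. a = h * p \<and> b = h * q"
  using assms
proof (induction "degree p" arbitrary: p a)
  case 0
  then obtain c where p: "p = [:c:]" by (metis degree_eq_zeroE)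
  show ?case
  proof (cases "c = 0")
    case True
    then have nr: "poly q z \<noteq> 0" for z using 0(2) p by simp
    then have "degree q = 0" using alg_closed_imp_poly_has_root by (metis gr0I)
    then obtain e where q: "q = [:e:]" by (rule degree_eq_zeroE)
    have e: "e \<noteq> 0" using nr[of 0] q by simp
    then have "a = 0" using 0(3) p True q by simp
    then show ?thesis using e p True q by (intro exI[of _ "smult (inverse e) b"]) simp
  next
    case False
    then have "smult c b = a * q" using 0(3) p by simp
    then have "b = smult (inverse c) (a * q)" using False by (metis left_inverse smult_1_left smult_smult)
    then show ?thesis using False p by (intro exI[of _ "smult (inverse c) a"]) simp
  qed
next
  case (Suc n)
  have "0 < degree p" using Suc(2) by simp
  then obtain v where v: "poly p v = 0" using alg_closed_imp_poly_has_root by blast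
  then have qv: "poly q v \<noteq> 0" using Suc(3) by blast
  have "poly a v * poly q v = poly p v * poly b v" using arg_cong[OF Suc(4), of "\<lambda>r. poly r v"] by simp
  then have "poly a v = 0" using v qv by simp
  then obtain a' where a: "a = [:-v, 1:] * a'" unfolding poly_eq_0_iff_dvd by (elim dvdE)
  obtain p' where p: "p = [:-v, 1:] * p'" using v unfolding poly_eq_0_iff_dvd by (elim dvdE)
  have p0: "p' \<noteq> 0" using Suc(2) p by auto
  have "degree p = Suc (degree p')" unfolding p by (subst degree_mult_eq) (use p0 in auto)
  then have dp: "n = degree p'" using Suc(2) by simp
  have nr: "\<not> (poly p' z = 0 \<and> poly q z = 0)" for z using Suc(3)[of z] by (auto simp: p)
  have "[:-v, 1:] * (a' * q) = [:-v, 1:] * (p' * b)" using Suc(4) unfolding a p by (simp only: mult.assoc)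
  then have "a' * q = p' * b" by (subst (asm) mult_cancel_left) auto
  from Suc(1)[OF dp nr this] obtain h where "a' = h * p'" "b = h * q" by blast
  then show ?case unfolding a p by (intro exI[of _ h]) (simp only: mult_ac simp_thms)
qed

lemma common_factor:
  fixes p q :: "'a::alg_closed_field poly"
  assumes "p \<noteq> 0 \<or> q \<noteq> 0"
  shows "\<exists>h a b. h \<noteq> 0 \<and> p = h * a \<and> q = h * b \<and> (\<forall>z. \<not> (poly a z = 0 \<and> poly b z = 0))"
  using assms
proof (induction "degree p + degree q" arbitrary: p q rule: less_induct)
  case less
  show ?case
  proof (cases "\<exists>v. poly p v = 0 \<and> poly q v = 0")
    case False
    then show ?thesis by (intro exI[of _ 1] exI[of _ p] exI[of _ q]) auto
  next
    case True
    then obtain v where v: "poly p v = 0" "poly q v = 0" by blast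
    obtain p' where p: "p = [:-v, 1:] * p'" using v(1) unfolding poly_eq_0_iff_dvd by (elim dvdE)
    obtain q' where q: "q = [:-v, 1:] * q'" using v(2) unfolding poly_eq_0_iff_dvd by (elim dvdE)
    have deg: "degree ([:-v, 1:] * r) = (if r = 0 then 0 else Suc (degree r))" for r
      by (auto simp: degree_mult_eq simp del: mult_pCons_left)
    have nz: "p' \<noteq> 0 \<or> q' \<noteq> 0" using less.prems p q by auto
    have "degree p' + degree q' < degree p + degree q" unfolding p q deg using nz by auto
    from less.hyps[OF this nz] obtain h a b where
      "h \<noteq> 0" "p' = h * a" "q' = h * b" "\<forall>z. \<not> (poly a z = 0 \<and> poly b z = 0)" by blast
    moreover have "[:-v, 1:] \<noteq> (0 :: 'a poly)" by simp
    ultimately have "[:-v, 1:] * h \<noteq> 0" "p = ([:-v, 1:] * h) * a" "q = ([:-v, 1:] * h) * b"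
      unfolding p q by (simp_all only: mult.assoc mult_eq_0_iff simp_thms)
    then show ?thesis using \<open>\<forall>z. \<not> (poly a z = 0 \<and> poly b z = 0)\<close> by blast
  qed
qed

lemma represents_tendsto:
  fixes X Y :: "'a::nonarch_field \<Rightarrow> 'a poly"
  assumes X: "poly_expands X \<X>" and Y: "poly_expands Y \<Y>" and rep: "represents D \<Phi> X Y"
    and xy: "(x, y) \<noteq> (0, 0)" and ne: "(hev D (reduction \<X>) x y, hev D (reduction \<Y>) x y) \<noteq> (0, 0)"
  shows "((\<lambda>t. \<Phi> t (of_hom (x, y))) \<longlongrightarrow> of_hom (hev D (reduction \<X>) x y, hev D (reduction \<Y>) x y)) (at 0)"
proof -
  have "((\<lambda>t. hev D (X t) x y) \<longlongrightarrow> hev D (reduction \<X>) x y) (at 0)" "((\<lambda>t. hev D (Y t) x y) \<longlongrightarrow> hev D (reduction \<Y>) x y) (at 0)"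
    using poly_expands_tendsto[OF X] poly_expands_tendsto[OF Y]
    by (auto intro!: tendsto_form tendsto_const simp: poly_tendsto_def)
  from tendsto_of_hom[OF this ne]
  have lim: "((\<lambda>t. of_hom (hev D (X t) x y, hev D (Y t) x y)) \<longlongrightarrow> of_hom (hev D (reduction \<X>) x y, hev D (reduction \<Y>) x y)) (at 0)" .
  have "\<forall>\<^sub>F t in at 0. \<Phi> t (of_hom (x, y)) = of_hom (hev D (X t) x y, hev D (Y t) x y)"
    using rep unfolding represents_def by eventually_elim (use xy in blast)
  from tendsto_cong[OF this] lim show ?thesis by blast
qed

lemma degree_reduction_le: "degree \<P> \<le> D \<Longrightarrow> degree (reduction \<P>) \<le> D"
  by (rule degree_le) (auto simp: coeff_reduction coeff_eq_0)

lemma hev_common_factor: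
  fixes h a :: "'a::field poly"
  assumes "h \<noteq> 0" "degree (h * a) \<le> D" "degree (h * b) \<le> D" "a \<noteq> 0 \<or> b \<noteq> 0" "\<delta> = max (degree a) (degree b)"
  shows "\<delta> \<le> D" "degree h \<le> D - \<delta>"
    "hev D (h * a) x y = hev (D - \<delta>) h x y * hev \<delta> a x y"
    "hev D (h * b) x y = hev (D - \<delta>) h x y * hev \<delta> b x y"
proof -
  have le: "degree h + \<delta> \<le> D"
  proof (cases "degree a \<le> degree b")
    case True
    show ?thesis
    proof (cases "b = 0")
      case True
      then have "degree a = 0" "a \<noteq> 0" using \<open>degree a \<le> degree b\<close> assms by auto
      then show ?thesis using True assms degree_mult_eq[OF assms(1), of a] by simp
    next
      case False
      then show ?thesis using True assms degree_mult_eq[OF assms(1), of b] by simp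
    qed
  next
    case False
    then have "a \<noteq> 0" by auto
    then show ?thesis using False assms degree_mult_eq[OF assms(1), of a] by simp
  qed
  then show d: "\<delta> \<le> D" "degree h \<le> D - \<delta>" by auto
  have D: "D = (D - \<delta>) + \<delta>" using d by simp
  show "hev D (h * a) x y = hev (D - \<delta>) h x y * hev \<delta> a x y"
    by (subst D, rule form_mult[OF ring_map_id d(2)]) (simp add: assms)
  show "hev D (h * b) x y = hev (D - \<delta>) h x y * hev \<delta> b x y"
    by (subst D, rule form_mult[OF ring_map_id d(2)]) (simp add: assms)
qed

lemma rat_from_common_factor:
  fixes a b :: "'a::alg_closed_field poly"
  assumes "\<And>z. \<not> (poly a z = 0 \<and> poly b z = 0)"
  shows "(a, b) \<in> Rat (max (degree a) (degree b))"
  using no_common_root_imp_coprime[OF assms] by (auto simp: Rat_def rational_map_def rat_degree_def)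

text \<open>
  The exceptional set is the set of zeros of the common factor \<open>h\<close> as a form of degree $D - \delta$, which accounts for a zero at infinity.
\<close>

lemma dynamically_dependent_if_nonconstant:
  fixes f M L :: "'a::{nonarch_field, alg_closed_field, field_char_0} \<Rightarrow> 'a rat_coords"
  assumes X: "poly_expands X \<X>" and Y: "poly_expands Y \<Y>" and deg: "degree \<X> \<le> D" "degree \<Y> \<le> D"
    and rep: "represents D (\<lambda>t z. inv (rat_eval (L t)) ((rat_eval (f t) ^^ k) (rat_eval (M t) z))) X Y"
    and h: "h \<noteq> 0" "reduction \<X> = h * a" "reduction \<Y> = h * b" "\<And>z. \<not> (poly a z = 0 \<and> poly b z = 0)"
    and nonconst: "max (degree a) (degree b) \<ge> 1"
  shows "dynamically_dependent f M L"
proof -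
  define \<delta> where "\<delta> = max (degree a) (degree b)"
  have g: "(a, b) \<in> Rat \<delta>" unfolding \<delta>_def by (rule rat_from_common_factor[OF h(4)])
  have nz: "a \<noteq> 0 \<or> b \<noteq> 0" using h(4)[of 0] by auto
  have dr: "degree (h * a) \<le> D" "degree (h * b) \<le> D"
    using degree_reduction_le[OF deg(1)] degree_reduction_le[OF deg(2)] by (simp_all add: h)
  note H = hev_common_factor[OF h(1) dr nz \<delta>_def]
  define S where "S = {z. hev (D - \<delta>) h (fst (hom_coords z)) (snd (hom_coords z)) = 0}"
  have "finite S" unfolding S_def by (rule form_zeros(1)[OF h(1) H(2)])
  moreover have "((\<lambda>t. inv (rat_eval (L t)) ((rat_eval (f t) ^^ k) (rat_eval (M t) z))) \<longlongrightarrow> rat_eval (a, b) z) (at 0)"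
    if "z \<notin> S" for z
  proof -
    obtain x y where xy: "z = of_hom (x, y)" "(x, y) \<noteq> (0, 0)"
      using of_hom_coords[of z] hom_coords_nonzero[of z] by (metis prod.collapse)
    have c: "hev (D - \<delta>) h x y \<noteq> 0"
      using that in_form_zeros_iff[OF xy(2), of "D - \<delta>" h] by (simp add: S_def xy(1) del: of_hom.simps)
    have ne: "(hev \<delta> a x y, hev \<delta> b x y) \<noteq> (0, 0)" using Rat_nonvanishing[OF g xy(2)] by simp
    have "(hev D (reduction \<X>) x y, hev D (reduction \<Y>) x y) \<noteq> (0, 0)"
      unfolding h H(3,4) using c ne by auto
    from represents_tendsto[OF X Y rep xy(2) this]
    show ?thesis
      unfolding xy(1) rat_eval_of_hom[OF g xy(2)] h H(3,4) of_hom_scale[OF c] by simp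
  qed
  ultimately have "frame_limit f M L k (a, b)" unfolding frame_limit_def by blast
  moreover have "rational_map (a, b)" "rat_degree (a, b) \<ge> 1"
    using g nonconst by (auto simp: Rat_def \<delta>_def)
  ultimately show ?thesis unfolding dynamically_dependent_def by blast
qed

text \<open>
  By the uniqueness of limits, the reduction of the family agrees with \<open>g\<close> at all but finitely many points of \<open>K\<close>, and \<open>K\<close> is infinite.
\<close>

lemma frame_limit_reduction:
  fixes g :: "'a::{nonarch_field, alg_closed_field, field_char_0} rat_coords"
  assumes X: "poly_expands X \<X>" and Y: "poly_expands Y \<Y>" and nz: "reduction \<X> \<noteq> 0 \<or> reduction \<Y> \<noteq> 0"
    and deg: "degree \<X> \<le> D" "degree \<Y> \<le> D"
    and rep: "represents D (\<lambda>t z. inv (rat_eval (L t)) ((rat_eval (f t) ^^ k) (rat_eval (M t) z))) X Y"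
    and g: "rational_map g" and lim: "frame_limit f M L k g"
  obtains h where "h \<noteq> 0" "reduction \<X> = h * fst g" "reduction \<Y> = h * snd g"
proof -
  define p q where "p = reduction \<X>" and "q = reduction \<Y>"
  have dp: "degree p \<le> D" "degree q \<le> D" using deg by (auto simp: p_def q_def degree_reduction_le)
  obtain S where S: "finite S" and l: "\<And>z. z \<notin> S \<Longrightarrow>
     ((\<lambda>t. inv (rat_eval (L t)) ((rat_eval (f t) ^^ k) (rat_eval (M t) z))) \<longlongrightarrow> rat_eval g z) (at 0)"
    using lim unfolding frame_limit_def by blast
  have nr: "\<not> (poly (fst g) z = 0 \<and> poly (snd g) z = 0)" for z
    using coprime_imp_no_common_root[of "fst g" "snd g"] g by (simp add: rational_map_def)
  have "p * snd g = fst g * q"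
  proof (rule ccontr)
    assume "p * snd g \<noteq> fst g * q"
    then have ne: "p * snd g - fst g * q \<noteq> 0" by simp
    have "poly (p * snd g - fst g * q) z = 0" if z: "Fin z \<notin> S" for z
    proof (cases "poly p z = 0 \<and> poly q z = 0")
      case False
      have hp: "hev D p z 1 = poly p z" "hev D q z 1 = poly q z" using dp by (simp_all add: hev_1)
      have ne': "(hev D (reduction \<X>) z 1, hev D (reduction \<Y>) z 1) \<noteq> (0, 0)"
        using False hp by (auto simp: p_def q_def)
      have z1: "(z, 1) \<noteq> (0, 0 :: 'a)" "of_hom (z, 1) = Fin z" by simp_all
      have "((\<lambda>t. inv (rat_eval (L t)) ((rat_eval (f t) ^^ k) (rat_eval (M t) (Fin z)))) \<longlongrightarrow> of_hom (poly p z, poly q z)) (at 0)"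
        using represents_tendsto[OF X Y rep z1(1) ne'] unfolding p_def[symmetric] q_def[symmetric] hp z1(2) .
      then have eq: "of_hom (poly p z, poly q z) = rat_eval g (Fin z)"
        by (rule tendsto_unique[OF at_0_neq_bot _ l[OF z]])
      have ne2: "(poly p z, poly q z) \<noteq> (0, 0)" "(poly (fst g) z, poly (snd g) z) \<noteq> (0, 0)"
        using False nr[of z] by auto
      have "poly p z * poly (snd g) z = poly (fst g) z * poly q z"
        using eq of_hom_eq_iff[OF ne2] by (simp del: of_hom.simps)
      then show ?thesis by simp
    qed simp
    then have "UNIV \<subseteq> Fin -` S \<union> {z. poly (p * snd g - fst g * q) z = 0}" by auto
    moreover have "finite (Fin -` S)" using S by (rule finite_vimageI) (auto intro: injI)
    moreover have "finite {z. poly (p * snd g - fst g * q) z = 0}" by (rule poly_roots_finite[OF ne])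
    ultimately have "finite (UNIV :: 'a set)" by (meson finite_Un finite_subset)
    then show False by (simp add: infinite_UNIV_char_0)
  qed
  from proportional_to_coprime[OF nr this] obtain h where h: "p = h * fst g" "q = h * snd g" by blast
  then have "h \<noteq> 0" using nz by (auto simp: p_def q_def)
  then show thesis using that h by (simp add: p_def q_def)
qed

text \<open>
  The form \<open>H\<close> in the definition of the local degree vanishes at least doubly at \<open>c\<close>. It is completed to a pair \<open>H\<close>, \<open>G\<close> of linear
  combinations of \<open>g\<close> with determinant 1; this pair has the same Wronskian, which thus vanishes at \<open>c\<close>.
\<close>

lemma critical_point_in_critical_set:
  fixes g :: "'a::{alg_closed_field, field_char_0} rat_coords"
  assumes g: "g \<in> Rat \<delta>" "\<delta> > 0" and c: "critical_point g c"
  shows "c \<in> critical_set \<delta> g"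
proof -
  define W where "W = wronskian (fst g) (snd g)"
  note dg = Rat_degree[OF g(1)]
  have W0: "W \<noteq> 0" unfolding W_def
    using g by (intro wronskian_coprime_nonzero dg) (auto simp: Rat_def rat_degree_def max_def split: if_splits)
  have dW: "degree W \<le> 2 * \<delta> - 2" unfolding W_def by (rule degree_wronskian_le[OF dg(1,2)])
  obtain w0 w1 where w: "hom_coords (rat_eval g c) = (w0, w1)" by (metis prod.collapse)
  have wne: "w0 \<noteq> 0 \<or> w1 \<noteq> 0" using hom_coords_nonzero[of "rat_eval g c"] w by auto
  obtain a b where ab: "w1 * b + w0 * a = 1"
    using wne by (metis add_0 mult_zero_left mult_zero_right right_inverse add.right_neutral)
  define H where "H = smult w1 (fst g) - smult w0 (snd g)"
  define G where "G = smult a (fst g) + smult b (snd g)"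
  have HG: "wronskian H G = W"
  proof -
    have "wronskian H G = smult (w1 * b - (- w0) * a) W"
      unfolding H_def G_def W_def using wronskian_linear_combination[of w1 "fst g" "-w0" "snd g" a b] by simp
    then show ?thesis using ab by simp
  qed
  have H0: "H \<noteq> 0" using W0 HG by (auto simp: wronskian_def)
  have dH: "degree H \<le> \<delta>" "degree G \<le> \<delta>" unfolding H_def G_def
    using dg by (auto intro!: degree_diff_le degree_add_le order.trans[OF degree_smult_le])
  have "local_degree g c = (case c of Fin z \<Rightarrow> order z H | Infty \<Rightarrow> rat_degree g - degree H)"
    unfolding local_degree_def w H_def Let_def by simp
  then have loc: "(case c of Fin z \<Rightarrow> order z H | Infty \<Rightarrow> rat_degree g - degree H) \<ge> 2"
    using c by (simp add: critical_point_def)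
  show ?thesis
  proof (cases c)
    case (Fin z)
    then have "order z H \<ge> 2" using loc by simp
    then have "[:-z, 1:] ^ 2 dvd H" by (simp add: order_divides)
    then obtain a' where a': "H = [:-z, 1:] ^ 2 * a'" by (elim dvdE)
    have H2: "H = [:-z, 1:] * ([:-z, 1:] * a')" unfolding a' power2_eq_square by (rule mult.assoc)
    have "poly H z = 0" unfolding H2 by simp
    moreover have "poly (pderiv H) z = 0" unfolding H2 by (subst pderiv_mult) simp
    ultimately have "poly W z = 0" by (simp flip: HG add: wronskian_def)
    then show ?thesis using Fin dW by (simp add: critical_set_def hev_1 W_def)
  next
    case Infty
    then have dH2: "degree H + 2 \<le> \<delta>"
      using loc dg(3) by simp
    have "coeff (pderiv H * G) ((\<delta> - 2) + \<delta>) = coeff (pderiv H) (\<delta> - 2) * coeff G \<delta>"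
      by (rule coeff_mult_top[OF _ dH(2)]) (use dH2 in \<open>auto simp: degree_pderiv\<close>)
    moreover have "coeff (pderiv H) (\<delta> - 2) = 0" using dH2 by (simp add: coeff_pderiv coeff_eq_0)
    moreover have "coeff (H * pderiv G) ((\<delta> - 2) + \<delta>) = 0"
    proof (rule coeff_eq_0)
      have "degree (H * pderiv G) \<le> degree H + (degree G - 1)"
        using degree_mult_le[of H "pderiv G"] by (simp add: degree_pderiv)
      then show "degree (H * pderiv G) < \<delta> - 2 + \<delta>" using dH2 dH g by linarith
    qed
    moreover have "2 * \<delta> - 2 = (\<delta> - 2) + \<delta>" using dH2 by simp
    ultimately have "coeff W (2 * \<delta> - 2) = 0" unfolding HG[symmetric] wronskian_def by simp
    then show ?thesis using Infty by (simp add: critical_set_def form_at_infinity W_def)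
  qed
qed

lemma infinite_orbit_inj:
  fixes F :: "'b \<Rightarrow> 'b"
  assumes "infinite (range (\<lambda>n. (F ^^ n) x))"
  shows "inj (\<lambda>n. (F ^^ n) x)"
proof (rule ccontr)
  assume "\<not> inj (\<lambda>n. (F ^^ n) x)"
  then obtain i j where ij: "i < j" "(F ^^ i) x = (F ^^ j) x"
    by (metis (mono_tags, lifting) injI linorder_neqE_nat)
  have "(F ^^ n) x \<in> (\<lambda>n. (F ^^ n) x) ` {..<j}" for n
  proof (induction n rule: less_induct)
    case (less n)
    show ?case
    proof (cases "n < j")
      case False
      then have "n = (n - j) + j" by simp
      then have "(F ^^ n) x = (F ^^ (n - j)) ((F ^^ j) x)" by (metis comp_apply funpow_add)
      also have "\<dots> = (F ^^ (n - j + i)) x" using ij by (simp add: funpow_add)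
      finally show ?thesis using less.IH[of "n - j + i"] False ij by simp
    qed auto
  qed
  then have "range (\<lambda>n. (F ^^ n) x) \<subseteq> (\<lambda>n. (F ^^ n) x) ` {..<j}" by auto
  then show False using assms finite_subset by blast
qed

text \<open>
  The line through $(v_0, v_1)$ with direction $(\alpha, \gamma)$ misses only one point of the projective line, so a form that vanishes along it is zero.
\<close>

lemma hcomp_line_nonzero:
  fixes W :: "'a::field_char_0 poly"
  assumes "W \<noteq> 0" "degree W \<le> E" "\<alpha> * v1 - \<gamma> * v0 = 1"
  shows "hcomp E W [:v0, \<alpha>:] [:v1, \<gamma>:] \<noteq> 0"
proof
  assume Z: "hcomp E W [:v0, \<alpha>:] [:v1, \<gamma>:] = 0"
  have "poly W s = 0" for s
  proof -
    have d: "degree [:v0, \<alpha>:] \<le> 1" "degree [:v1, \<gamma>:] \<le> 1" by auto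
    define x y where "x = v1 * s - v0" and "y = \<alpha> - \<gamma> * s"
    have "\<alpha> * x + v0 * y = (\<alpha> * v1 - \<gamma> * v0) * s" "\<gamma> * x + v1 * y = \<alpha> * v1 - \<gamma> * v0"
      by (simp_all add: x_def y_def algebra_simps)
    then have "hev 1 [:v0, \<alpha>:] x y = s" "hev 1 [:v1, \<gamma>:] x y = 1"
      using assms(3) by (simp_all add: hev_1_linear add.commute)
    then have "hev E W s 1 = 0"
      using form_hcomp[OF ring_map_id d, of E W x y] Z by (simp add: form_zero[OF ring_map_id])
    then show ?thesis using assms(2) by (simp add: hev_1)
  qed
  then have "W = 0" using poly_all_0_iff_0 by blast
  then show False using assms(1) by simp
qed

section \<open>A critical point attached to each rescaling\<close>

text \<open>
  The limits of the returns are points of the orbit under \<open>g\<close> of a critical point, from one step after the last visit to a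
  bad or critical direction onwards. Points are followed by their homogeneous coordinates, because the orbit may
  pass through infinity. The critical point of $f_t^q$ that is seen in the frame runs into a
  critical point of $f_t$ after \<open>e t\<close> steps, and this number may depend on \<open>t\<close>.
\<close>

lemma critical_orbit_of_rescaling:
  fixes f M :: "'a::{nonarch_field, alg_closed_field, field_char_0} \<Rightarrow> 'a rat_coords"
  assumes d: "d > 0" and f: "analytic_family d f" and M: "moving_frame M"
    and lim: "rescaling_limit f M q g" and npcf: "\<not> postcritically_finite g"
  obtains \<omega> e x y u v where
    "\<forall>\<^sub>F t in at 0. \<omega> t \<in> critical_set d (f t) \<and> e t < q"
    "\<And>k. (x k \<longlongrightarrow> u k) (at 0)" "\<And>k. (y k \<longlongrightarrow> v k) (at 0)" "\<And>k. (u k, v k) \<noteq> (0::'a, 0::'a)"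
    "inj (\<lambda>k. of_hom (u k, v k))"
    "\<And>k. \<forall>\<^sub>F t in at 0. (x k t, y k t) \<noteq> (0, 0) \<and>
       (rat_eval (f t) ^^ (q * Suc k - e t)) (\<omega> t) = rat_eval (M t) (of_hom (x k t, y k t))"
proof -
  define D where "D = d ^ q"
  define \<delta> where "\<delta> = rat_degree g"
  have q: "q \<ge> 1" and g: "rational_map g" and d2: "\<delta> \<ge> 2" and flim: "frame_limit f M M q g"
    using lim by (auto simp: rescaling_limit_def \<delta>_def)
  have gR: "g \<in> Rat \<delta>" using g by (simp add: Rat_def \<delta>_def)
  note dg = Rat_degree[OF gR]
  obtain X Y \<X> \<Y> where X: "poly_expands X \<X>" and Y: "poly_expands Y \<Y>"
    and dXY: "degree \<X> \<le> D" "degree \<Y> \<le> D" and nd: "nondegenerate D \<X> \<Y>"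
    and nz: "reduction \<X> \<noteq> 0 \<or> reduction \<Y> \<noteq> 0"
    and degt: "\<forall>\<^sub>F t in at 0. degree (X t) \<le> D \<and> degree (Y t) \<le> D"
    and rep: "represents D (\<lambda>t z. inv (rat_eval (M t)) ((rat_eval (f t) ^^ q) (rat_eval (M t) z))) X Y"
    and crit: "\<forall>\<^sub>F t in at 0. \<forall>x y. (x, y) \<noteq> (0, 0) \<longrightarrow> hev (2 * D - 2) (wronskian (X t) (Y t)) x y = 0 \<longrightarrow>
       (\<exists>e<q. (rat_eval (f t) ^^ e) (rat_eval (M t) (of_hom (x, y))) \<in> critical_set d (f t))"
    by (rule frame_change_family[OF d f M M, of q, folded D_def]) (rule that)
  have MR: "\<forall>\<^sub>F t in at 0. M t \<in> Rat 1"
    using analytic_family_formal[OF M[unfolded moving_frame_def]] by metis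
  define p r where "p = reduction \<X>" and "r = reduction \<Y>"
  have dpr: "degree p \<le> D" "degree r \<le> D" using dXY by (auto simp: p_def r_def degree_reduction_le)
  obtain h where h: "h \<noteq> 0" "p = h * fst g" "r = h * snd g"
    using frame_limit_reduction[OF X Y nz dXY rep g flim] by (auto simp: p_def r_def)
  have gnz: "fst g \<noteq> 0 \<or> snd g \<noteq> 0" using d2 by (auto simp: \<delta>_def rat_degree_def)
  have dd: "\<delta> = max (degree (fst g)) (degree (snd g))" by (simp add: \<delta>_def rat_degree_def)
  note H = hev_common_factor[OF h(1) dpr[unfolded h] gnz dd, folded h(2,3)]
  define W where "W = wronskian p r"
  define Wg where "Wg = wronskian (fst g) (snd g)"
  have WWg: "W = h\<^sup>2 * Wg" unfolding W_def Wg_def h by (rule wronskian_mult)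
  have Wg0: "Wg \<noteq> 0" unfolding Wg_def
    using d2 by (intro wronskian_coprime_nonzero dg) (auto simp: dd)
  have W0: "W \<noteq> 0" using WWg Wg0 h by simp
  have dW: "degree W \<le> 2 * D - 2" unfolding W_def by (rule degree_wronskian_le[OF dpr])
  have dWg: "degree Wg \<le> 2 * \<delta> - 2" unfolding Wg_def by (rule degree_wronskian_le[OF dg(1,2)])
  have hevW: "hev (2 * D - 2) W s t = (hev (D - \<delta>) h s t)\<^sup>2 * hev (2 * \<delta> - 2) Wg s t" for s t
  proof -
    have "2 * D - 2 = 2 * (D - \<delta>) + (2 * \<delta> - 2)" using H(1) d2 by simp
    moreover have "degree (h\<^sup>2) \<le> 2 * (D - \<delta>)"
      using degree_power_le[of h 2] H(2) by linarith
    ultimately show ?thesis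
      using form_mult[OF ring_map_id _ dWg, of "h\<^sup>2" "2 * (D - \<delta>)" s t] form_power[OF ring_map_id H(2), of 2 s t]
      by (simp add: WWg)
  qed
  define Z where "Z = {z. hev (2 * D - 2) W (fst (hom_coords z)) (snd (hom_coords z)) = 0}"
  have Zfin: "finite Z" unfolding Z_def by (rule form_zeros(1)[OF W0 dW])
  obtain c where c: "critical_point g c" "infinite (range (\<lambda>n. (rat_eval g ^^ n) c))"
    using npcf unfolding postcritically_finite_def by blast
  define z where "z n = (rat_eval g ^^ n) c" for n
  have zinj: "inj z" using infinite_orbit_inj[OF c(2)] by (simp add: z_def[abs_def])
  have "c \<in> critical_set \<delta> g" using critical_point_in_critical_set[OF gR _ c(1)] d2 by simp
  then have z0: "z 0 \<in> Z" by (simp add: z_def Z_def hevW critical_set_def Wg_def)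
  have "finite (z -` Z)" by (rule finite_vimageI[OF Zfin zinj])
  \<comment> \<open>From time N + 1 on, the orbit avoids the directions that are bad or critical.\<close>
  define N where "N = Max (z -` Z)"
  have zN: "z N \<in> Z" using Max_in[OF \<open>finite (z -` Z)\<close>] z0 by (auto simp: N_def)
  have good: "z n \<notin> Z" if "n > N" for n
    using Max_ge[OF \<open>finite (z -` Z)\<close>, of n] that by (auto simp: N_def)
  obtain v0 v1 where v: "hom_coords (z N) = (v0, v1)" by (metis prod.collapse)
  have vne: "(v0, v1) \<noteq> (0, 0)" using hom_coords_nonzero[of "z N"] v by simp
  have vz: "of_hom (v0, v1) = z N" using of_hom_coords[of "z N"] v by simp
  \<comment> \<open>Affine coordinates at the source and at the target in which v and g(v) become 0.\<close>
  obtain \<alpha> \<gamma> where line: "\<alpha> * v1 - \<gamma> * v0 = 1"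
  proof (cases "v1 = 0")
    case True
    then show thesis using vne by (intro that[of 0 "- inverse v0"]) simp
  next
    case False
    then show thesis by (intro that[of "inverse v1" 0]) simp
  qed
  define w0 w1 where "w0 = hev \<delta> (fst g) v0 v1" and "w1 = hev \<delta> (snd g) v0 v1"
  have wne: "(w0, w1) \<noteq> (0, 0)" using Rat_nonvanishing[OF gR vne] by (simp add: w0_def w1_def)
  have wz: "of_hom (w0, w1) = z (Suc N)"
    using rat_eval_of_hom[OF gR vne] vz by (simp add: z_def w0_def w1_def del: of_hom.simps)
  obtain \<kappa> \<mu> where lm: "\<kappa> * w0 + \<mu> * w1 = 1"
  proof (cases "w1 = 0")
    case True
    then show thesis using wne by (intro that[of "inverse w0" 0]) simp
  next
    case False
    then show thesis by (intro that[of 0 "inverse w1"]) simp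
  qed
  define b0 b1 where "b0 = [:v0, \<alpha>:]" and "b1 = [:v1, \<gamma>:]"
  have db: "degree b0 \<le> 1" "degree b1 \<le> 1" by (auto simp: b0_def b1_def)
  have Wb: "wronskian b0 b1 = 1"
    using line by (simp add: wronskian_def b0_def b1_def pderiv_pCons one_pCons algebra_simps)
  define \<B>0 \<B>1 where "\<B>0 = map_poly fps_const b0" and "\<B>1 = map_poly fps_const b1"
  have bB: "poly_expands (\<lambda>_. b0) \<B>0" "poly_expands (\<lambda>_. b1) \<B>1"
    unfolding \<B>0_def \<B>1_def by (rule poly_expands_constant)+
  define X1 where "X1 t = smult w1 (X t) + smult (- w0) (Y t)" for t
  define Y1 where "Y1 t = smult \<kappa> (X t) + smult \<mu> (Y t)" for t
  define \<X>1 where "\<X>1 = smult (fps_const w1) \<X> + smult (fps_const (- w0)) \<Y>"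
  define \<Y>1 where "\<Y>1 = smult (fps_const \<kappa>) \<X> + smult (fps_const \<mu>) \<Y>"
  have det: "w1 * \<mu> - (- w0) * \<kappa> = 1" using lm by (simp add: mult.commute add.commute)
  have nd1: "nondegenerate D \<X>1 \<Y>1" unfolding \<X>1_def \<Y>1_def
  proof (rule nondegenerate_linear_combination[OF nd])
    have "fps_const w1 * fps_const \<mu> - fps_const (- w0) * fps_const \<kappa> = fps_const (w1 * \<mu> - (- w0) * \<kappa>)" by simp
    then show "fps_const w1 * fps_const \<mu> - fps_const (- w0) * fps_const \<kappa> \<noteq> 0" unfolding det by simp
  qed
  have X1e: "poly_expands X1 \<X>1" and Y1e: "poly_expands Y1 \<Y>1"
    unfolding X1_def \<X>1_def Y1_def \<Y>1_def
    by (intro poly_expands_add poly_expands_smult expands_const X Y)+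
  define P where "P t = hcomp D (X1 t) b0 b1" for t
  define Q where "Q t = hcomp D (Y1 t) b0 b1" for t
  define \<P> where "\<P> = hcomp D \<X>1 \<B>0 \<B>1"
  define \<Q> where "\<Q> = hcomp D \<Y>1 \<B>0 \<B>1"
  have Pe: "poly_expands P \<P>" and Qe: "poly_expands Q \<Q>"
    unfolding P_def \<P>_def Q_def \<Q>_def by (intro poly_expands_hcomp X1e Y1e bB)+
  have bez: "map_poly fps_const [:- \<gamma>:] * \<B>0 + map_poly fps_const [:\<alpha>:] * \<B>1 = 1"
  proof -
    have "[:- \<gamma>:] * b0 + [:\<alpha>:] * b1 = 1" using line by (simp add: b0_def b1_def one_pCons algebra_simps)
    from arg_cong[OF this, of "map_poly fps_const"] show ?thesis
      by (simp only: \<B>0_def \<B>1_def ring_map_add[OF ring_map_map_poly[OF ring_map_fps_const]]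
          ring_map_mult[OF ring_map_map_poly[OF ring_map_fps_const]] ring_map_one[OF ring_map_map_poly[OF ring_map_fps_const]])
  qed
  obtain A B \<rho> where AB: "\<rho> \<noteq> 0" "A * \<P> + B * \<Q> = [:\<rho>:]"
    using nondegenerate_bezout[OF nd1 bez] unfolding \<P>_def \<Q>_def by blast
  have redB: "reduction \<B>0 = b0" "reduction \<B>1 = b1"
    by (rule poly_eqI; simp add: coeff_reduction \<B>0_def \<B>1_def coeff_ring_map[OF ring_map_fps_const])+
  define p1 where "p1 = smult w1 p + smult (- w0) r"
  define r1 where "r1 = smult \<kappa> p + smult \<mu> r"
  have redX1: "reduction \<X>1 = p1" "reduction \<Y>1 = r1"
    by (rule poly_eqI; simp add: coeff_reduction \<X>1_def \<Y>1_def p1_def r1_def p_def r_def)+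
  have redP: "reduction \<P> = hcomp D p1 b0 b1"
    using map_poly_hcomp[OF ring_map_fps_nth_0, of D \<X>1 \<B>0 \<B>1] redX1 redB by (simp add: \<P>_def reduction_def)
  have redQ: "reduction \<Q> = hcomp D r1 b0 b1"
    using map_poly_hcomp[OF ring_map_fps_nth_0, of D \<Y>1 \<B>0 \<B>1] redX1 redB by (simp add: \<Q>_def reduction_def)
  have D0: "D > 0" using d by (simp add: D_def)
  have "wronskian p1 r1 = smult 1 W"
    unfolding p1_def r1_def wronskian_linear_combination W_def det ..
  then have W1: "wronskian p1 r1 = W" by simp
  have dp1: "degree p1 \<le> D" "degree r1 \<le> D"
    unfolding p1_def r1_def by (intro degree_add_le order.trans[OF degree_smult_le] dpr)+
  have redW: "wronskian (reduction \<P>) (reduction \<Q>) = hcomp (2 * D - 2) W b0 b1"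
    unfolding redP redQ wronskian_hcomp[OF dp1 D0] W1 Wb by simp
  have redW0: "wronskian (reduction \<P>) (reduction \<Q>) \<noteq> 0"
    unfolding redW b0_def b1_def by (rule hcomp_line_nonzero[OF W0 dW line])
  have b_at_0: "poly b0 0 = v0" "poly b1 0 = v1" by (simp_all add: b0_def b1_def)
  have redWr: "poly (wronskian (reduction \<P>) (reduction \<Q>)) 0 = 0"
    unfolding redW poly_hcomp b_at_0 using zN v by (simp add: Z_def)
  have ord: "order 0 (reduction \<Q>) < order 0 (reduction \<P>)"
  proof -
    define a where "a = smult w1 (fst g) + smult (- w0) (snd g)"
    define b where "b = smult \<kappa> (fst g) + smult \<mu> (snd g)"
    define h' where "h' = hcomp (D - \<delta>) h b0 b1"
    have dab: "degree a \<le> \<delta>" "degree b \<le> \<delta>"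
      unfolding a_def b_def by (intro degree_add_le order.trans[OF degree_smult_le] dg)+
    have pr: "p1 = h * a" "r1 = h * b" by (simp_all add: p1_def r1_def a_def b_def h algebra_simps)
    have DD: "D = (D - \<delta>) + \<delta>" using H(1) by simp
    have P': "reduction \<P> = h' * hcomp \<delta> a b0 b1"
      unfolding redP pr h'_def by (subst DD, rule form_mult[OF ring_map_const_poly H(2) dab(1)])
    have Q': "reduction \<Q> = h' * hcomp \<delta> b b0 b1"
      unfolding redQ pr h'_def by (subst DD, rule form_mult[OF ring_map_const_poly H(2) dab(2)])
    have a0: "poly (hcomp \<delta> a b0 b1) 0 = 0"
      unfolding poly_hcomp b_at_0 a_def form_add[OF ring_map_id] form_smult[OF ring_map_id]
      by (simp add: w0_def w1_def)
    have b1: "poly (hcomp \<delta> b b0 b1) 0 = 1"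
      unfolding poly_hcomp b_at_0 b_def form_add[OF ring_map_id] form_smult[OF ring_map_id]
      using lm by (simp add: w0_def w1_def)
    have PQ0: "reduction \<P> \<noteq> 0" "reduction \<Q> \<noteq> 0" using redW0 by (auto simp: wronskian_def)
    then have nz': "hcomp \<delta> a b0 b1 \<noteq> 0" "h' \<noteq> 0" using P' by auto
    have "order 0 (hcomp \<delta> a b0 b1) > 0" using a0 nz' by (simp add: order_gt_0_iff)
    moreover have "order 0 (hcomp \<delta> b b0 b1) = 0" using b1 by (intro order_0I) simp
    moreover have "order 0 (reduction \<P>) = order 0 h' + order 0 (hcomp \<delta> a b0 b1)"
      unfolding P' by (rule order_mult) (use PQ0 P' in simp)
    moreover have "order 0 (reduction \<Q>) = order 0 h' + order 0 (hcomp \<delta> b b0 b1)"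
      unfolding Q' by (rule order_mult) (use PQ0 Q' in simp)
    ultimately show ?thesis by simp
  qed
  from critical_family[OF Pe Qe AB(2,1) redW0 redWr ord]
  obtain \<zeta> where ze: "(\<zeta> \<longlongrightarrow> 0) (at 0)"
    "\<forall>\<^sub>F t in at 0. poly (wronskian (P t) (Q t)) (\<zeta> t) = 0 \<and> poly (Q t) (\<zeta> t) \<noteq> 0"
    "((\<lambda>t. poly (P t) (\<zeta> t) / poly (Q t) (\<zeta> t)) \<longlongrightarrow> 0) (at 0)"
    unfolding has_critical_family_def by blast
  define s0 s1 where "s0 t = poly b0 (\<zeta> t)" and "s1 t = poly b1 (\<zeta> t)" for t
  have s_line: "\<alpha> * s1 t - \<gamma> * s0 t = 1" for t
    using line by (simp add: s0_def s1_def b0_def b1_def algebra_simps)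
  have sne: "(s0 t, s1 t) \<noteq> (0, 0)" for t using s_line[of t] by auto
  define e where "e t = (SOME e. e < q \<and> (rat_eval (f t) ^^ e) (rat_eval (M t) (of_hom (s0 t, s1 t))) \<in> critical_set d (f t))" for t
  define \<omega> where "\<omega> t = (rat_eval (f t) ^^ e t) (rat_eval (M t) (of_hom (s0 t, s1 t)))" for t
  have om: "\<forall>\<^sub>F t in at 0. \<omega> t \<in> critical_set d (f t) \<and> e t < q"
    using ze(2) degt crit
  proof eventually_elim
    case (elim t)
    have dX1: "degree (X1 t) \<le> D" "degree (Y1 t) \<le> D"
      unfolding X1_def Y1_def using elim by (auto intro!: degree_add_le degree_diff_le order.trans[OF degree_smult_le])
    have "wronskian (X1 t) (Y1 t) = smult 1 (wronskian (X t) (Y t))"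
      unfolding X1_def Y1_def wronskian_linear_combination det ..
    then have "wronskian (P t) (Q t) = hcomp (2 * D - 2) (wronskian (X t) (Y t)) b0 b1"
      unfolding P_def Q_def wronskian_hcomp[OF dX1 D0] Wb by simp
    then have "hev (2 * D - 2) (wronskian (X t) (Y t)) (s0 t) (s1 t) = 0"
      using elim(1) by (simp add: poly_hcomp s0_def s1_def)
    with elim(3) sne[of t] have "\<exists>e<q. (rat_eval (f t) ^^ e) (rat_eval (M t) (of_hom (s0 t, s1 t))) \<in> critical_set d (f t)"
      by blast
    from someI_ex[OF this[unfolded Bex_def]] show ?case unfolding e_def \<omega>_def by blast
  qed
  \<comment> \<open>The image of the critical point has homogeneous coordinates P, Q in the target coordinates. Dividing by Q,
    which does not vanish, one gets the limit (w0, w1).\<close>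
  define T where "T t = poly (P t) (\<zeta> t) / poly (Q t) (\<zeta> t)" for t
  define xy where "xy = rec_nat (\<lambda>t. (\<mu> * T t + w0, - \<kappa> * T t + w1))
    (\<lambda>_ V t. (hev D (X t) (fst (V t)) (snd (V t)), hev D (Y t) (fst (V t)) (snd (V t))))"
  define x y where "x k t = fst (xy k t)" and "y k t = snd (xy k t)" for k t
  have x0: "x 0 t = \<mu> * T t + w0" "y 0 t = - \<kappa> * T t + w1" for t by (simp_all add: x_def y_def xy_def)
  have xS: "x (Suc k) t = hev D (X t) (x k t) (y k t)" "y (Suc k) t = hev D (Y t) (x k t) (y k t)" for k t
    by (simp_all add: x_def y_def xy_def)
  define uv where "uv = rec_nat (w0, w1) (\<lambda>_ V. (hev D p (fst V) (snd V), hev D r (fst V) (snd V)))"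
  define u v' where "u k = fst (uv k)" and "v' k = snd (uv k)" for k
  have u0: "u 0 = w0" "v' 0 = w1" by (simp_all add: u_def v'_def uv_def)
  have uS: "u (Suc k) = hev D p (u k) (v' k)" "v' (Suc k) = hev D r (u k) (v' k)" for k
    by (simp_all add: u_def v'_def uv_def)
  have lims: "(x k \<longlongrightarrow> u k) (at 0) \<and> (y k \<longlongrightarrow> v' k) (at 0)" for k
  proof (induction k)
    case 0
    have "(T \<longlongrightarrow> 0) (at 0)" using ze(3) by (simp add: T_def[abs_def])
    then have "((\<lambda>t. \<mu> * T t + w0) \<longlongrightarrow> \<mu> * 0 + w0) (at 0)" "((\<lambda>t. - \<kappa> * T t + w1) \<longlongrightarrow> - \<kappa> * 0 + w1) (at 0)"
      by (intro tendsto_add tendsto_mult tendsto_const; assumption)+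
    then show ?case by (simp add: x0[abs_def] u0)
  next
    case (Suc k)
    have Xc: "((\<lambda>t. coeff (X t) i) \<longlongrightarrow> coeff p i) (at 0)" "((\<lambda>t. coeff (Y t) i) \<longlongrightarrow> coeff r i) (at 0)" for i
      using poly_expands_tendsto[OF X] poly_expands_tendsto[OF Y] by (auto simp: poly_tendsto_def p_def r_def)
    show ?case unfolding xS[abs_def] uS using Suc by (auto intro!: tendsto_form Xc)
  qed
  have dir: "(u k, v' k) \<noteq> (0, 0) \<and> of_hom (u k, v' k) = z (Suc N + k)" for k
  proof (induction k)
    case 0
    show ?case using wne wz by (simp add: u0 del: of_hom.simps)
  next
    case (Suc k)
    then have ne: "(u k, v' k) \<noteq> (0, 0)" and eq: "of_hom (u k, v' k) = z (Suc N + k)" by auto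
    have "z (Suc N + k) \<notin> Z" by (rule good) simp
    then have "hev (2 * D - 2) W (u k) (v' k) \<noteq> 0"
      using in_form_zeros_iff[OF ne, of "2 * D - 2" W] by (simp add: Z_def eq del: of_hom.simps)
    then have hne: "hev (D - \<delta>) h (u k) (v' k) \<noteq> 0" by (auto simp: hevW)
    have "(hev \<delta> (fst g) (u k) (v' k), hev \<delta> (snd g) (u k) (v' k)) \<noteq> (0, 0)" by (rule Rat_nonvanishing[OF gR ne])
    then have "(u (Suc k), v' (Suc k)) \<noteq> (0, 0)" unfolding uS H(3,4) using hne by auto
    moreover have "of_hom (u (Suc k), v' (Suc k)) = z (Suc N + Suc k)"
      unfolding uS H(3,4) of_hom_scale[OF hne] rat_eval_of_hom[OF gR ne, symmetric] eq by (simp add: z_def)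
    ultimately show ?case by simp
  qed
  have orbit: "\<forall>\<^sub>F t in at 0. (x k t, y k t) \<noteq> (0, 0) \<and>
     (rat_eval (f t) ^^ (q * Suc k)) (rat_eval (M t) (of_hom (s0 t, s1 t))) = rat_eval (M t) (of_hom (x k t, y k t))" for k
  proof (induction k)
    case 0
    show ?case using ze(2) rep[unfolded represents_def] MR
    proof eventually_elim
      case (elim t)
      define c where "c = poly (Q t) (\<zeta> t)"
      have c: "c \<noteq> 0" using elim(1) by (simp add: c_def)
      define G0 G1 where "G0 = hev D (X t) (s0 t) (s1 t)" and "G1 = hev D (Y t) (s0 t) (s1 t)"
      have PQ: "poly (P t) (\<zeta> t) = w1 * G0 - w0 * G1" "c = \<kappa> * G0 + \<mu> * G1"
        unfolding c_def P_def Q_def poly_hcomp X1_def Y1_def form_add[OF ring_map_id] form_smult[OF ring_map_id]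
        by (simp_all add: G0_def G1_def s0_def s1_def)
      have "T t * c = w1 * G0 - w0 * G1" using c PQ by (simp add: T_def c_def)
      then have "G0 = c * x 0 t" "G1 = c * y 0 t"
        using lm PQ(2) unfolding x0 by algebra+
      then have G: "(G0, G1) = (c * x 0 t, c * y 0 t)" by simp
      have 1: "(G0, G1) \<noteq> (0, 0)" "inv (rat_eval (M t)) ((rat_eval (f t) ^^ q) (rat_eval (M t) (of_hom (s0 t, s1 t)))) = of_hom (G0, G1)"
        using elim(2) sne[of t] by (auto simp: G0_def G1_def simp del: of_hom.simps)
      have "(rat_eval (f t) ^^ q) (rat_eval (M t) (of_hom (s0 t, s1 t))) = rat_eval (M t) (of_hom (G0, G1))"
        using frame_inverse(1)[OF elim(3)] 1(2) by metis
      then show ?case using 1(1) unfolding G of_hom_scale[OF c] by (auto simp del: of_hom.simps)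
    qed
  next
    case (Suc k)
    show ?case using Suc rep[unfolded represents_def] MR
    proof eventually_elim
      case (elim t)
      have 1: "(x (Suc k) t, y (Suc k) t) \<noteq> (0, 0)"
        "inv (rat_eval (M t)) ((rat_eval (f t) ^^ q) (rat_eval (M t) (of_hom (x k t, y k t)))) = of_hom (x (Suc k) t, y (Suc k) t)"
        using elim(1,2) unfolding xS by blast+
      have "q * Suc (Suc k) = q + q * Suc k" by simp
      then have "(rat_eval (f t) ^^ (q * Suc (Suc k))) (rat_eval (M t) (of_hom (s0 t, s1 t)))
          = (rat_eval (f t) ^^ q) (rat_eval (M t) (of_hom (x k t, y k t)))"
        using elim(1) by (simp only: funpow_add comp_apply)
      also have "\<dots> = rat_eval (M t) (of_hom (x (Suc k) t, y (Suc k) t))"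
        using frame_inverse(1)[OF elim(3)] 1(2) by metis
      finally show ?case using 1(1) by blast
    qed
  qed
  show thesis
  proof (rule that[of \<omega> e x u y v'])
    show "\<forall>\<^sub>F t in at 0. \<omega> t \<in> critical_set d (f t) \<and> e t < q" by (rule om)
    show "(x k \<longlongrightarrow> u k) (at 0)" "(y k \<longlongrightarrow> v' k) (at 0)" "(u k, v' k) \<noteq> (0, 0)" for k
      using lims dir by auto
    show "inj (\<lambda>k. of_hom (u k, v' k))"
      using dir zinj by (auto intro!: injI dest: injD simp del: of_hom.simps)
    show "\<forall>\<^sub>F t in at 0. (x k t, y k t) \<noteq> (0, 0) \<and>
       (rat_eval (f t) ^^ (q * Suc k - e t)) (\<omega> t) = rat_eval (M t) (of_hom (x k t, y k t))" for k
      using orbit[of k] om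
    proof eventually_elim
      case (elim t)
      have "e t \<le> q * Suc k" using elim(2) by simp
      then have "q * Suc k = (q * Suc k - e t) + e t" by simp
      then have "(rat_eval (f t) ^^ (q * Suc k)) (rat_eval (M t) (of_hom (s0 t, s1 t))) = (rat_eval (f t) ^^ (q * Suc k - e t)) (\<omega> t)"
        unfolding \<omega>_def by (metis comp_apply funpow_add)
      then show ?case using elim(1) by simp
    qed
  qed
qed

section \<open>Counting rescalings\<close>

text \<open>
  The orbit starts in the frame \<open>M\<close> and passes through \<open>\<omega> t\<close> after \<open>e t\<close> steps. The visits to \<open>M\<close> after
  \<open>q\<close>, \<open>2 q\<close>, ... steps are thus counted from \<open>\<omega> t\<close> with the delay \<open>e t\<close> subtracted.
\<close>

definition attached_critical_point ::
  "nat \<Rightarrow> ('a::nonarch_field \<Rightarrow> 'a rat_coords) \<Rightarrow> ('a \<Rightarrow> 'a rat_coords) \<Rightarrow> nat \<Rightarrow> ('a \<Rightarrow> 'a pline) \<Rightarrow> ('a \<Rightarrow> nat) \<Rightarrow> bool" where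
  "attached_critical_point d f M q \<omega> e \<longleftrightarrow>
     (\<forall>\<^sub>F t in at 0. \<omega> t \<in> critical_set d (f t) \<and> e t < q) \<and>
     (\<exists>x y u v. inj (\<lambda>k::nat. of_hom (u k, v k)) \<and> (\<forall>k. (u k, v k) \<noteq> (0, 0) \<and>
        (x k \<longlongrightarrow> u k) (at 0) \<and> (y k \<longlongrightarrow> v k) (at 0) \<and>
        (\<forall>\<^sub>F t in at 0. (x k t, y k t) \<noteq> (0, 0) \<and>
           (rat_eval (f t) ^^ (q * Suc k - e t)) (\<omega> t) = rat_eval (M t) (of_hom (x k t, y k t)))))"

lemma exists_attached_critical_point:
  fixes f M :: "'a::{nonarch_field, alg_closed_field, field_char_0} \<Rightarrow> 'a rat_coords"
  assumes "d > 0" "analytic_family d f" "moving_frame M" "rescaling_limit f M q g" "\<not> postcritically_finite g"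
  shows "\<exists>\<omega> e. attached_critical_point d f M q \<omega> e"
proof -
  obtain \<omega> e x y u v where
    "\<forall>\<^sub>F t in at 0. \<omega> t \<in> critical_set d (f t) \<and> e t < q"
    "\<And>k. (x k \<longlongrightarrow> u k) (at 0)" "\<And>k. (y k \<longlongrightarrow> v k) (at 0)" "\<And>k. (u k, v k) \<noteq> (0::'a, 0::'a)"
    "inj (\<lambda>k. of_hom (u k, v k))"
    "\<And>k. \<forall>\<^sub>F t in at 0. (x k t, y k t) \<noteq> (0, 0) \<and>
       (rat_eval (f t) ^^ (q * Suc k - e t)) (\<omega> t) = rat_eval (M t) (of_hom (x k t, y k t))"
    by (rule critical_orbit_of_rescaling[OF assms]) (rule that)
  then have "attached_critical_point d f M q \<omega> e"
    unfolding attached_critical_point_def by (intro conjI exI[of _ x] exI[of _ y] exI[of _ u] exI[of _ v] allI)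
  then show ?thesis by blast
qed

text \<open>
  Suppose that \<open>L\<close> cannot be reached from \<open>M\<close>. Then $L_t^{-1} \circ f_t^E \circ M_t$ has a constant limit outside a finite set, for
  every \<open>E\<close>. For a suitable \<open>E\<close>, infinitely many returns of the common critical point to \<open>M\<close> are followed, \<open>E\<close> steps
  later, by a return to \<open>L\<close>. Almost all of these take place in the same direction at \<open>L\<close>, contrary to the
  distinctness of the directions.
\<close>

lemma dynamically_dependent_if_shared_critical_point:
  fixes f M L :: "'a::{nonarch_field, alg_closed_field, field_char_0} \<Rightarrow> 'a rat_coords"
  assumes d: "d > 0" and f: "analytic_family d f" and M: "moving_frame M" and L: "moving_frame L"
    and q: "q > 0" "q' > 0" and ab: "a < q" "b < q'"
    and att: "attached_critical_point d f M q \<omega> e" and att': "attached_critical_point d f L q' \<omega>' e'"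
    and freq: "\<exists>\<^sub>F t in at 0. \<omega> t = \<omega>' t \<and> e t = a \<and> e' t = b"
  shows "dynamically_dependent f M L"
proof (rule ccontr)
  assume indep: "\<not> dynamically_dependent f M L"
  define G where "G = inf (at 0) (principal {t. \<omega> t = \<omega>' t \<and> e t = a \<and> e' t = b})"
  have G: "G \<noteq> bot"
  proof
    assume "G = bot"
    then have "\<forall>\<^sub>F t in G. False" by simp
    then have "\<forall>\<^sub>F t in at 0. \<not> (\<omega> t = \<omega>' t \<and> e t = a \<and> e' t = b)"
      unfolding G_def eventually_inf_principal by (auto elim: eventually_mono)
    then show False using freq by (simp add: frequently_def)
  qed
  have Gle: "G \<le> at 0" by (simp add: G_def)
  have inG: "\<forall>\<^sub>F t in G. \<omega> t = \<omega>' t \<and> e t = a \<and> e' t = b"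
    unfolding G_def eventually_inf_principal by simp
  obtain x y u v where inj1: "inj (\<lambda>k::nat. of_hom (u k, v k))"
    and D1: "\<And>k. (u k, v k) \<noteq> (0, 0) \<and> (x k \<longlongrightarrow> u k) (at 0) \<and> (y k \<longlongrightarrow> v k) (at 0) \<and>
        (\<forall>\<^sub>F t in at 0. (x k t, y k t) \<noteq> (0, 0) \<and>
           (rat_eval (f t) ^^ (q * Suc k - e t)) (\<omega> t) = rat_eval (M t) (of_hom (x k t, y k t)))"
    using att unfolding attached_critical_point_def by blast
  obtain x' y' u' v' where inj2: "inj (\<lambda>k::nat. of_hom (u' k, v' k))"
    and D2: "\<And>k. (u' k, v' k) \<noteq> (0, 0) \<and> (x' k \<longlongrightarrow> u' k) (at 0) \<and> (y' k \<longlongrightarrow> v' k) (at 0) \<and>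
        (\<forall>\<^sub>F t in at 0. (x' k t, y' k t) \<noteq> (0, 0) \<and>
           (rat_eval (f t) ^^ (q' * Suc k - e' t)) (\<omega>' t) = rat_eval (L t) (of_hom (x' k t, y' k t)))"
    using att' unfolding attached_critical_point_def by blast
  \<comment> \<open>The time from the first return to M to the return number q to L, which is late enough to make E nonnegative.
    Advancing by q * q' steps gives further pairs of returns at the same distance.\<close>
  define E where "E = (q' * Suc q - b) - (q - a)"
  have time: "q' * Suc (q + i * q) - b = E + (q * Suc (i * q') - a)" for i
  proof -
    have "q \<le> q' * q" using q by simp
    moreover have "b \<le> q'" using ab by simp
    moreover have "q' * Suc q = q' + q' * q" by simp
    ultimately have "b + (q - a) \<le> q' * Suc q" by linarith
    then have 1: "q - a \<le> q' * Suc q - b" by linarith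
    have 2: "q' * Suc (q + i * q) - b = (q' * Suc q - b) + i * (q * q')"
      using \<open>b \<le> q'\<close> by (simp add: algebra_simps)
    have 3: "q * Suc (i * q') - a = (q - a) + i * (q * q')" using ab by (simp add: algebra_simps)
    show ?thesis unfolding 2 3 E_def using 1 by simp
  qed
  define D where "D = d ^ E"
  obtain X Y \<X> \<Y> where X: "poly_expands X \<X>" and Y: "poly_expands Y \<Y>"
    and dXY: "degree \<X> \<le> D" "degree \<Y> \<le> D" and nd: "nondegenerate D \<X> \<Y>"
    and nz: "reduction \<X> \<noteq> 0 \<or> reduction \<Y> \<noteq> 0"
    and degt: "\<forall>\<^sub>F t in at 0. degree (X t) \<le> D \<and> degree (Y t) \<le> D"
    and rep: "represents D (\<lambda>t z. inv (rat_eval (L t)) ((rat_eval (f t) ^^ E) (rat_eval (M t) z))) X Y"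
    and crit: "\<forall>\<^sub>F t in at 0. \<forall>x y. (x, y) \<noteq> (0, 0) \<longrightarrow> hev (2 * D - 2) (wronskian (X t) (Y t)) x y = 0 \<longrightarrow>
       (\<exists>e<E. (rat_eval (f t) ^^ e) (rat_eval (M t) (of_hom (x, y))) \<in> critical_set d (f t))"
    by (rule frame_change_family[OF d f M L, of E, folded D_def]) (rule that)
  have LR: "\<forall>\<^sub>F t in at 0. L t \<in> Rat 1"
    using analytic_family_formal[OF L[unfolded moving_frame_def]] by metis
  obtain h A B where h: "h \<noteq> 0" "reduction \<X> = h * A" "reduction \<Y> = h * B"
    and nr: "\<And>z. \<not> (poly A z = 0 \<and> poly B z = 0)"
    using common_factor[OF nz] by blast
  have "\<not> max (degree A) (degree B) \<ge> 1"
    using dynamically_dependent_if_nonconstant[OF X Y dXY rep h nr] indep by blast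
  then have "degree A = 0" "degree B = 0" by auto
  then obtain \<alpha> \<beta> where AB: "A = [:\<alpha>:]" "B = [:\<beta>:]" by (metis degree_eq_zeroE)
  have abne: "(\<alpha>, \<beta>) \<noteq> (0, 0)" using nr[of 0] by (auto simp: AB)
  have redX: "reduction \<X> = smult \<alpha> h" "reduction \<Y> = smult \<beta> h" by (simp_all add: h AB)
  have dh: "degree h \<le> D"
    using degree_reduction_le[OF dXY(1)] degree_reduction_le[OF dXY(2)] abne unfolding redX by auto
  define Z where "Z = {z. hev D h (fst (hom_coords z)) (snd (hom_coords z)) = 0}"
  have Zfin: "finite Z" unfolding Z_def by (rule form_zeros(1)[OF h(1) dh])
  have key: "of_hom (u' (q + i * q), v' (q + i * q)) = of_hom (\<alpha>, \<beta>)" if i: "of_hom (u (i * q'), v (i * q')) \<notin> Z" for i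
  proof -
    define k j where "k = i * q'" and "j = q + i * q"
    have une: "(u k, v k) \<noteq> (0, 0)" "(u' j, v' j) \<noteq> (0, 0)" using D1 D2 by blast+
    have hne: "hev D h (u k) (v k) \<noteq> 0"
      using i in_form_zeros_iff[OF une(1), of D h] by (simp add: Z_def k_def del: of_hom.simps)
    have meet: "\<forall>\<^sub>F t in G. hev D (X t) (x k t) (y k t) * y' j t = x' j t * hev D (Y t) (x k t) (y k t)"
      using inG filter_leD[OF Gle D1[of k, THEN conjunct2, THEN conjunct2, THEN conjunct2]]
        filter_leD[OF Gle D2[of j, THEN conjunct2, THEN conjunct2, THEN conjunct2]]
        filter_leD[OF Gle LR] filter_leD[OF Gle rep[unfolded represents_def]]
    proof eventually_elim
      case (elim t)
      have w: "\<omega>' t = \<omega> t" "e t = a" "e' t = b" using elim(1) by auto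
      have "rat_eval (L t) (of_hom (x' j t, y' j t)) = (rat_eval (f t) ^^ (E + (q * Suc k - a))) (\<omega> t)"
        using elim(3) unfolding w time[of i, folded k_def j_def, symmetric] by simp
      also have "\<dots> = (rat_eval (f t) ^^ E) (rat_eval (M t) (of_hom (x k t, y k t)))"
        using elim(2) unfolding w by (simp only: funpow_add comp_apply)
      finally have "inv (rat_eval (L t)) ((rat_eval (f t) ^^ E) (rat_eval (M t) (of_hom (x k t, y k t)))) = of_hom (x' j t, y' j t)"
        using frame_inverse(2)[OF elim(4)] by metis
      moreover have "(hev D (X t) (x k t) (y k t), hev D (Y t) (x k t) (y k t)) \<noteq> (0, 0)"
        "inv (rat_eval (L t)) ((rat_eval (f t) ^^ E) (rat_eval (M t) (of_hom (x k t, y k t))))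
          = of_hom (hev D (X t) (x k t) (y k t), hev D (Y t) (x k t) (y k t))"
        using elim(5) elim(2) by blast+
      ultimately show ?case using of_hom_eq_iff elim(3) by metis
    qed
    have lim: "(x k \<longlongrightarrow> u k) G" "(y k \<longlongrightarrow> v k) G" "(x' j \<longlongrightarrow> u' j) G" "(y' j \<longlongrightarrow> v' j) G"
      using D1[of k] D2[of j] tendsto_mono[OF Gle] by blast+
    have "((\<lambda>t. hev D (X t) (x k t) (y k t)) \<longlongrightarrow> hev D (reduction \<X>) (u k) (v k)) G"
      "((\<lambda>t. hev D (Y t) (x k t) (y k t)) \<longlongrightarrow> hev D (reduction \<Y>) (u k) (v k)) G"
      using poly_expands_tendsto[OF X] poly_expands_tendsto[OF Y] tendsto_mono[OF Gle]
      by (auto intro!: tendsto_form lim simp: poly_tendsto_def)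
    then have lim2: "((\<lambda>t. hev D (X t) (x k t) (y k t) * y' j t) \<longlongrightarrow> hev D (reduction \<X>) (u k) (v k) * v' j) G"
      "((\<lambda>t. x' j t * hev D (Y t) (x k t) (y k t)) \<longlongrightarrow> u' j * hev D (reduction \<Y>) (u k) (v k)) G"
      by (auto intro!: tendsto_mult lim)
    from tendsto_unique[OF G tendsto_cong[OF meet, THEN iffD1, OF lim2(1)] lim2(2)]
    have "hev D (reduction \<X>) (u k) (v k) * v' j = u' j * hev D (reduction \<Y>) (u k) (v k)" .
    then have "hev D h (u k) (v k) * (\<alpha> * v' j) = hev D h (u k) (v k) * (u' j * \<beta>)"
      unfolding redX form_smult[OF ring_map_id] by (simp add: mult_ac)
    then have "u' j * \<beta> = \<alpha> * v' j" using hne by simp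
    then show ?thesis unfolding j_def[symmetric] by (simp only: of_hom_eq_iff[OF une(2) abne])
  qed
  have "inj (\<lambda>i. of_hom (u (i * q'), v (i * q')))"
    using inj1 q by (auto intro!: injI dest!: injD simp del: of_hom.simps)
  then have "finite ((\<lambda>i. of_hom (u (i * q'), v (i * q'))) -` Z)" by (rule finite_vimageI[OF Zfin])
  then obtain n where n: "\<forall>i\<in>(\<lambda>i. of_hom (u (i * q'), v (i * q'))) -` Z. i < n"
    unfolding finite_nat_set_iff_bounded by (elim exE)
  have far: "of_hom (u (i * q'), v (i * q')) \<notin> Z" if "i \<ge> n" for i
  proof
    assume "of_hom (u (i * q'), v (i * q')) \<in> Z"
    then have "i < n" by (intro n[rule_format] vimageI2)
    then show False using that by simp
  qed
  have "of_hom (u' (q + n * q), v' (q + n * q)) = of_hom (u' (q + Suc n * q), v' (q + Suc n * q))"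
    by (rule trans[OF key[OF far] key[OF far, symmetric]]) simp_all
  then have "q + n * q = q + Suc n * q" using injD[OF inj2] by blast
  then show False using q by simp
qed

theorem corollary1p2:
  fixes f :: "'a::{nonarch_field, complete_space, alg_closed_field, field_char_0} \<Rightarrow> 'a rat_coords"
    and d :: nat
    and R :: "('a \<Rightarrow> 'a rat_coords) set"
  assumes "d \<ge> 2"
    and "analytic_family d f"
    and "\<And>M. M \<in> R \<Longrightarrow> rescaling f M"
    and "\<And>M. M \<in> R \<Longrightarrow> \<exists>q g. rescaling_limit f M q g \<and> \<not> postcritically_finite g"
    and "pairwise (\<lambda>M L. \<not> dynamically_dependent f M L) R"
  shows "finite R \<and> card R \<le> 2 * d - 2"
proof (rule ccontr)
  assume neg: "\<not> (finite R \<and> card R \<le> 2 * d - 2)"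
  obtain S where S: "S \<subseteq> R" "finite S" "card S = Suc (2 * d - 2)"
  proof (cases "finite R")
    case True
    then have "Suc (2 * d - 2) \<le> card R" using neg by simp
    then show thesis using that obtain_subset_with_card_n by metis
  next
    case False
    then show thesis using that infinite_arbitrarily_large by metis
  qed
  have d: "d > 0" using assms(1) by simp
  have frame: "moving_frame M" if "M \<in> R" for M using assms(3)[OF that] by (simp add: rescaling_def)
  have "\<forall>M\<in>R. \<exists>q \<omega> e. q > 0 \<and> attached_critical_point d f M q \<omega> e"
  proof
    fix M assume MR: "M \<in> R"
    obtain q g where g: "rescaling_limit f M q g" "\<not> postcritically_finite g" using assms(4)[OF MR] by blast
    then have "q > 0" by (simp add: rescaling_limit_def)
    then show "\<exists>q \<omega> e. q > 0 \<and> attached_critical_point d f M q \<omega> e"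
      using exists_attached_critical_point[OF d assms(2) frame[OF MR] g] by blast
  qed
  then obtain q \<omega> e where att: "\<And>M. M \<in> R \<Longrightarrow> q M > 0 \<and> attached_critical_point d f M (q M) (\<omega> M) (e M)"
    by metis
  \<comment> \<open>The coincidences depend on t, but there are only finitely many kinds of them.\<close>
  define I where "I = {(M, L, a, b). M \<in> S \<and> L \<in> S \<and> M \<noteq> L \<and> a < q M \<and> b < q L}"
  have "I \<subseteq> S \<times> S \<times> (\<Union>M\<in>S. {..<q M}) \<times> (\<Union>M\<in>S. {..<q M})" by (auto simp: I_def)
  then have I: "finite I" by (rule finite_subset) (use S(2) in auto)
  have "\<forall>\<^sub>F t in at 0. \<omega> M t \<in> critical_set d (f t) \<and> e M t < q M" if "M \<in> S" for M
    using att[of M] that S(1) by (auto simp: attached_critical_point_def)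
  then have "\<forall>\<^sub>F t in at 0. \<forall>M\<in>S. \<omega> M t \<in> critical_set d (f t) \<and> e M t < q M"
    using S(2) by (simp add: eventually_ball_finite)
  moreover have "\<forall>\<^sub>F t in at 0. f t \<in> Rat d" using analytic_family_formal[OF assms(2)] by metis
  ultimately have "\<forall>\<^sub>F t in at 0. \<exists>(M, L, a, b)\<in>I. \<omega> M t = \<omega> L t \<and> e M t = a \<and> e L t = b"
  proof eventually_elim
    case (elim t)
    note C = critical_set_card[OF elim(2) d]
    have "\<not> inj_on (\<lambda>M. \<omega> M t) S"
    proof
      assume "inj_on (\<lambda>M. \<omega> M t) S"
      then have "card S \<le> card (critical_set d (f t))"
        by (rule card_inj_on_le[OF _ _ C(1)]) (use elim in auto)
      then show False using C(2) S(3) by simp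
    qed
    then obtain M L where pair: "M \<in> S" "L \<in> S" "M \<noteq> L" "\<omega> M t = \<omega> L t" by (auto simp: inj_on_def)
    then have "(M, L, e M t, e L t) \<in> I" using elim by (auto simp: I_def)
    then show ?case using pair by (intro bexI[of _ "(M, L, e M t, e L t)"]) auto
  qed
  then have "\<exists>\<^sub>F t in at 0. \<exists>(M, L, a, b)\<in>I. \<omega> M t = \<omega> L t \<and> e M t = a \<and> e L t = b"
    by (rule eventually_frequently[OF at_0_neq_bot])
  then have "\<exists>x\<in>I. \<exists>\<^sub>F t in at 0. (case x of (M, L, a, b) \<Rightarrow> \<omega> M t = \<omega> L t \<and> e M t = a \<and> e L t = b)"
    by (simp only: frequently_bex_finite_distrib[OF I])
  then obtain M L a b where pair: "(M, L, a, b) \<in> I" "\<exists>\<^sub>F t in at 0. \<omega> M t = \<omega> L t \<and> e M t = a \<and> e L t = b"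
    by auto
  then have R: "M \<in> R" "L \<in> R" "M \<noteq> L" and ab: "a < q M" "b < q L" using S(1) by (auto simp: I_def)
  have "dynamically_dependent f M L"
    by (rule dynamically_dependent_if_shared_critical_point[OF d assms(2) frame[OF R(1)] frame[OF R(2)] _ _ ab _ _ pair(2)])
      (use att R in auto)
  then show False using assms(5) R by (auto simp: pairwise_def)
qed

end
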